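(* For every $k\in\mathbb N$, the mapping $\mathfrak r:\mathfrak X_k\to\mathcal R_k$, which sends $q$ to the sequence $\mathfrak r(q)=(r_n(q))_{n=1}^k$ of roots (with multiplicity) of the Jost function $\psi_0(\cdot,q)$ of the Jacobi operator with perturbation $q$, is a bijection between $\mathfrak X_k$ and $\mathcal R_k$. There is an algorithm to recover the perturbation $q$ from $\mathfrak r(q)$.
   Context: $\mathbb N=\{1,2,\dots\}$. For real bounded sequences $(a_x)_{x\ge1}$, $(b_x)_{x\ge1}$ with $a_x>0$, the Jacobi operator $J$ on $\ell^2(\mathbb N)$ is $(Jf)_x=a_xf_{x+1}+b_xf_x+a_{x-1}f_{x-1}$, $x\ge1$, with $f_0=0$ formally and $a_0=1$. Its perturbation is $q=q(a,b)=(b_1,a_1-1,b_2,a_2-1,\dots)$. For $k\in\mathbb N$, $\mathfrak X_k=\{h\in\ell^\infty(\mathbb N)\ \text{real}:\ h_{2x}>-1\ \forall x\in\mathbb N,\ h_k\ne0,\ h_x=0\ \forall x>k\}$. For $q\in\mathfrak X_k$ with $k\in\{2p-1,2p\}$, the Jost solution $(\psi_x(z))_{x\ge0}$, $z\ne0$, is defined by $a_{x-1}\psi_{x-1}+a_x\psi_{x+1}+b_x\psi_x=(z+z^{-1})\psi_x$ for $x\ge1$ and $\psi_x(z)=z^x$ for $x>p$. The Jost function $\psi_0$ is a real polynomial of degree $k$. $\mathcal R_k\subset\mathbb C^k$ is the set of vectors $r=(r_n)_1^k$ (two vectors that are rearrangements of each other being identified, i.e. $r$ is regarded as a multiset of roots)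 such that, with $\mathbb D=\{|z|<1\}$: (R1) $0<|r_1|\le|r_2|\le\dots\le|r_k|$; (R2) the polynomial $f(z)=\prod_{n=1}^k(z-r_n)$ is real on the real line; (R3) all zeros of $f$ in $\overline{\mathbb D}$ are real and simple; denoting the zeros of $f$ in $\mathbb D$ by $-1<s_{-n_-}<\dots<s_{-1}<0<s_1<\dots<s_{n_+}<1$ ($n_\pm\ge0$), one has $f(s_j^{-1})\ne0$ for every $j\in\{-n_-,\dots,-1,1,\dots,n_+\}$; (R4) $f$ has an odd number $\ge1$ of zeros (counted with multiplicity) on each interval $(s_j^{-1},s_{j-1}^{-1})$, $j\in\{-n_-+1,\dots,-1\}\cup\{2,\dots,n_+\}$, and an even number $\ge0$ of zeros on each of the intervals $(1,s_{n_+}^{-1})$ (if $n_+\ge1$) and $(s_{-n_-}^{-1},-1)$ (if $n_-\ge1$).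
   Formalization: In (R4) the even counts are taken on [1, 1/s_{n_+}) and (1/s_{-n_-}, -1], endpoints ±1 included; with open intervals the claim fails, e.g. k=2 with roots s, 1 (0<s<1), which would need a_1^2 = 1-1/s < 0. *)

theory Defs
  imports
    "HOL-Analysis.Analysis"
    "HOL-Computational_Algebra.Computational_Algebra"
begin

section \<open>Jacobi operators and their perturbations\<close>

text \<open>
  Sequences indexed by the positive integers are functions on \<^typ>\<open>nat\<close>. The entries at 0 of the
  coefficient sequences carry the convention \<open>a\<^sub>0 = 1\<close> and a dummy value for \<open>b\<close>; perturbations are
  normalised by \<open>h 0 = 0\<close>, so that equality of functions is equality of sequences.

  The difference expression below is the Jacobi operator when it is applied to sequences with
  \<open>f\<^sub>0 = 0\<close>. The Jost solution solves the same difference equation without that restriction.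
\<close>

definition jacobi :: "(nat \<Rightarrow> real) \<Rightarrow> (nat \<Rightarrow> real) \<Rightarrow> (nat \<Rightarrow> complex) \<Rightarrow> nat \<Rightarrow> complex" where
  "jacobi a b f x =
     of_real (a x) * f (x + 1) + of_real (b x) * f x + of_real (a (x - 1)) * f (x - 1)"

definition perturbation :: "(nat \<Rightarrow> real) \<Rightarrow> (nat \<Rightarrow> real) \<Rightarrow> nat \<Rightarrow> real" where
  "perturbation a b n =
     (if n = 0 then 0 else if odd n then b ((n + 1) div 2) else a (n div 2) - 1)"

definition jacobi_a :: "(nat \<Rightarrow> real) \<Rightarrow> nat \<Rightarrow> real" where
  "jacobi_a q x = (if x = 0 then 1 else 1 + q (2 * x))"

definition jacobi_b :: "(nat \<Rightarrow> real) \<Rightarrow> nat \<Rightarrow> real" where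
  "jacobi_b q x = (if x = 0 then 0 else q (2 * x - 1))"

lemma perturbation_jacobi:
  assumes "q 0 = 0"
  shows "perturbation (jacobi_a q) (jacobi_b q) = q"
  using assms by (auto simp: perturbation_def jacobi_a_def jacobi_b_def fun_eq_iff elim!: oddE)

lemma jacobi_perturbation:
  assumes "a 0 = 1" and "b 0 = 0"
  shows "jacobi_a (perturbation a b) = a" and "jacobi_b (perturbation a b) = b"
  using assms by (auto simp: perturbation_def jacobi_a_def jacobi_b_def fun_eq_iff)

definition pert_class :: "nat \<Rightarrow> (nat \<Rightarrow> real) set" where
  "pert_class k =
     {h. h 0 = 0 \<and> bounded (range h) \<and> (\<forall>x\<ge>1. h (2 * x) > - 1) \<and> h k \<noteq> 0 \<and> (\<forall>x>k. h x = 0)}"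


section \<open>The Jost function and its roots\<close>

text \<open>The number \<open>p\<close> with \<open>k \<in> {2p - 1, 2p}\<close> is \<open>(k + 1) div 2\<close>.\<close>

definition is_jost_solution :: "nat \<Rightarrow> (nat \<Rightarrow> real) \<Rightarrow> complex \<Rightarrow> (nat \<Rightarrow> complex) \<Rightarrow> bool" where
  "is_jost_solution k q z \<psi> \<longleftrightarrow>
     (\<forall>x\<ge>1. jacobi (jacobi_a q) (jacobi_b q) \<psi> x = (z + inverse z) * \<psi> x) \<and>
     (\<forall>x>(k + 1) div 2. \<psi> x = z ^ x)"

definition jost_solution :: "nat \<Rightarrow> (nat \<Rightarrow> real) \<Rightarrow> complex \<Rightarrow> nat \<Rightarrow> complex" where
  "jost_solution k q z = (THE \<psi>. is_jost_solution k q z \<psi>)"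

text \<open>
  The Jost function is \<open>\<psi>\<^sub>0\<close>, which is a polynomial in \<open>z \<noteq> 0\<close>; as a member of \<^typ>\<open>complex poly\<close>
  it is determined by its values there.
\<close>

definition jost_poly :: "nat \<Rightarrow> (nat \<Rightarrow> real) \<Rightarrow> complex poly" where
  "jost_poly k q = (THE P. \<forall>z. z \<noteq> 0 \<longrightarrow> poly P z = jost_solution k q z 0)"

definition jost_roots :: "nat \<Rightarrow> (nat \<Rightarrow> real) \<Rightarrow> complex multiset" where
  "jost_roots k q = proots (jost_poly k q)"


section \<open>The admissible root multisets\<close>

definition root_poly :: "complex list \<Rightarrow> complex poly" where
  "root_poly r = (\<Prod>c\<leftarrow>r. [:- c, 1:])"

definition zeros_on :: "complex poly \<Rightarrow> real set \<Rightarrow> nat" where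
  "zeros_on f I = size {#z \<in># proots f. z \<in> of_real ` I#}"

definition zero_index :: "nat \<Rightarrow> nat \<Rightarrow> int set" where
  "zero_index m n = {- int m..int n} - {0}"

text \<open>\<open>m\<close> and \<open>n\<close> stand for \<open>n\<^sub>-\<close> and \<open>n\<^sub>+\<close>; they and the values of \<open>s\<close> on the index set are
  uniquely determined by \<open>f\<close>.\<close>

definition enumerates_disc_zeros :: "complex poly \<Rightarrow> nat \<Rightarrow> nat \<Rightarrow> (int \<Rightarrow> real) \<Rightarrow> bool" where
  "enumerates_disc_zeros f m n s \<longleftrightarrow>
     strict_mono_on (zero_index m n) s \<and>
     (\<forall>j\<in>zero_index m n. - 1 < s j \<and> s j < 1 \<and> (j < 0 \<longrightarrow> s j < 0) \<and> (0 < j \<longrightarrow> 0 < s j)) \<and>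
     {z. poly f z = 0 \<and> cmod z < 1} = (\<lambda>j. of_real (s j)) ` zero_index m n"

text \<open>
  The intervals in the last two conditions contain the endpoints 1 and -1. Zeros of \<open>f\<close> at 1 and
  -1 are allowed and have to be counted there: for \<open>f = (z - s) (z - 1)\<close> with \<open>0 < s < 1\<close> there are
  no zeros in the open interval \<open>(1, 1/s)\<close>, but a two-term perturbation with Jost function \<open>c f\<close>
  would need \<open>a\<^sub>1\<^sup>2 = 1 - 1/s < 0\<close>. For \<open>f\<close> without zeros at 1 and -1 the endpoints are immaterial.
\<close>

definition root_condition :: "complex list \<Rightarrow> bool" where
  "root_condition r \<longleftrightarrow> (let f = root_poly r in
     (\<forall>c\<in>set r. 0 < cmod c) \<and> sorted (map cmod r) \<and>
     (\<forall>x::real. poly f (of_real x) \<in> \<real>) \<and>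
     (\<forall>z. cmod z \<le> 1 \<and> poly f z = 0 \<longrightarrow> z \<in> \<real> \<and> order z f = 1) \<and>
     (\<exists>m n s. enumerates_disc_zeros f m n s \<and>
        (\<forall>j\<in>zero_index m n. poly f (of_real (inverse (s j))) \<noteq> 0) \<and>
        (\<forall>j\<in>{- int m + 1..- 1} \<union> {2..int n}.
           odd (zeros_on f {inverse (s j)<..<inverse (s (j - 1))})) \<and>
        (n \<ge> 1 \<longrightarrow> even (zeros_on f {1..<inverse (s (int n))})) \<and>
        (m \<ge> 1 \<longrightarrow> even (zeros_on f {inverse (s (- int m))<..- 1}))))"

text \<open>Vectors that are rearrangements of each other are identified by passing to multisets.\<close>

definition root_class :: "nat \<Rightarrow> complex multiset set" where
  "root_class k = mset ` {r. length r = k \<and> root_condition r}"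


section \<open>Algorithms over the reals\<close>

text \<open>
  An algorithm is a program for a real random access machine, with exact real arithmetic, square
  roots and comparisons. A store has natural number registers and real cells; cells are addressed
  by natural number expressions, so that one program treats inputs of every length. The only
  constants available for real numbers are 0 and 1.
\<close>

datatype nexp = NConst nat | Reg nat | NAdd nexp nexp | NSub nexp nexp

datatype rexp = RZero | ROne | Cell nexp
  | RAdd rexp rexp | RSub rexp rexp | RMul rexp rexp | RDiv rexp rexp | RSqrt rexp

datatype test = NLess nexp nexp | RLess rexp rexp

datatype prog = Skip | SetReg nat nexp | SetCell nexp rexp
  | Seq prog prog | Cond test prog prog | While test prog

type_synonym store = "(nat \<Rightarrow> nat) \<times> (nat \<Rightarrow> real)"

primrec nval :: "nexp \<Rightarrow> store \<Rightarrow> nat" where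
  "nval (NConst n) \<sigma> = n"
| "nval (Reg i) \<sigma> = fst \<sigma> i"
| "nval (NAdd e e') \<sigma> = nval e \<sigma> + nval e' \<sigma>"
| "nval (NSub e e') \<sigma> = nval e \<sigma> - nval e' \<sigma>"

primrec rval :: "rexp \<Rightarrow> store \<Rightarrow> real" where
  "rval RZero \<sigma> = 0"
| "rval ROne \<sigma> = 1"
| "rval (Cell e) \<sigma> = snd \<sigma> (nval e \<sigma>)"
| "rval (RAdd e e') \<sigma> = rval e \<sigma> + rval e' \<sigma>"
| "rval (RSub e e') \<sigma> = rval e \<sigma> - rval e' \<sigma>"
| "rval (RMul e e') \<sigma> = rval e \<sigma> * rval e' \<sigma>"
| "rval (RDiv e e') \<sigma> = rval e \<sigma> / rval e' \<sigma>"
| "rval (RSqrt e) \<sigma> = sqrt (rval e \<sigma>)"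

primrec holds :: "test \<Rightarrow> store \<Rightarrow> bool" where
  "holds (NLess e e') \<sigma> \<longleftrightarrow> nval e \<sigma> < nval e' \<sigma>"
| "holds (RLess e e') \<sigma> \<longleftrightarrow> rval e \<sigma> < rval e' \<sigma>"

text \<open>\<open>exec c \<sigma> \<tau>\<close>: the program \<open>c\<close> started in the store \<open>\<sigma>\<close> terminates in the store \<open>\<tau>\<close>.\<close>

inductive exec :: "prog \<Rightarrow> store \<Rightarrow> store \<Rightarrow> bool" where
  Skip: "exec Skip \<sigma> \<sigma>"
| SetReg: "exec (SetReg i e) \<sigma> ((fst \<sigma>)(i := nval e \<sigma>), snd \<sigma>)"
| SetCell: "exec (SetCell d e) \<sigma> (fst \<sigma>, (snd \<sigma>)(nval d \<sigma> := rval e \<sigma>))"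
| Seq: "exec c \<sigma> \<sigma>' \<Longrightarrow> exec d \<sigma>' \<tau> \<Longrightarrow> exec (Seq c d) \<sigma> \<tau>"
| CondTrue: "holds t \<sigma> \<Longrightarrow> exec c \<sigma> \<tau> \<Longrightarrow> exec (Cond t c d) \<sigma> \<tau>"
| CondFalse: "\<not> holds t \<sigma> \<Longrightarrow> exec d \<sigma> \<tau> \<Longrightarrow> exec (Cond t c d) \<sigma> \<tau>"
| WhileFalse: "\<not> holds t \<sigma> \<Longrightarrow> exec (While t c) \<sigma> \<sigma>"
| WhileTrue: "holds t \<sigma> \<Longrightarrow> exec c \<sigma> \<sigma>' \<Longrightarrow> exec (While t c) \<sigma>' \<tau> \<Longrightarrow> exec (While t c) \<sigma> \<tau>"

text \<open>
  The input for a vector of \<open>k\<close> complex numbers: \<open>k\<close> in register 0, real and imaginary part of its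
  entry \<open>i < k\<close> in the cells \<open>2i\<close> and \<open>2i + 1\<close>, and 0 everywhere else.
\<close>

definition input_store :: "complex list \<Rightarrow> store" where
  "input_store r =
     ((\<lambda>i. if i = 0 then length r else 0),
      (\<lambda>i. if i < 2 * length r then (if even i then Re (r ! (i div 2)) else Im (r ! (i div 2))) else 0))"

definition outputs :: "prog \<Rightarrow> complex list \<Rightarrow> (nat \<Rightarrow> real) \<Rightarrow> bool" where
  "outputs c r q \<longleftrightarrow> (\<exists>\<tau>. exec c (input_store r) \<tau> \<and> (\<forall>x\<in>{1..length r}. snd \<tau> x = q x))"

end

theory Submission
  imports Defs "HOL-Complex_Analysis.Complex_Analysis"
begin

text \<open>
  Write the Jost solution as \<open>\<psi>\<^sub>x(z) = z\<^sup>x A\<^sub>x(z) / (a\<^sub>x \<cdots> a\<^sub>p)\<close>. The \<open>A\<^sub>x\<close> are real polynomials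
  with \<open>A\<^sub>x(0) = 1\<close> and \<open>A\<^sub>x = 1\<close> for \<open>x \<ge> p\<close>, and the difference equation becomes
  \<open>A\<^sub>x = (1 - b z + z\<^sup>2) A\<^sub>x\<^sub>+\<^sub>1 - a\<^sup>2 z\<^sup>2 A\<^sub>x\<^sub>+\<^sub>2\<close> with \<open>a, b\<close> taken at \<open>x + 1\<close>
  (\<open>jost_factors\<close>). The Jost function is a multiple of \<open>A\<^sub>0\<close>, and \<open>A\<^sub>0\<close>, being normalised at 0, is the
  same information as its multiset of roots. So the question is which polynomials \<open>A\<^sub>0\<close> arise, and how
  to run the recurrence from \<open>A\<^sub>0\<close> alone.

  Two properties of a pair \<open>P = A\<^sub>x\<close>, \<open>Q = z A\<^sub>x\<^sub>+\<^sub>1\<close> carry the proof. The Wronskian of \<open>\<psi>(z)\<close> and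
  \<open>\<psi>(1/z)\<close> gives \<open>P(z) Q(1/z) - Q(z) P(1/z) = C (1/z - z)\<close> with \<open>C > 0\<close> (\<open>has_wronskian\<close>). The
  continued fraction of the Weyl function gives \<open>Im (Q/P) > 0\<close> on the upper half of the disc
  (\<open>herglotz\<close>).

  Injectivity: the Wronskian identity determines \<open>Q\<close> up to a factor from \<open>P\<close> (\<open>has_wronskian_unique\<close>),
  because the difference of two solutions leads to a polynomial that changes sign under
  \<open>z \<mapsto> 1/z\<close>. Hence \<open>A\<^sub>0\<close> determines \<open>A\<^sub>1\<close>, then the recurrence determines \<open>b\<^sub>1\<close>, \<open>a\<^sub>1\<close> and \<open>A\<^sub>2\<close>, and so on.

  Characterisation of the range: in the presence of the Wronskian identity, \<open>Q/P\<close> has positive imaginary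
  part exactly if \<open>P\<close> is \<open>admissible\<close>, that is, its zeros in the closed disc are real and simple and
  \<open>s P'(s) P(1/s) > 0\<close> at every zero \<open>s \<noteq> 0\<close> in the open disc (\<open>herglotz_admissible\<close>, \<open>admissible_herglotz\<close>). Indeed the
  identity makes \<open>Im (Q/P)\<close> positive on the upper half circle, the sign condition says that the
  residues of \<open>Q/P\<close> at its real poles are negative, and the maximum principle does the rest. As \<open>P'\<close>
  alternates in sign along consecutive real zeros, the sign condition is a statement about signs
  of \<open>P\<close> at the points \<open>1/s\<close>, that is, about parities of numbers of zeros between them
  (\<open>parity_conditions_iff\<close>); these are the conditions on \<open>\<R>\<^sub>k\<close>.

  Surjectivity: both properties are invariant under \<open>(P, Q) \<mapsto> (Q, -P)\<close>. So if \<open>P\<close> is admissible, its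
  partner \<open>Q = z X\<close> is admissible too, and positivity at 0 supplies \<open>X(0) > 0\<close> and later \<open>a\<^sup>2 > 0\<close>.
  The recurrence can therefore be run forwards from any admissible polynomial (\<open>jost_pair_step\<close>); the degree drops
  by two in each step until the constant polynomial 1 is reached.

  A partner of \<open>P\<close> is built explicitly, by adding the roots of \<open>P\<close> one after the other
  (\<open>has_wronskian_add_root\<close>). This takes only one division of polynomials per root and no linear system, and it
  is the first phase of the algorithm; the second phase is the recurrence above.
\<close>

section \<open>Real polynomials as complex polynomials\<close>

abbreviation cpoly :: "real poly \<Rightarrow> complex poly" where
  "cpoly \<equiv> map_poly complex_of_real"

lemma coeff_cpoly [simp]: "coeff (cpoly P) i = of_real (coeff P i)"
  by (simp add: coeff_map_poly)

lemma cpoly_add: "cpoly (P + Q) = cpoly P + cpoly Q"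
  and cpoly_diff: "cpoly (P - Q) = cpoly P - cpoly Q"
  and cpoly_uminus: "cpoly (- P) = - cpoly P"
  and cpoly_smult: "cpoly (smult c P) = smult (of_real c) (cpoly P)"
  and cpoly_mult: "cpoly (P * Q) = cpoly P * cpoly Q"
  by (auto intro!: poly_eqI simp: coeff_mult)

lemma cpoly_1 [simp]: "cpoly 1 = 1"
  by (auto intro!: poly_eqI simp: coeff_1)

lemma cpoly_power: "cpoly (P ^ n) = cpoly P ^ n"
  by (induction n) (simp_all add: cpoly_mult)

lemma cpoly_pCons [simp]: "cpoly (pCons c P) = pCons (of_real c) (cpoly P)"
  by (auto intro!: poly_eqI simp: coeff_pCons split: nat.splits)

lemma degree_cpoly [simp]: "degree (cpoly P) = degree P"
  by (rule degree_map_poly) simp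

lemma cpoly_eq_iff [simp]: "cpoly P = cpoly Q \<longleftrightarrow> P = Q"
  by (auto simp: poly_eq_iff)

lemma cpoly_eq_0_iff [simp]: "cpoly P = 0 \<longleftrightarrow> P = 0"
  by (auto simp: poly_eq_iff)

lemma poly_cpoly_of_real [simp]: "poly (cpoly P) (of_real x) = of_real (poly P x)"
  by (induction P) auto

lemma poly_cpoly_cnj: "poly (cpoly P) (cnj z) = cnj (poly (cpoly P) z)"
  by (induction P) auto

lemma pderiv_cpoly: "pderiv (cpoly P) = cpoly (pderiv P)"
  by (auto intro!: poly_eqI simp: coeff_pderiv)

lemma cpoly_of_real_coeffs:
  assumes "\<And>i. coeff f i \<in> \<real>"
  shows "f = cpoly (map_poly Re f)"
  using assms by (auto intro!: poly_eqI simp: coeff_map_poly of_real_Re)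

text \<open>
  A polynomial and its complex conjugate agree on the real line, which is infinite.
\<close>

lemma cpoly_of_real_values:
  assumes "\<And>x::real. poly f (of_real x) \<in> \<real>"
  shows "f = cpoly (map_poly Re f)"
proof -
  have "poly (f - map_poly cnj f) (of_real x) = 0" for x :: real
    using assms[of x] by (simp add: Reals_cnj_iff)
  then have "range complex_of_real \<subseteq> {z. poly (f - map_poly cnj f) z = 0}"
    by auto
  moreover have "infinite (range complex_of_real)"
    by (simp add: finite_image_iff inj_on_def infinite_UNIV_char_0)
  ultimately have "f - map_poly cnj f = 0"
    using poly_roots_finite finite_subset by blast
  then have "coeff f i = coeff (map_poly cnj f) i" for i
    by simp
  then have "coeff f i \<in> \<real>" for i
    by (metis coeff_map_poly complex_cnj_zero Reals_cnj_iff)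
  then show ?thesis
    by (rule cpoly_of_real_coeffs)
qed

section \<open>The Wronskian identity\<close>

text \<open>
  For \<open>P = A\<^sub>x\<close> and \<open>Q = z A\<^sub>x\<^sub>+\<^sub>1\<close> this is the constancy of the Wronskian
  \<open>a\<^sub>x (\<psi>\<^sub>x(z) \<psi>\<^sub>x\<^sub>+\<^sub>1(1/z) - \<psi>\<^sub>x\<^sub>+\<^sub>1(z) \<psi>\<^sub>x(1/z)) = 1/z - z\<close> with the powers of \<open>z\<close> absorbed and the
  product \<open>C = (a\<^sub>x\<^sub>+\<^sub>1 \<cdots> a\<^sub>p)\<^sup>2\<close> moved to the right. Writing it for functions of \<open>z \<noteq> 0\<close>, without reversed
  polynomials, keeps it uniform in the degrees.
\<close>

definition has_wronskian :: "complex poly \<Rightarrow> complex poly \<Rightarrow> complex \<Rightarrow> bool" where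
  "has_wronskian P Q C \<longleftrightarrow>
     (\<forall>z. z \<noteq> 0 \<longrightarrow>
        poly P z * poly Q (inverse z) - poly Q z * poly P (inverse z) = C * (inverse z - z))"

lemma has_wronskianD:
  "has_wronskian P Q C \<Longrightarrow> z \<noteq> 0 \<Longrightarrow>
     poly P z * poly Q (inverse z) - poly Q z * poly P (inverse z) = C * (inverse z - z)"
  by (simp add: has_wronskian_def)

lemma has_wronskian_swap: "has_wronskian P Q C \<Longrightarrow> has_wronskian Q (- P) C"
  by (simp add: has_wronskian_def)

lemma has_wronskian_smult:
  assumes "has_wronskian P Q C"
  shows "has_wronskian P (smult c Q) (c * C)"
  unfolding has_wronskian_def
proof (intro allI impI)
  fix z :: complex assume z: "z \<noteq> 0"
  have "c * (poly P z * poly Q (inverse z) - poly Q z * poly P (inverse z)) = c * (C * (inverse z - z))"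
    by (simp only: has_wronskianD[OF assms z])
  then show "poly P z * poly (smult c Q) (inverse z) - poly (smult c Q) z * poly P (inverse z)
      = c * C * (inverse z - z)"
    by (simp add: algebra_simps)
qed

lemma has_wronskian_diff:
  assumes "has_wronskian P Q C" "has_wronskian P Q' C'"
  shows "has_wronskian P (Q - Q') (C - C')"
  unfolding has_wronskian_def
proof (intro allI impI)
  fix z :: complex assume z: "z \<noteq> 0"
  have "poly P z * poly (Q - Q') (inverse z) - poly (Q - Q') z * poly P (inverse z)
      = (poly P z * poly Q (inverse z) - poly Q z * poly P (inverse z))
        - (poly P z * poly Q' (inverse z) - poly Q' z * poly P (inverse z))"
    by (simp add: algebra_simps)
  also have "\<dots> = (C - C') * (inverse z - z)"
    by (simp only: has_wronskianD[OF assms(1) z] has_wronskianD[OF assms(2) z] left_diff_distrib)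
  finally show "poly P z * poly (Q - Q') (inverse z) - poly (Q - Q') z * poly P (inverse z)
      = (C - C') * (inverse z - z)" .
qed

lemma has_wronskian_cnj:
  assumes "has_wronskian P Q C"
  shows "has_wronskian (map_poly cnj P) (map_poly cnj Q) (cnj C)"
  unfolding has_wronskian_def
proof (intro allI impI)
  fix z :: complex assume "z \<noteq> 0"
  with has_wronskianD[OF assms, of "cnj z"]
  have "cnj (poly P (cnj z) * poly Q (inverse (cnj z)) - poly Q (cnj z) * poly P (inverse (cnj z)))
     = cnj (C * (inverse (cnj z) - cnj z))"
    by simp
  then show "poly (map_poly cnj P) z * poly (map_poly cnj Q) (inverse z)
     - poly (map_poly cnj Q) z * poly (map_poly cnj P) (inverse z) = cnj C * (inverse z - z)"
    by (simp add: complex_cnj_inverse)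
qed

text \<open>
  One step of the recurrence towards smaller indices. The factor \<open>(1 - b z + z\<^sup>2) / z\<close> is invariant
  under \<open>z \<mapsto> 1/z\<close>, so its contributions to the two products cancel.
\<close>

lemma has_wronskian_step:
  assumes "has_wronskian P (pCons 0 Q) C"
  shows "has_wronskian ([:1, - b, 1:] * P - smult d ([:0, 0, 1:] * Q)) (pCons 0 P) (d * C)"
  unfolding has_wronskian_def
proof (intro allI impI)
  fix z :: complex assume z: "z \<noteq> 0"
  have *: "poly P z * (inverse z * poly Q (inverse z)) - (z * poly Q z) * poly P (inverse z) = C * (inverse z - z)"
    using has_wronskianD[OF assms z] by simp
  have A: "poly ([:1, - b, 1:] * P - smult d ([:0, 0, 1:] * Q)) w
     = (1 - b * w + w * w) * poly P w - d * (w * w) * poly Q w" for w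
    by (simp add: algebra_simps)
  define p p' q q' i where "p = poly P z" and "p' = poly P (inverse z)" and "q = poly Q z"
    and "q' = poly Q (inverse z)" and "i = inverse z"
  have "((1 - b * z + z * z) * p - d * (z * z) * q) * (i * p') - z * p * ((1 - b * i + i * i) * p' - d * (i * i) * q')
    = p * p' * (i + z * (i * z) - z - i * (z * i)) + d * ((z * i) * i * p * q' - z * (z * i) * q * p')"
    by (simp add: algebra_simps)
  also have "\<dots> = d * (p * (i * q') - (z * q) * p')"
    using z by (simp add: i_def algebra_simps)
  also have "\<dots> = d * (C * (inverse z - z))"
    using * by (simp add: p_def p'_def q_def q'_def i_def)
  finally show "poly ([:1, - b, 1:] * P - smult d ([:0, 0, 1:] * Q)) z * poly (pCons 0 P) (inverse z) -
       poly (pCons 0 P) z * poly ([:1, - b, 1:] * P - smult d ([:0, 0, 1:] * Q)) (inverse z)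
     = d * C * (inverse z - z)"
    unfolding A by (simp add: p_def p'_def q_def q'_def i_def algebra_simps)
qed

lemma has_wronskian_step_back:
  assumes W: "has_wronskian P (pCons 0 Q) C" and Y: "[:0, 0, 1:] * Y = [:1, - b, 1:] * Q - P"
  shows "has_wronskian Q (pCons 0 Y) C"
  unfolding has_wronskian_def
proof (intro allI impI)
  fix z :: complex assume z: "z \<noteq> 0"
  have *: "poly P w = (1 - b * w + w\<^sup>2) * poly Q w - w\<^sup>2 * poly Y w" for w
    using arg_cong[OF Y, of "\<lambda>p. poly p w"] by (simp add: algebra_simps power2_eq_square)
  define p p' y y' i where "p = poly Q z" and "p' = poly Q (inverse z)" and "y = poly Y z"
    and "y' = poly Y (inverse z)" and "i = inverse z"
  have "p * (i * y') - (z * y) * p'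
    = p * p' * (i + z * (i * z) - z - i * (z * i)) + ((z * i) * i * p * y' - z * (z * i) * y * p')"
    using z by (simp add: i_def algebra_simps)
  also have "\<dots> = ((1 - b * z + z * z) * p - (z * z) * y) * (i * p') - z * p * ((1 - b * i + i * i) * p' - (i * i) * y')"
    by (simp add: algebra_simps)
  also have "\<dots> = poly P z * poly (pCons 0 Q) (inverse z) - poly (pCons 0 Q) z * poly P (inverse z)"
    by (simp add: * p_def p'_def y_def y'_def i_def power2_eq_square)
  finally show "poly Q z * poly (pCons 0 Y) (inverse z) - poly (pCons 0 Y) z * poly Q (inverse z)
     = C * (inverse z - z)"
    using has_wronskianD[OF W z] by (simp add: p_def p'_def y_def y'_def i_def)
qed

lemma poly_eqI_nonzero:
  fixes p q :: "complex poly"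
  assumes "\<And>z. z \<noteq> 0 \<Longrightarrow> poly p z = poly q z"
  shows "p = q"
proof -
  have "p * [:0, 1:] = q * [:0, 1:]"
    by (rule poly_ext) (use assms in force)
  then show ?thesis by simp
qed

text \<open>
  \<open>H(1/z)\<close> is bounded at infinity, hence so is \<open>H\<close>; in terms of degrees, \<open>z\<^sup>n H(1/z)\<close> has degree at
  most \<open>n = deg H\<close> while \<open>z\<^sup>n H(z)\<close> has degree \<open>2 n\<close>. A constant that equals its negative is 0.
\<close>

lemma antisymmetric_poly_eq_0:
  fixes H :: "complex poly"
  assumes "\<And>z. z \<noteq> 0 \<Longrightarrow> poly H (inverse z) = - poly H z"
  shows "H = 0"
proof (rule ccontr)
  assume H0: "H \<noteq> 0"
  have "reflect_poly H = - (monom 1 (degree H) * H)"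
  proof (rule poly_eqI_nonzero)
    fix z :: complex assume z: "z \<noteq> 0"
    show "poly (reflect_poly H) z = poly (- (monom 1 (degree H) * H)) z"
      using assms[OF z] z by (simp add: poly_reflect_poly_nz poly_monom)
  qed
  moreover have "degree (monom 1 (degree H) * H) = degree H + degree H"
    using H0 by (simp add: degree_mult_eq degree_monom_eq)
  ultimately have "degree H = 0"
    using degree_reflect_poly_le[of H] by simp
  then obtain c where "H = [:c:]"
    using degree_eq_zeroE by blast
  with assms[of 1] H0 show False by simp
qed

text \<open>
  Eliminating \<open>P(1/z)\<close> from the two identities gives \<open>P(z) F(z) = C D(z) (1/z - z)\<close>, where
  \<open>F(z) = Q(1/z) D(z) - Q(z) D(1/z)\<close> changes sign under \<open>z \<mapsto> 1/z\<close>. Since \<open>P(0) \<noteq> 0\<close> and \<open>D(0) = 0\<close>, the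
  function \<open>F\<close> has no pole at 0 and is a polynomial, so it vanishes. The condition \<open>D(0) = 0\<close> excludes the
  solution \<open>D = P\<close>.
\<close>

lemma has_wronskian_unique_zero:
  assumes W: "has_wronskian P Q C" and "C \<noteq> 0" and P0: "poly P 0 \<noteq> 0"
    and Q0: "poly Q 0 = 0" and W0: "has_wronskian P D 0" and D0: "poly D 0 = 0"
  shows "D = 0"
proof -
  define F where "F z = poly Q (inverse z) * poly D z - poly Q z * poly D (inverse z)" for z
  have PF: "poly P z * F z = C * poly D z * (inverse z - z)" if z: "z \<noteq> 0" for z
  proof -
    have "poly P z * poly Q (inverse z) = C * (inverse z - z) + poly Q z * poly P (inverse z)"
      using has_wronskianD[OF W z] by (simp add: diff_eq_eq)
    then have "poly P z * F z = (C * (inverse z - z) + poly Q z * poly P (inverse z)) * poly D z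
        - poly Q z * (poly P z * poly D (inverse z))"
      unfolding F_def by (metis (no_types, lifting) mult.assoc mult.left_commute right_diff_distrib)
    also have "poly P z * poly D (inverse z) = poly D z * poly P (inverse z)"
      using has_wronskianD[OF W0 z] by simp
    finally show ?thesis by (simp add: algebra_simps)
  qed
  obtain D' where D': "D = pCons 0 D'"
    using D0 by (cases D) auto
  \<comment> \<open>Clearing the powers of 1/z turns F into the polynomial G; dividing them out again is possible
  because z does not divide P.\<close>
  define N where "N = degree Q + degree D"
  define G where "G = monom 1 (degree D) * reflect_poly Q * D - monom 1 (degree Q) * Q * reflect_poly D"
  have FG: "z ^ N * F z = poly G z" if "z \<noteq> 0" for z
    using that by (simp add: F_def G_def N_def poly_reflect_poly_nz poly_monom power_add algebra_simps)
  have PG: "P * G = smult C (monom 1 N * D' * [:1, 0, -1:])"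
  proof (rule poly_eqI_nonzero)
    fix z :: complex assume z: "z \<noteq> 0"
    have "poly (P * G) z = z ^ N * (poly P z * F z)"
      using FG[OF z] by (simp add: algebra_simps)
    also have "\<dots> = z ^ N * (C * (z * poly D' z) * (inverse z - z))"
      by (simp only: PF[OF z]) (simp add: D')
    also have "\<dots> = z ^ N * (C * poly D' z * (1 - z * z))"
      using z by (simp add: field_simps)
    finally show "poly (P * G) z = poly (smult C (monom 1 N * D' * [:1, 0, -1:])) z"
      by (simp add: poly_monom algebra_simps)
  qed
  have "monom 1 N dvd P * G"
    unfolding PG by (intro dvd_smult dvd_mult2 dvd_refl)
  moreover have "\<not> [:0, 1:] dvd P"
    using P0 poly_eq_0_iff_dvd[of P 0] by simp
  moreover have "prime_elem [:0, 1::complex:]"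
    by (rule prime_elem_linear_field_poly) simp
  ultimately have "monom 1 N dvd G"
    using prime_power_dvd_multD[of "[:0, 1:]" N P G] by (cases "N = 0") (auto simp: monom_altdef simp flip: one_pCons)
  then obtain H where H: "G = monom 1 N * H" by (elim dvdE)
  have FH: "F z = poly H z" if "z \<noteq> 0" for z
    using FG[OF that] that by (simp add: H poly_monom)
  have "H = 0"
  proof (rule antisymmetric_poly_eq_0)
    fix z :: complex assume "z \<noteq> 0"
    then show "poly H (inverse z) = - poly H z"
      by (simp add: FH[symmetric] F_def)
  qed
  with PG H \<open>C \<noteq> 0\<close> have "monom 1 N * D' * [:1, 0, -1:] = 0"
    by simp
  then have "D' = 0"
    by (simp only: mult_eq_0_iff monom_eq_0_iff pCons_eq_0_iff) auto
  then show ?thesis by (simp add: D')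
qed

lemma has_wronskian_unique:
  assumes "has_wronskian P (pCons 0 Q) C" "has_wronskian P (pCons 0 Q') C'"
    and "C \<noteq> 0" "poly P 0 \<noteq> 0"
  shows "smult C' Q = smult C Q'"
proof -
  have "has_wronskian P (smult C' (pCons 0 Q) - smult C (pCons 0 Q')) (C' * C - C * C')"
    by (intro has_wronskian_diff has_wronskian_smult assms)
  then have "has_wronskian P (pCons 0 (smult C' Q - smult C Q')) 0"
    by (simp add: mult.commute)
  from has_wronskian_unique_zero[OF assms(1,3,4) _ this] show ?thesis by simp
qed

text \<open>
  In \<open>z Q(z) P(1/z) = P(z) Q(1/z) / z - C (1/z - z)\<close> the left side grows like \<open>z\<close> to the power
  \<open>deg Q + 1\<close>, as \<open>P(0) \<noteq> 0\<close>, and the right side at most like the power \<open>max (deg P - 1) 1\<close>.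
  With truncated subtraction this also covers \<open>deg P \<le> 2\<close>, where \<open>Q\<close> is constant.
\<close>

lemma has_wronskian_degree:
  assumes W: "has_wronskian P (pCons 0 Q) C" and P0: "poly P 0 \<noteq> 0"
  shows "degree Q \<le> degree P - 2"
proof (cases "Q = 0")
  case False
  define n d where "n = degree P" and "d = degree Q"
  have nz: "P \<noteq> 0" using P0 by auto
  have eq: "[:0, 0, 1:] * monom 1 d * Q * reflect_poly P =
     P * reflect_poly Q * monom 1 n - smult C (monom 1 (n + d) - monom 1 (n + d + 2))"
  proof (rule poly_eqI_nonzero)
    fix z :: complex assume z: "z \<noteq> 0"
    have W': "z * poly Q z * poly P (inverse z) = poly P z * inverse z * poly Q (inverse z) - C * (inverse z - z)"
      using has_wronskianD[OF W z] by (simp add: algebra_simps)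
    have P': "poly (reflect_poly P) z = z ^ n * poly P (inverse z)"
     and Q': "poly (reflect_poly Q) z = z ^ d * poly Q (inverse z)"
      using z by (simp_all add: poly_reflect_poly_nz n_def d_def)
    have "poly ([:0, 0, 1:] * monom 1 d * Q * reflect_poly P) z
       = z ^ (n + d + 1) * (z * poly Q z * poly P (inverse z))"
      by (simp add: P' poly_monom power_add algebra_simps)
    also have "\<dots> = poly (P * reflect_poly Q * monom 1 n - smult C (monom 1 (n + d) - monom 1 (n + d + 2))) z"
      unfolding W' using z by (simp add: Q' poly_monom power_add field_simps)
    finally show "poly ([:0, 0, 1:] * monom 1 d * Q * reflect_poly P) z = \<dots>" .
  qed
  have rP: "degree (reflect_poly P) = n"
    using P0 by (simp add: n_def poly_0_coeff_0)
  have "degree ([:0, 0, 1:] * monom 1 d * Q * reflect_poly P) = 2 + d + d + n"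
    using False nz by (simp add: degree_mult_eq degree_monom_eq rP monom_eq_0_iff d_def)
  moreover have "degree (P * reflect_poly Q * monom 1 n - smult C (monom 1 (n + d) - monom 1 (n + d + 2)))
     \<le> max (2 * n + d) (n + d + 2)"
  proof (intro degree_diff_le)
    show "degree (P * reflect_poly Q * monom 1 n) \<le> max (2 * n + d) (n + d + 2)"
      using degree_reflect_poly_le[of Q] False nz
      by (simp add: degree_mult_eq degree_monom_eq monom_eq_0_iff d_def n_def)
    have "degree (monom 1 (n + d) - monom 1 (n + d + 2) :: complex poly) \<le> n + d + 2"
      by (intro degree_diff_le order.trans[OF degree_monom_le]) auto
    then show "degree (smult C (monom 1 (n + d) - monom 1 (n + d + 2))) \<le> max (2 * n + d) (n + d + 2)"
      using degree_smult_le[of C] le_trans by fastforce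
  qed
  ultimately show ?thesis
    unfolding eq n_def[symmetric] d_def[symmetric] by simp
qed simp

text \<open>
  For \<open>M = z Q / P\<close> the identity reads \<open>M(z) - M(1/z) = - C (1/z - z) / (P(z) P(1/z))\<close>. A new factor
  \<open>1 - \<alpha> z\<close> of \<open>P\<close> divides the right side by the symmetric function \<open>(1 - \<alpha> z) (1 - \<alpha>/z)\<close>, so
  \<open>(M - g) / ((1 - \<alpha> z) (1 - \<alpha>/z))\<close> solves the new equation for every constant \<open>g\<close>. The choice
  \<open>g = M(\<alpha>)\<close> makes its numerator divisible by \<open>z - \<alpha>\<close>, and this is where \<open>Q'\<close> comes from.
\<close>

lemma has_wronskian_add_root:
  assumes W: "has_wronskian P (pCons 0 Q) C" and "\<alpha> \<noteq> 0"
    and Q': "[:-\<alpha>, 1:] * Q' = pCons 0 Q - smult g P"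
  shows "has_wronskian ([:1, -\<alpha>:] * P) (pCons 0 Q') C"
  unfolding has_wronskian_def
proof (intro allI impI)
  fix z :: complex assume z: "z \<noteq> 0"
  have *: "(w - \<alpha>) * poly Q' w = w * poly Q w - g * poly P w" for w
    using arg_cong[OF Q', of "\<lambda>p. poly p w"] by (simp add: algebra_simps)
  have "poly ([:1, -\<alpha>:] * P) z * poly (pCons 0 Q') (inverse z)
      - poly (pCons 0 Q') z * poly ([:1, -\<alpha>:] * P) (inverse z)
    = poly P z * ((inverse z - \<alpha>) * poly Q' (inverse z)) - ((z - \<alpha>) * poly Q' z) * poly P (inverse z)"
    using z by (simp add: field_simps)
  also have "\<dots> = poly P z * poly (pCons 0 Q) (inverse z) - poly (pCons 0 Q) z * poly P (inverse z)"
    unfolding * by (simp add: algebra_simps)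
  also have "\<dots> = C * (inverse z - z)"
    by (rule has_wronskianD[OF W z])
  finally show "poly ([:1, -\<alpha>:] * P) z * poly (pCons 0 Q') (inverse z)
      - poly (pCons 0 Q') z * poly ([:1, -\<alpha>:] * P) (inverse z) = C * (inverse z - z)" .
qed

section \<open>Positivity in the upper half of the disc\<close>

text \<open>
  Positivity of \<open>Im (Q/P)\<close>, written without division. In particular neither \<open>P\<close> nor \<open>Q\<close> vanishes on the
  upper half disc.
\<close>

definition herglotz :: "real poly \<Rightarrow> real poly \<Rightarrow> bool" where
  "herglotz P Q \<longleftrightarrow>
     (\<forall>z. cmod z < 1 \<and> 0 < Im z \<longrightarrow> 0 < Im (poly (cpoly Q) z * cnj (poly (cpoly P) z)))"

text \<open>
  The sign condition says that \<open>Q/P\<close> has negative residues for every \<open>Q\<close> related to \<open>P\<close> by a Wronskian identity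
  with \<open>C > 0\<close>. It also forbids a common zero of \<open>P(z)\<close> and \<open>P(1/z)\<close> in the open disc. Zeros at 1 and -1 are only
  required to be simple.
\<close>

definition admissible :: "real poly \<Rightarrow> bool" where
  "admissible P \<longleftrightarrow>
     (\<forall>z. cmod z \<le> 1 \<and> poly (cpoly P) z = 0 \<longrightarrow> z \<in> \<real> \<and> poly (cpoly (pderiv P)) z \<noteq> 0) \<and>
     (\<forall>s. \<bar>s\<bar> < 1 \<and> s \<noteq> 0 \<and> poly P s = 0 \<longrightarrow> 0 < s * poly (pderiv P) s * poly P (inverse s))"

lemma herglotz_swap: "herglotz P Q \<Longrightarrow> herglotz Q (- P)"
  by (auto simp: herglotz_def cpoly_uminus algebra_simps)

text \<open>
  At a zero of order \<open>n\<close> the polynomial \<open>P\<close> looks like \<open>G(s) (z - s)\<^sup>n\<close>. On the ray of angle \<open>\<theta>\<close> from \<open>s\<close>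
  positivity becomes \<open>Q(s) G(s) sin (n \<theta>) \<le> 0\<close> for all \<open>\<theta>\<close> between 0 and \<open>\<pi>\<close>, and for \<open>n \<ge> 2\<close> the sine takes
  both signs there. So \<open>n = 1\<close>, and the sign of the residue follows.
\<close>

lemma herglotz_root:
  assumes H: "herglotz P Q" and s: "\<bar>s\<bar> < 1" "poly P s = 0" "poly Q s \<noteq> 0"
  shows "poly (pderiv P) s * poly Q s < 0"
proof -
  have "P \<noteq> 0"
  proof
    assume "P = 0"
    moreover have "cmod (\<i> / 2) < 1" "0 < Im (\<i> / 2)" by (simp_all add: norm_divide)
    ultimately show False using H unfolding herglotz_def by fastforce
  qed
  define n where "n = order s P"
  have n: "n \<ge> 1"
    using s(2) \<open>P \<noteq> 0\<close> order_root[of P s] by (simp add: n_def)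
  obtain G where G: "P = [:-s, 1:] ^ n * G"
    using order_1[of s P] unfolding n_def by (elim dvdE)
  have "poly G s \<noteq> 0"
  proof
    assume "poly G s = 0"
    then have "[:-s, 1:] ^ Suc n dvd P"
      unfolding G poly_eq_0_iff_dvd power_Suc2 by (intro mult_dvd_mono dvd_refl)
    then show False
      using order_2[OF \<open>P \<noteq> 0\<close>, of s] by (simp add: n_def)
  qed
  have key: "poly Q s * poly G s * sin (real n * \<theta>) \<le> 0" if th: "0 < \<theta>" "\<theta> < pi" for \<theta>
  proof -
    define g where "g t = poly (cpoly Q) (of_real s + of_real t * cis \<theta>)
      * cnj (poly (cpoly G) (of_real s + of_real t * cis \<theta>)) * cis (- (real n * \<theta>))" for t :: real
    have sin: "sin \<theta> > 0" using th by (rule sin_gt_zero)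
    have pos: "Im (g t) > 0" if t: "0 < t" "t < 1 - \<bar>s\<bar>" for t
    proof -
      define z where "z = complex_of_real s + of_real t * cis \<theta>"
      have "cmod z \<le> \<bar>s\<bar> + t"
        unfolding z_def using norm_triangle_ineq[of "of_real s" "of_real t * cis \<theta>"] t
        by (simp add: norm_mult)
      moreover have "Im z > 0" using t sin by (simp add: z_def)
      ultimately have "0 < Im (poly (cpoly Q) z * cnj (poly (cpoly P) z))"
        using H t unfolding herglotz_def by simp
      also have "poly (cpoly P) z = of_real (t ^ n) * cis (real n * \<theta>) * poly (cpoly G) z"
      proof -
        have "cpoly P = [:- of_real s, 1:] ^ n * cpoly G"
          unfolding G cpoly_mult cpoly_power by (simp flip: one_pCons)
        then show ?thesis
          by (simp add: poly_power z_def power_mult_distrib Complex.DeMoivre)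
      qed
      finally have "0 < Im (of_real (t ^ n) * g t)"
        by (simp add: g_def z_def cis_cnj algebra_simps)
      then have "0 < t ^ n * Im (g t)"
        by simp
      then show ?thesis using t by (simp add: zero_less_mult_iff)
    qed
    have "(g \<longlongrightarrow> g 0) (at_right 0)"
      unfolding g_def by (intro tendsto_intros)
    then have "((\<lambda>t. Im (g t)) \<longlongrightarrow> Im (g 0)) (at_right 0)"
      by (rule tendsto_Im)
    moreover have "eventually (\<lambda>t. 0 \<le> Im (g t)) (at_right 0)"
      using eventually_at_right_less eventually_at_right_real[of 0 "1 - \<bar>s\<bar>"] s
      by (auto elim!: eventually_mono dest: pos)
    ultimately have "0 \<le> Im (g 0)"
      by (rule tendsto_lowerbound) simp
    moreover have "g 0 = of_real (poly Q s * poly G s) * cis (- (real n * \<theta>))"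
      by (simp add: g_def)
    then have "Im (g 0) = - (poly Q s * poly G s * sin (real n * \<theta>))"
      by (simp only: Im_complex_of_real times_complex.sel Re_complex_of_real cis.sel) simp
    ultimately show ?thesis by simp
  qed
  \<comment> \<open>The angle is chosen such that n \<theta> = \<pi>/2.\<close>
  have le: "poly Q s * poly G s \<le> 0"
  proof -
    have "pi / (2 * real n) < pi"
      using n by (simp add: divide_less_eq)
    with key[of "pi / (2 * real n)"] n show ?thesis by simp
  qed
  have "n = 1"
  proof (rule ccontr)
    assume "n \<noteq> 1"
    then have n2: "n \<ge> 2" using n by simp
    \<comment> \<open>For n \<theta> = 3 \<pi>/2 the sine is -1, and this angle is below \<pi> as soon as n \<ge> 2.\<close>
    then have "3 * pi / (2 * real n) < pi"
      by (simp add: divide_less_eq)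
    moreover have "sin (real n * (3 * pi / (2 * real n))) = - 1"
      using n sin_3over2_pi by simp
    ultimately have "poly Q s * poly G s \<ge> 0"
      using key[of "3 * pi / (2 * real n)"] n by simp
    with le s(3) \<open>poly G s \<noteq> 0\<close> show False
      by (simp add: order_antisym)
  qed
  then have "poly (pderiv P) s = poly G s"
    unfolding G pderiv_mult by (simp add: pderiv_pCons)
  moreover have "poly Q s * poly G s \<noteq> 0"
    using s(3) \<open>poly G s \<noteq> 0\<close> by simp
  ultimately show ?thesis using le by (simp add: mult.commute less_le)
qed

lemma has_wronskian_real:
  assumes "has_wronskian (cpoly P) (cpoly Q) (of_real C)" "x \<noteq> 0"
  shows "poly P x * poly Q (inverse x) - poly Q x * poly P (inverse x) = C * (inverse x - x)"
proof -
  have "complex_of_real (poly P x * poly Q (inverse x) - poly Q x * poly P (inverse x))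
     = of_real (C * (inverse x - x))"
    using has_wronskianD[OF assms(1), of "of_real x"] assms(2)
    by (simp flip: of_real_inverse)
  then show ?thesis by (simp only: of_real_eq_iff)
qed

text \<open>
  On the unit circle \<open>1/z\<close> is the complex conjugate of \<open>z\<close>, and for real polynomials the identity becomes one between
  a number and its conjugate.
\<close>

lemma has_wronskian_circle:
  assumes "has_wronskian (cpoly P) (cpoly Q) (of_real C)" "cmod z = 1"
  shows "Im (poly (cpoly Q) z * cnj (poly (cpoly P) z)) = C * Im z"
proof -
  have "z * cnj z = 1"
    using complex_norm_square[of z] assms(2) by simp
  then have z: "z \<noteq> 0" "inverse z = cnj z"
    by (auto intro: inverse_unique)
  define w where "w = poly (cpoly Q) z * cnj (poly (cpoly P) z)"
  have "cnj w - w = of_real C * (cnj z - z)"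
    using has_wronskianD[OF assms(1) z(1)] unfolding z(2) w_def
    by (simp add: poly_cpoly_cnj mult.commute)
  then have "Im (cnj w - w) = Im (of_real C * (cnj z - z))" by simp
  then have "2 * Im w = 2 * (C * Im z)" by simp
  then show ?thesis unfolding w_def by simp
qed

text \<open>
  At 1 and -1 both sides of the identity vanish, so the information is in their derivatives.
\<close>

lemma has_wronskian_endpoint:
  assumes W: "has_wronskian (cpoly P) (cpoly Q) (of_real C)" and s: "\<bar>s\<bar> = 1" "poly P s = 0"
  shows "poly (pderiv P) s * poly Q s = - C"
proof -
  have s': "s \<noteq> 0" "inverse s = s" "s * s = 1"
    using s(1) by (auto simp: abs_if split: if_splits)
  have "((\<lambda>x. poly P x * poly Q (inverse x) - poly Q x * poly P (inverse x))
     has_field_derivative 2 * (poly (pderiv P) s * poly Q s)) (at s)"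
    using s s' by (auto intro!: derivative_eq_intros simp: power2_eq_square)
  moreover have "((\<lambda>x. C * (inverse x - x)) has_field_derivative - 2 * C) (at s)"
    using s s' by (auto intro!: derivative_eq_intros simp: power2_eq_square)
  then have "((\<lambda>x. poly P x * poly Q (inverse x) - poly Q x * poly P (inverse x))
     has_field_derivative - 2 * C) (at s)"
  proof (rule has_field_derivative_transform_within_open[where S = "- {0}"])
    fix x :: real assume "x \<in> - {0}"
    then show "C * (inverse x - x) = poly P x * poly Q (inverse x) - poly Q x * poly P (inverse x)"
      using has_wronskian_real[OF W, of x] by simp
  qed (use s' in auto)
  ultimately have "2 * (poly (pderiv P) s * poly Q s) = - 2 * C"
    by (rule DERIV_unique)
  then show ?thesis by (simp add: mult.commute)
qed

text \<open>
  By positivity and its mirror image, zeros of \<open>P\<close> in the open disc are real; on the circle the Wronskian identity leaves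
  only 1 and -1. At a zero \<open>s\<close> the identity reads \<open>Q(s) P(1/s) = C (s - 1/s)\<close>, which trades the sign of
  \<open>P'(s) Q(s)\<close> for that of \<open>s P'(s) P(1/s)\<close>. A common zero of \<open>P\<close> and \<open>Q\<close> at 0 has to be excluded
  separately, since the identity says nothing there.
\<close>

lemma herglotz_admissible:
  assumes H: "herglotz P Q" and W: "has_wronskian (cpoly P) (cpoly Q) (of_real C)" and C: "C > 0"
    and 0: "poly P 0 \<noteq> 0 \<or> poly Q 0 \<noteq> 0"
  shows "admissible P"
proof -
  have Q: "poly Q s \<noteq> 0" if "poly P s = 0" "\<bar>s\<bar> < 1" for s
  proof (cases "s = 0")
    case False
    have "inverse s \<noteq> s"
    proof
      assume "inverse s = s"
      then have "s * s = 1" using False by (metis right_inverse)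
      then have "\<bar>s\<bar> = 1" by (auto simp: square_eq_1_iff)
      with that show False by simp
    qed
    then show ?thesis
      using has_wronskian_real[OF W False] that C by auto
  qed (use 0 that in auto)
  have neg: "poly (pderiv P) s * poly Q s < 0" if "poly P s = 0" "\<bar>s\<bar> \<le> 1" for s
  proof (cases "\<bar>s\<bar> = 1")
    case True
    from has_wronskian_endpoint[OF W True that(1)] C show ?thesis by simp
  next
    case False
    then have "\<bar>s\<bar> < 1" using that by simp
    from herglotz_root[OF H this that(1) Q[OF that(1) this]] show ?thesis .
  qed
  have real: "Im z = 0" if "cmod z \<le> 1" "poly (cpoly P) z = 0" for z
  proof (cases "cmod z = 1")
    case True
    from has_wronskian_circle[OF W this] that C show ?thesis by simp
  next
    case False
    then have "cmod z < 1" using that by simp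
    then have "\<not> Im z > 0" "\<not> Im (cnj z) > 0"
      using H that(2) poly_cpoly_cnj[of P z] unfolding herglotz_def
      by (metis complex_cnj_zero less_irrefl mult_zero_right zero_complex.sel(2),
          metis complex_cnj_zero complex_mod_cnj less_irrefl mult_zero_right zero_complex.sel(2))
    then show ?thesis by simp
  qed
  show ?thesis
    unfolding admissible_def
  proof (intro conjI allI impI)
    fix z assume z: "cmod z \<le> 1 \<and> poly (cpoly P) z = 0"
    then have "Im z = 0" using real by blast
    then obtain s where s: "z = of_real s"
      by (metis complex_is_Real_iff Reals_cases)
    show "z \<in> \<real>" by (simp add: s)
    from neg[of s] z show "poly (cpoly (pderiv P)) z \<noteq> 0"
      by (auto simp: s)
  next
    fix s :: real assume s: "\<bar>s\<bar> < 1 \<and> s \<noteq> 0 \<and> poly P s = 0"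
    define D R E where "D = poly (pderiv P) s" and "R = poly Q s" and "E = poly P (inverse s)"
    have 1: "D * R < 0" using neg[of s] s by (simp add: D_def R_def)
    have "R * E = C * (s - inverse s)"
      using has_wronskian_real[OF W, of s] s by (simp add: R_def E_def algebra_simps)
    then have "s * (R * E) = C * (s * s - 1)" using s by (simp add: field_simps)
    moreover have "s * s < 1" using s by (simp add: abs_square_less_1 flip: power2_eq_square)
    ultimately have 2: "s * (R * E) < 0" using C by (simp add: mult_pos_neg)
    have "0 < (D * R) * (s * (R * E))" using 1 2 by (rule mult_neg_neg)
    also have "\<dots> = (s * D * E) * R\<^sup>2" by (simp add: power2_eq_square algebra_simps)
    finally show "0 < s * poly (pderiv P) s * poly P (inverse s)"
      by (simp add: zero_less_mult_iff D_def E_def not_less power2_eq_square)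
  qed
qed

lemma Im_divide_cnj: "Im (a / b) = Im (a * cnj b) / (cmod b)\<^sup>2"
  by (simp only: complex_div_cnj[of a b] Im_divide_of_real flip: of_real_power)

text \<open>
  The same trade of signs backwards: the residues of \<open>Q/P\<close> on the closed interval from -1 to 1 are negative.
\<close>

lemma admissible_root_sign:
  assumes A: "admissible P" and W: "has_wronskian (cpoly P) (cpoly Q) (of_real C)" and C: "C > 0"
    and P0: "poly P 0 \<noteq> 0" and s: "\<bar>s\<bar> \<le> 1" "poly P s = 0"
  shows "poly (pderiv P) s * poly Q s < 0"
proof (cases "\<bar>s\<bar> = 1")
  case True
  from has_wronskian_endpoint[OF W True s(2)] C show ?thesis by simp
next
  case False
  define D R E where "D = poly (pderiv P) s" and "R = poly Q s" and "E = poly P (inverse s)"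
  have s0: "s \<noteq> 0" using P0 s by auto
  have 1: "0 < s * D * E"
    using A False s s0 unfolding admissible_def D_def E_def by auto
  have "R * E = C * (s - inverse s)"
    using has_wronskian_real[OF W s0] s by (simp add: R_def E_def algebra_simps)
  then have "s * (R * E) = C * (s * s - 1)" using s0 by (simp add: field_simps)
  moreover have "s * s < 1" using s False by (simp add: abs_square_less_1 flip: power2_eq_square)
  ultimately have 2: "s * (R * E) < 0" using C by (simp add: mult_pos_neg)
  have "(s * D * E) * (s * (R * E)) < 0" using 1 2 by (rule mult_pos_neg)
  then have "(D * R) * (s * E)\<^sup>2 < 0" by (simp add: power2_eq_square algebra_simps)
  then show ?thesis
    by (simp add: mult_less_0_iff D_def R_def not_less)
qed

text \<open>
  \<open>M = Q/P\<close> is holomorphic on the upper half disc, has positive imaginary part on the arc and is real on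
  the real segment except at its simple poles. Near a pole \<open>x\<close> it is \<open>\<rho> / (z - x)\<close> plus a continuous function
  that is real at \<open>x\<close>, and \<open>\<rho> < 0\<close> makes the imaginary part of the first term positive. So on horizontal
  lines that approach the segment \<open>Im M\<close> is at least \<open>- \<delta>\<close> in the end, and the maximum principle for \<open>\<i> M\<close> on the
  region above such a line extends the bound to the interior. Strict positivity follows from the open mapping theorem.
\<close>

lemma admissible_herglotz:
  assumes A: "admissible P" and W: "has_wronskian (cpoly P) (cpoly Q) (of_real C)" and C: "C > 0"
    and P0: "poly P 0 \<noteq> 0"
  shows "herglotz P Q"
proof -
  define M where "M z = poly (cpoly Q) z / poly (cpoly P) z" for z
  have nz: "poly (cpoly P) z \<noteq> 0" if "cmod z \<le> 1" "Im z \<noteq> 0" for z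
    using A that by (auto simp: admissible_def complex_is_Real_iff)
  have circle: "Im (M z) > 0" if "cmod z = 1" "Im z > 0" for z
  proof -
    have "poly (cpoly P) z \<noteq> 0" using nz[of z] that by simp
    then show ?thesis
      unfolding M_def Im_divide_cnj has_wronskian_circle[OF W that(1)] using C that by simp
  qed
  \<comment> \<open>The lower bound near a point of the real segment, poles and endpoints included.\<close>
  have local: "\<exists>r>0. \<forall>z. dist z (of_real x) < r \<and> cmod z \<le> 1 \<and> Im z > 0 \<longrightarrow> Im (M z) > - \<delta>"
    if x: "\<bar>x\<bar> \<le> 1" and \<delta>: "\<delta> > 0" for x \<delta> :: real
  proof -
    have near: "\<exists>r>0. \<forall>z. dist z (of_real x) < r \<longrightarrow> Im (poly (cpoly Y) z / poly (cpoly B) z) > - \<delta>"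
      if "poly B x \<noteq> 0" for Y B
    proof -
      have "isCont (\<lambda>z. poly (cpoly Y) z / poly (cpoly B) z) (of_real x)"
        using that by (intro isCont_divide poly_isCont) auto
      then have "((\<lambda>z. Im (poly (cpoly Y) z / poly (cpoly B) z)) \<longlongrightarrow>
          Im (poly (cpoly Y) (of_real x) / poly (cpoly B) (of_real x))) (at (of_real x))"
        unfolding isCont_def by (rule tendsto_Im)
      then have "((\<lambda>z. Im (poly (cpoly Y) z / poly (cpoly B) z)) \<longlongrightarrow>
          Im (poly (cpoly Y) (of_real x) / poly (cpoly B) (of_real x))) (nhds (of_real x))"
        by (rule tendsto_at_iff_tendsto_nhds[THEN iffD1])
      moreover have "Im (poly (cpoly Y) (of_real x) / poly (cpoly B) (of_real x)) > - \<delta>"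
        using \<delta> by simp
      ultimately have "eventually (\<lambda>z. Im (poly (cpoly Y) z / poly (cpoly B) z) > - \<delta>) (nhds (of_real x))"
        by (rule order_tendstoD(1))
      then show ?thesis by (simp add: eventually_nhds_metric)
    qed
    show ?thesis
    proof (cases "poly P x = 0")
      case False
      from near[OF this, of Q] show ?thesis unfolding M_def by blast
    next
      case True
      then obtain B where B: "P = [:-x, 1:] * B"
        unfolding poly_eq_0_iff_dvd by (elim dvdE)
      have dB: "poly (pderiv P) x = poly B x"
        unfolding B pderiv_mult by (simp add: pderiv_pCons)
      have neg: "poly B x * poly Q x < 0"
        using admissible_root_sign[OF A W C P0 x True] by (simp add: dB)
      then have Bx: "poly B x \<noteq> 0" by auto
      define \<rho> where "\<rho> = poly Q x / poly B x"
      have \<rho>: "\<rho> < 0" using neg by (auto simp: \<rho>_def divide_less_0_iff mult_less_0_iff)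
      have "poly (Q - smult \<rho> B) x = 0" using Bx by (simp add: \<rho>_def)
      then obtain Y where Y: "Q - smult \<rho> B = [:-x, 1:] * Y"
        unfolding poly_eq_0_iff_dvd by (elim dvdE)
      from near[OF Bx, of Y] obtain r where r: "r > 0"
        "\<And>z. dist z (of_real x) < r \<Longrightarrow> Im (poly (cpoly Y) z / poly (cpoly B) z) > - \<delta>" by blast
      have "Im (M z) > - \<delta>" if z: "dist z (of_real x) < r" "cmod z \<le> 1" "Im z > 0" for z
      proof -
        have "z \<noteq> of_real x" using z(3) by auto
        then have zx: "z - of_real x \<noteq> 0" by simp
        have Pz: "poly (cpoly P) z = (z - of_real x) * poly (cpoly B) z"
          unfolding B cpoly_mult by (simp add: algebra_simps)
        then have Bz: "poly (cpoly B) z \<noteq> 0" using nz[of z] z by auto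
        have "poly (cpoly (Q - smult \<rho> B)) z = poly (cpoly ([:-x, 1:] * Y)) z" by (simp only: Y)
        then have "poly (cpoly Q) z = of_real \<rho> * poly (cpoly B) z + (z - of_real x) * poly (cpoly Y) z"
          by (simp add: cpoly_diff cpoly_smult cpoly_mult algebra_simps)
        then have "M z = of_real \<rho> / (z - of_real x) + poly (cpoly Y) z / poly (cpoly B) z"
          unfolding M_def Pz using zx Bz by (simp add: field_simps)
        moreover have "Im (of_real \<rho> / (z - of_real x)) = - \<rho> * Im z / (cmod (z - of_real x))\<^sup>2"
          by (simp add: Im_divide_cnj)
        then have "Im (of_real \<rho> / (z - of_real x)) > 0"
          using \<rho> z(3) zx by (simp add: mult_neg_pos divide_neg_pos)
        ultimately show ?thesis using r(2)[OF z(1)] by simp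
      qed
      with r(1) show ?thesis by blast
    qed
  qed
  \<comment> \<open>Compactness of the segment makes the local bounds uniform.\<close>
  have uniform: "\<exists>\<epsilon>>0. \<forall>z. cmod z \<le> 1 \<and> 0 < Im z \<and> Im z \<le> \<epsilon> \<longrightarrow> Im (M z) > - \<delta>"
    if \<delta>: "\<delta> > 0" for \<delta>
  proof (rule ccontr)
    assume "\<not> ?thesis"
    then have "\<exists>z. cmod z \<le> 1 \<and> 0 < Im z \<and> Im z \<le> inverse (real (Suc n)) \<and> \<not> Im (M z) > - \<delta>" for n
      by (metis inverse_positive_iff_positive of_nat_0_less_iff zero_less_Suc)
    then obtain z where z: "\<And>n. cmod (z n) \<le> 1" "\<And>n. 0 < Im (z n)"
      "\<And>n. Im (z n) \<le> inverse (real (Suc n))" "\<And>n. \<not> Im (M (z n)) > - \<delta>" by metis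
    have "seq_compact (cball (0::complex) 1)"
      using compact_cball by (rule compact_imp_seq_compact)
    moreover have "\<forall>n. z n \<in> cball 0 1" using z(1) by simp
    ultimately obtain l r where l: "l \<in> cball 0 1" "strict_mono r" "(z \<circ> r) \<longlonglongrightarrow> l"
      unfolding seq_compact_def by blast
    have "(\<lambda>n. Im (z n)) \<longlonglongrightarrow> 0"
    proof (rule tendsto_sandwich[OF _ _ tendsto_const LIMSEQ_inverse_real_of_nat])
      show "\<forall>\<^sub>F n in sequentially. 0 \<le> Im (z n)" using z(2) by (simp add: less_imp_le)
      show "\<forall>\<^sub>F n in sequentially. Im (z n) \<le> inverse (real (Suc n))" using z(3) by simp
    qed
    then have "((\<lambda>n. Im (z n)) \<circ> r) \<longlonglongrightarrow> 0"
      using l(2) by (rule LIMSEQ_subseq_LIMSEQ)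
    moreover have "((\<lambda>n. Im (z n)) \<circ> r) \<longlonglongrightarrow> Im l"
      using tendsto_Im[OF l(3)] by (simp add: o_def)
    ultimately have "Im l = 0" by (rule LIMSEQ_unique[rotated])
    then obtain x where x: "l = of_real x" by (metis complex_is_Real_iff Reals_cases)
    with l(1) have "\<bar>x\<bar> \<le> 1" by simp
    from local[OF this \<delta>] obtain e where e: "e > 0"
      "\<And>w. dist w l < e \<Longrightarrow> cmod w \<le> 1 \<Longrightarrow> Im w > 0 \<Longrightarrow> Im (M w) > - \<delta>" unfolding x by blast
    from l(3) e(1) have "eventually (\<lambda>n. dist ((z \<circ> r) n) l < e) sequentially"
      by (rule tendstoD)
    then obtain n where "dist (z (r n)) l < e"
      by (auto simp: eventually_sequentially)
    with e(2)[OF this] z show False by blast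
  qed
  define U where "U = {z. cmod z < 1 \<and> 0 < Im z}"
  have U: "open U" "connected U"
  proof -
    have U': "U = ball 0 1 \<inter> {z. 0 < Im z}" by (auto simp: U_def)
    show "open U" unfolding U' by (intro open_Int open_ball open_halfspace_Im_gt)
    have "convex U" unfolding U' by (intro convex_Int convex_ball convex_halfspace_Im_gt)
    then show "connected U" by (rule convex_connected)
  qed
  have holo: "M holomorphic_on U"
    unfolding M_def by (intro holomorphic_intros) (use nz in \<open>auto simp: U_def\<close>)
  have bound: "Im (M w) \<ge> - \<delta>" if w: "w \<in> U" and \<delta>: "\<delta> > 0" for w \<delta>
  proof -
    from uniform[OF \<delta>] obtain e where e: "e > 0"
      "\<And>z. cmod z \<le> 1 \<Longrightarrow> 0 < Im z \<Longrightarrow> Im z \<le> e \<Longrightarrow> Im (M z) > - \<delta>" by blast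
    define \<epsilon> where "\<epsilon> = min e (Im w / 2)"
    have \<epsilon>: "0 < \<epsilon>" "\<epsilon> \<le> e" "\<epsilon> < Im w" using e w by (auto simp: \<epsilon>_def U_def)
    define S where "S = ball (0::complex) 1 \<inter> {z. \<epsilon> < Im z}"
    have opS: "open S" unfolding S_def by (intro open_Int open_ball open_halfspace_Im_gt)
    have clS: "closure S \<subseteq> {z. cmod z \<le> 1 \<and> \<epsilon> \<le> Im z}"
    proof (rule closure_minimal)
      have "{z. cmod z \<le> 1 \<and> \<epsilon> \<le> Im z} = cball 0 1 \<inter> {z. \<epsilon> \<le> Im z}" by auto
      then show "closed {z. cmod z \<le> 1 \<and> \<epsilon> \<le> Im z}"
        by (simp add: closed_Int closed_halfspace_Im_ge)
    qed (auto simp: S_def)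
    have nzS: "poly (cpoly P) z \<noteq> 0" if "z \<in> closure S" for z
      using nz[of z] clS that \<epsilon>(1) by auto
    have "Re (\<i> * M w) \<le> \<delta>"
    proof (rule maximum_real_frontier[where f = "\<lambda>z. \<i> * M z" and S = S])
      show "(\<lambda>z. \<i> * M z) holomorphic_on interior S"
        unfolding M_def using nzS closure_subset[of S] interior_subset[of S]
        by (intro holomorphic_intros) auto
      show "continuous_on (closure S) (\<lambda>z. \<i> * M z)"
        unfolding M_def using nzS by (intro continuous_intros) auto
      show "bounded S" unfolding S_def by (simp add: bounded_Int)
      show "w \<in> S" using w \<epsilon> by (simp add: S_def U_def)
      fix z assume "z \<in> frontier S"
      then have z: "z \<in> closure S" "z \<notin> S" using opS by (auto simp: frontier_def interior_open)
      then have z1: "cmod z \<le> 1" "\<epsilon> \<le> Im z" using clS by auto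
      have "Im (M z) \<ge> - \<delta>"
      proof (cases "cmod z = 1")
        case True
        with circle[of z] z1 \<epsilon> \<delta> show ?thesis by simp
      next
        case False
        then have "Im z = \<epsilon>" using z1 z(2) by (auto simp: S_def)
        with e(2)[of z] z1 \<epsilon> show ?thesis by simp
      qed
      then show "Re (\<i> * M z) \<le> \<delta>" by simp
    qed
    then show ?thesis by simp
  qed
  have nonneg: "Im (M w) \<ge> 0" if "w \<in> U" for w
  proof (rule field_le_epsilon)
    fix e :: real assume "e > 0"
    from bound[OF that this] show "0 \<le> Im (M w) + e" by simp
  qed
  \<comment> \<open>A constant value would have positive imaginary part at \<i> and be real at 0.\<close>
  have noncon: "\<not> M constant_on U"
  proof
    assume "M constant_on U"
    then obtain c where c: "\<And>z. z \<in> U \<Longrightarrow> M z = c" by (auto simp: constant_on_def)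
    have nz0: "poly (cpoly P) 0 \<noteq> 0"
      using P0 poly_cpoly_of_real[of P 0] by (metis of_real_0 of_real_eq_0_iff)
    have ev: "eventually (\<lambda>t. M (of_real t * \<i>) = c) F"
      if "eventually (\<lambda>t::real. t \<in> {0<..<1}) F" for F
      using that by (rule eventually_mono) (auto intro!: c simp: U_def norm_mult)
    have "((\<lambda>t. M (of_real t * \<i>)) \<longlongrightarrow> M (of_real 1 * \<i>)) (at_left 1)"
      unfolding M_def using nz[of \<i>] by (intro tendsto_intros) auto
    moreover have "((\<lambda>t. M (of_real t * \<i>)) \<longlongrightarrow> c) (at_left 1)"
      by (intro tendsto_eventually ev eventually_at_left_real) simp
    ultimately have "M (of_real 1 * \<i>) = c"
      by (rule tendsto_unique[rotated]) simp
    with circle[of \<i>] have "Im c > 0" by simp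
    have "((\<lambda>t. M (of_real t * \<i>)) \<longlongrightarrow> M (of_real 0 * \<i>)) (at_right 0)"
      unfolding M_def using nz0 by (intro tendsto_intros) auto
    moreover have "((\<lambda>t. M (of_real t * \<i>)) \<longlongrightarrow> c) (at_right 0)"
      by (intro tendsto_eventually ev eventually_at_right_real) simp
    ultimately have "M (of_real 0 * \<i>) = c"
      by (rule tendsto_unique[rotated]) simp
    then have "c = of_real (poly Q 0 / poly P 0)"
      using poly_cpoly_of_real[of P 0] poly_cpoly_of_real[of Q 0] by (simp add: M_def)
    with \<open>Im c > 0\<close> show False by simp
  qed
  have "Im (M w) > 0" if w: "w \<in> U" for w
  proof (rule ccontr)
    assume "\<not> Im (M w) > 0"
    then have Im0: "Im (M w) = 0" using nonneg[OF w] by simp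
    have "open (M ` U)"
      by (rule open_mapping_thm[OF holo U U(1) subset_refl noncon])
    then obtain e where e: "e > 0" "ball (M w) e \<subseteq> M ` U"
      using w by (meson open_contains_ball imageI)
    have "M w - of_real (e / 2) * \<i> \<in> ball (M w) e"
      using e(1) by (simp add: dist_norm norm_mult)
    then have "M w - of_real (e / 2) * \<i> \<in> M ` U" using e(2) by (rule rev_subsetD)
    then obtain v where "v \<in> U" "M v = M w - of_real (e / 2) * \<i>" by (metis imageE)
    with nonneg[of v] Im0 e(1) show False by simp
  qed
  then show ?thesis
    unfolding herglotz_def M_def Im_divide_cnj U_def
    by (auto simp: zero_less_divide_iff)
qed

section \<open>The normalised Jost solution\<close>

text \<open>
  The polynomials \<open>A\<^sub>x\<close> with \<open>\<psi>\<^sub>x(z) = z\<^sup>x A\<^sub>x(z) / (a\<^sub>x \<cdots> a\<^sub>p)\<close>, characterised by their recurrence and their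
  value far out. No index bound \<open>p\<close> appears, so this applies to coefficient sequences of unknown length.
\<close>

definition jost_factors :: "(nat \<Rightarrow> real) \<Rightarrow> (nat \<Rightarrow> real poly) \<Rightarrow> bool" where
  "jost_factors q A \<longleftrightarrow>
     (\<forall>x. A x = [:1, - jacobi_b q (Suc x), 1:] * A (Suc x)
          - smult ((jacobi_a q (Suc x))\<^sup>2) ([:0, 0, 1:] * A (Suc (Suc x)))) \<and>
     (\<exists>N. \<forall>x\<ge>N. A x = 1)"

lemma jost_factors_rec:
  "jost_factors q A \<Longrightarrow> A x = [:1, - jacobi_b q (Suc x), 1:] * A (Suc x)
          - smult ((jacobi_a q (Suc x))\<^sup>2) ([:0, 0, 1:] * A (Suc (Suc x)))"
  unfolding jost_factors_def by blast

lemma jost_factors_eventually: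
  assumes "jost_factors q A"
  obtains N where "\<And>x. x \<ge> N \<Longrightarrow> A x = 1"
  using assms unfolding jost_factors_def by blast

text \<open>
  The recurrence run downwards from 1; the last argument counts the remaining steps.
\<close>

fun jost_tail :: "(nat \<Rightarrow> real) \<Rightarrow> nat \<Rightarrow> nat \<Rightarrow> real poly" where
  "jost_tail q x 0 = 1"
| "jost_tail q x (Suc n) = [:1, - jacobi_b q (Suc x), 1:] * jost_tail q (Suc x) n
     - smult ((jacobi_a q (Suc x))\<^sup>2) ([:0, 0, 1:] * jost_tail q (Suc (Suc x)) (n - 1))"

text \<open>
  Properties that hold for large indices and are inherited by the preceding index. For a recurrence of
  order two they are formulated for pairs of consecutive indices.
\<close>

lemma downward_induct:
  assumes "\<And>x. N \<le> x \<Longrightarrow> P x" "\<And>x. P (Suc x) \<Longrightarrow> P x"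
  shows "P (x :: nat)"
proof (cases "N \<le> x")
  case False
  then have "x \<le> N" by simp
  then show ?thesis by (induction rule: inc_induct) (use assms in auto)
qed (rule assms)

lemma pert_class_a_pos:
  assumes "q \<in> pert_class k"
  shows "jacobi_a q x > 0"
proof (cases "x = 0")
  case False
  then have "q (2 * x) > - 1" using assms by (simp add: pert_class_def)
  then show ?thesis using False by (simp add: jacobi_a_def)
qed (simp add: jacobi_a_def)

lemma pert_class_trivial:
  assumes "q \<in> pert_class k" "(k + 1) div 2 \<le> x"
  shows "jacobi_b q (Suc x) = 0" "jacobi_a q (Suc x) = 1"
proof -
  have "q j = 0" if "j > k" for j
    using assms(1) that by (simp add: pert_class_def)
  then show "jacobi_b q (Suc x) = 0" "jacobi_a q (Suc x) = 1"
    using assms(2) by (simp_all add: jacobi_a_def jacobi_b_def)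
qed

lemma jost_factors_exist:
  assumes "q \<in> pert_class k"
  shows "\<exists>A. jost_factors q A"
proof
  let ?p = "(k + 1) div 2"
  show "jost_factors q (\<lambda>x. jost_tail q x (?p - x))"
    unfolding jost_factors_def
  proof (intro conjI allI exI impI)
    fix x
    show "jost_tail q x (?p - x) = [:1, - jacobi_b q (Suc x), 1:] * jost_tail q (Suc x) (?p - Suc x)
          - smult ((jacobi_a q (Suc x))\<^sup>2) ([:0, 0, 1:] * jost_tail q (Suc (Suc x)) (?p - Suc (Suc x)))"
    proof (cases "?p \<le> x")
      case True
      then show ?thesis using pert_class_trivial[OF assms True]
        by simp
    next
      case False
      then have "?p - x = Suc (?p - Suc x)" by simp
      then show ?thesis by simp
    qed
  next
    fix x assume "?p \<le> x"
    then show "jost_tail q x (?p - x) = 1" by simp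
  qed
qed

lemma jost_factors_unique:
  assumes "jost_factors q A" "jost_factors q A'"
  shows "A = A'"
proof
  fix x
  obtain N where N: "\<And>x. x \<ge> N \<Longrightarrow> A x = 1" using jost_factors_eventually[OF assms(1)] by blast
  obtain N' where N': "\<And>x. x \<ge> N' \<Longrightarrow> A' x = 1" using jost_factors_eventually[OF assms(2)] by blast
  have "A x = A' x \<and> A (Suc x) = A' (Suc x)"
  proof (induction x rule: downward_induct[where N = "max N N'"])
    fix x assume "A (Suc x) = A' (Suc x) \<and> A (Suc (Suc x)) = A' (Suc (Suc x))"
    then show "A x = A' x \<and> A (Suc x) = A' (Suc x)"
      using jost_factors_rec[OF assms(1), of x] jost_factors_rec[OF assms(2), of x] by simp
  qed (simp add: N N')
  then show "A x = A' x" ..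
qed

lemma jost_factors_tail_1:
  assumes "q \<in> pert_class k" "jost_factors q A" "(k + 1) div 2 \<le> x"
  shows "A x = 1"
proof -
  obtain N where N: "\<And>x. x \<ge> N \<Longrightarrow> A x = 1" using jost_factors_eventually[OF assms(2)] by blast
  have "(k + 1) div 2 \<le> x \<longrightarrow> A x = 1 \<and> A (Suc x) = 1"
  proof (induction x rule: downward_induct[where N = N])
    fix x assume IH: "(k + 1) div 2 \<le> Suc x \<longrightarrow> A (Suc x) = 1 \<and> A (Suc (Suc x)) = 1"
    show "(k + 1) div 2 \<le> x \<longrightarrow> A x = 1 \<and> A (Suc x) = 1"
    proof
      assume x: "(k + 1) div 2 \<le> x"
      with IH have 1: "A (Suc x) = 1" "A (Suc (Suc x)) = 1" by auto
      show "A x = 1 \<and> A (Suc x) = 1"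
        using jost_factors_rec[OF assms(2), of x] pert_class_trivial[OF assms(1) x]
        by (simp add: 1)
    qed
  qed (simp add: N)
  with assms(3) show ?thesis by blast
qed

lemma coeff_jost_step:
  fixes P Q :: "'a :: comm_ring_1 poly"
  shows "coeff ([:1, - b, 1:] * P - smult d ([:0, 0, 1:] * Q)) 0 = coeff P 0"
    and "coeff ([:1, - b, 1:] * P - smult d ([:0, 0, 1:] * Q)) (Suc 0) = coeff P 1 - b * coeff P 0"
    and "coeff ([:1, - b, 1:] * P - smult d ([:0, 0, 1:] * Q)) (Suc (Suc i))
       = coeff P (i + 2) - b * coeff P (i + 1) + coeff P i - d * coeff Q i"
  by (simp_all add: coeff_pCons)

lemma jost_factors_coeff_0:
  assumes "jost_factors q A"
  shows "coeff (A x) 0 = 1"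
proof -
  obtain N where N: "\<And>x. x \<ge> N \<Longrightarrow> A x = 1" using jost_factors_eventually[OF assms] by blast
  show ?thesis
  proof (induction x rule: downward_induct[where N = N])
    fix x assume "coeff (A (Suc x)) 0 = 1"
    then show "coeff (A x) 0 = 1"
      by (subst jost_factors_rec[OF assms, of x]) (simp only: coeff_jost_step)
  qed (simp add: N)
qed

text \<open>
  The last entry \<open>q\<^sub>k\<close> decides the leading coefficient: it is \<open>- b\<^sub>p\<close> for \<open>k = 2 p - 1\<close> and \<open>1 - a\<^sub>p\<^sup>2\<close> for
  \<open>k = 2 p\<close>, and every further step multiplies by a monic quadratic polynomial and subtracts a term of lower
  degree.
\<close>

lemma jost_factors_degree:
  assumes q: "q \<in> pert_class k" and A: "jost_factors q A" and "2 * x < k"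
  shows "degree (A x) = k - 2 * x"
proof -
  have "(2 * x < k \<longrightarrow> degree (A x) = k - 2 * x) \<and> (2 * Suc x < k \<longrightarrow> degree (A (Suc x)) = k - 2 * Suc x)"
  proof (induction x rule: downward_induct[where N = k])
    fix x
    assume IH: "(2 * Suc x < k \<longrightarrow> degree (A (Suc x)) = k - 2 * Suc x) \<and>
      (2 * Suc (Suc x) < k \<longrightarrow> degree (A (Suc (Suc x))) = k - 2 * Suc (Suc x))"
    have "degree (A x) = k - 2 * x" if x: "2 * x < k"
    proof (cases "2 * x + 2 < k")
      case False
      then have p: "(k + 1) div 2 \<le> Suc x" using x by simp
      have 1: "A (Suc x) = 1" "A (Suc (Suc x)) = 1"
        using jost_factors_tail_1[OF q A] p by auto
      have rec: "A x = [:1, - jacobi_b q (Suc x), 1 - (jacobi_a q (Suc x))\<^sup>2:]"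
        using jost_factors_rec[OF A, of x] by (simp add: 1)
      have qk: "q k \<noteq> 0" using q by (simp add: pert_class_def)
      show ?thesis
      proof (cases "k = 2 * x + 1")
        case True
        have "jacobi_a q (Suc x) = 1" using q True by (auto simp: pert_class_def jacobi_a_def)
        moreover have "jacobi_b q (Suc x) = q k" by (simp add: jacobi_b_def True)
        ultimately show ?thesis using rec qk True by simp
      next
        case False
        with x \<open>\<not> 2 * x + 2 < k\<close> have k: "k = 2 * x + 2" by simp
        have "jacobi_a q (Suc x) = 1 + q k" by (simp add: jacobi_a_def k)
        then have "jacobi_a q (Suc x) \<noteq> 1" using qk by simp
        moreover have "jacobi_a q (Suc x) > 0" by (rule pert_class_a_pos[OF q])
        ultimately have "1 - (jacobi_a q (Suc x))\<^sup>2 \<noteq> 0"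
          by (simp add: power2_eq_1_iff)
        then show ?thesis using rec k by simp
      qed
    next
      case True
      with IH have d1: "degree (A (Suc x)) = k - 2 * Suc x" by simp
      have d2: "degree (A (Suc (Suc x))) \<le> k - 2 * Suc (Suc x)"
      proof (cases "2 * Suc (Suc x) < k")
        case False
        then have "(k + 1) div 2 \<le> Suc (Suc x)" by simp
        from jost_factors_tail_1[OF q A this] show ?thesis by simp
      qed (use IH in simp)
      have "A (Suc x) \<noteq> 0" using d1 True by auto
      define L S where "L = [:1, - jacobi_b q (Suc x), 1:] * A (Suc x)"
        and "S = smult ((jacobi_a q (Suc x))\<^sup>2) ([:0, 0, 1:] * A (Suc (Suc x)))"
      have L: "degree L = k - 2 * x"
        using d1 True \<open>A (Suc x) \<noteq> 0\<close> unfolding L_def by (subst degree_mult_eq) auto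
      have S: "degree S < k - 2 * x"
        unfolding S_def
        using degree_smult_le[of "(jacobi_a q (Suc x))\<^sup>2" "[:0, 0, 1:] * A (Suc (Suc x))"]
          degree_mult_le[of "[:0, 0, 1:]" "A (Suc (Suc x))"] d2 True by simp
      have "degree (L + - S) = degree L"
        by (rule degree_add_eq_left) (simp add: L S)
      moreover have "A x = L + - S"
        using jost_factors_rec[OF A, of x] by (simp only: L_def S_def add_uminus_conv_diff)
      ultimately show ?thesis by (simp only: L)
    qed
    with IH show "(2 * x < k \<longrightarrow> degree (A x) = k - 2 * x) \<and>
      (2 * Suc x < k \<longrightarrow> degree (A (Suc x)) = k - 2 * Suc x)" by blast
  qed auto
  with assms(3) show ?thesis by blast
qed

lemma jost_factors_wronskian:
  assumes q: "\<And>x. jacobi_a q x > 0" and A: "jost_factors q A"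
  shows "\<exists>C>0. has_wronskian (cpoly (A x)) (pCons 0 (cpoly (A (Suc x)))) (of_real C)"
proof -
  obtain N where N: "\<And>x. x \<ge> N \<Longrightarrow> A x = 1" using jost_factors_eventually[OF A] by blast
  show ?thesis
  proof (induction x rule: downward_induct[where N = N])
    fix x assume "N \<le> x"
    then have "A x = 1" "A (Suc x) = 1" using N by auto
    then show "\<exists>C>0. has_wronskian (cpoly (A x)) (pCons 0 (cpoly (A (Suc x)))) (of_real C)"
      by (intro exI[of _ 1]) (simp add: has_wronskian_def)
  next
    fix x assume "\<exists>C>0. has_wronskian (cpoly (A (Suc x))) (pCons 0 (cpoly (A (Suc (Suc x))))) (of_real C)"
    then obtain C where C: "C > 0"
      "has_wronskian (cpoly (A (Suc x))) (pCons 0 (cpoly (A (Suc (Suc x))))) (of_real C)" by blast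
    define d where "d = (jacobi_a q (Suc x))\<^sup>2"
    have "cpoly (A x) = [:1, - of_real (jacobi_b q (Suc x)), 1:] * cpoly (A (Suc x))
       - smult (of_real d) ([:0, 0, 1:] * cpoly (A (Suc (Suc x))))"
      by (subst jost_factors_rec[OF A, of x])
        (simp only: cpoly_diff cpoly_mult cpoly_smult cpoly_pCons d_def of_real_minus of_real_1 of_real_0 map_poly_0)
    then have "has_wronskian (cpoly (A x)) (pCons 0 (cpoly (A (Suc x)))) (of_real (d * C))"
      using has_wronskian_step[OF C(2)] by simp
    moreover have "d * C > 0" using C(1) q[of "Suc x"] by (simp add: d_def)
    ultimately show "\<exists>C>0. has_wronskian (cpoly (A x)) (pCons 0 (cpoly (A (Suc x)))) (of_real C)"
      by blast
  qed
qed

text \<open>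
  One step of the continued fraction: with \<open>u = A\<^sub>x\<^sub>+\<^sub>1(z)\<close> the ratio \<open>A\<^sub>x / (z u)\<close> equals
  \<open>z + 1/z - b - a\<^sup>2 (z A\<^sub>x\<^sub>+\<^sub>2 / u)\<close>, and for \<open>z\<close> in the upper half disc both \<open>z + 1/z\<close> and the last term push
  the imaginary part down.
\<close>

lemma jost_factors_herglotz:
  assumes A: "jost_factors q A"
  shows "herglotz (A x) (pCons 0 (A (Suc x)))"
proof -
  obtain N where N: "\<And>x. x \<ge> N \<Longrightarrow> A x = 1" using jost_factors_eventually[OF A] by blast
  show ?thesis
  proof (induction x rule: downward_induct[where N = N])
    fix x assume "N \<le> x"
    then show "herglotz (A x) (pCons 0 (A (Suc x)))" using N by (simp add: herglotz_def)
  next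
    fix x assume IH: "herglotz (A (Suc x)) (pCons 0 (A (Suc (Suc x))))"
    show "herglotz (A x) (pCons 0 (A (Suc x)))"
      unfolding herglotz_def
    proof (intro allI impI)
      fix z assume z: "cmod z < 1 \<and> 0 < Im z"
      define b d where "b = jacobi_b q (Suc x)" and "d = (jacobi_a q (Suc x))\<^sup>2"
      define u v where "u = poly (cpoly (A (Suc x))) z" and "v = poly (cpoly (A (Suc (Suc x)))) z"
      have uv: "0 < Im (z * v * cnj u)"
        using IH z by (auto simp: herglotz_def u_def v_def)
      then have "u \<noteq> 0" by auto
      have "poly (cpoly (A x)) z = poly ([:1, - of_real b, 1:] * cpoly (A (Suc x))
         - smult (of_real d) ([:0, 0, 1:] * cpoly (A (Suc (Suc x))))) z"
        by (subst jost_factors_rec[OF A, of x])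
          (simp only: cpoly_diff cpoly_mult cpoly_smult cpoly_pCons d_def b_def of_real_minus of_real_1 of_real_0 map_poly_0)
      then have Ax: "poly (cpoly (A x)) z = (1 + z * z - of_real b * z) * u - of_real d * (z * z * v)"
        unfolding u_def v_def by (simp add: algebra_simps)
      define n where "n = (cmod z)\<^sup>2"
      have n: "z * cnj z = of_real n" unfolding n_def by (rule complex_norm_square[symmetric])
      have n1: "n < 1" using z by (simp add: n_def power_less_one_iff abs_square_less_1)
      have "z * u * cnj ((1 + z * z - of_real b * z) * u - of_real d * (z * z * v))
        = (u * cnj u) * (z + z * cnj z * cnj z - of_real b * (z * cnj z)) - of_real d * (z * cnj z) * (cnj (z * v * cnj u))"
        by (simp add: algebra_simps)
      also have "\<dots> = of_real ((cmod u)\<^sup>2) * (z + of_real n * cnj z - of_real (b * n)) - of_real (d * n) * cnj (z * v * cnj u)"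
        unfolding n by (simp add: complex_norm_square[symmetric])
      finally have eq: "z * u * cnj (poly (cpoly (A x)) z)
        = of_real ((cmod u)\<^sup>2) * (z + of_real n * cnj z - of_real (b * n)) - of_real (d * n) * cnj (z * v * cnj u)"
        unfolding Ax .
      define r w where "r = (cmod u)\<^sup>2" and "w = z * v * cnj u"
      have "Im (z * u * cnj (poly (cpoly (A x)) z))
         = (cmod u)\<^sup>2 * ((1 - n) * Im z) + d * n * Im (z * v * cnj u)"
        unfolding eq unfolding r_def[symmetric] w_def[symmetric] by (simp add: algebra_simps)
      moreover have "0 < (cmod u)\<^sup>2 * ((1 - n) * Im z)" using n1 z \<open>u \<noteq> 0\<close> by simp
      moreover have "0 \<le> d * n * Im (z * v * cnj u)"
        using uv by (intro mult_nonneg_nonneg) (auto simp: d_def n_def)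
      ultimately show "0 < Im (poly (cpoly (pCons 0 (A (Suc x)))) z * cnj (poly (cpoly (A x)) z))"
        by (simp add: u_def)
    qed
  qed
qed

lemma jost_factors_admissible:
  assumes q: "q \<in> pert_class k" and A: "jost_factors q A"
  shows "admissible (A x)"
proof -
  obtain C where C: "C > 0" "has_wronskian (cpoly (A x)) (pCons 0 (cpoly (A (Suc x)))) (of_real C)"
    using jost_factors_wronskian[OF pert_class_a_pos[OF q] A] by blast
  have "has_wronskian (cpoly (A x)) (cpoly (pCons 0 (A (Suc x)))) (of_real C)" using C(2) by simp
  from herglotz_admissible[OF jost_factors_herglotz[OF A] this C(1)] show ?thesis
    by (simp add: poly_0_coeff_0 jost_factors_coeff_0[OF A])
qed

lemma pert_class_eqI:
  assumes "q 0 = 0" "q' 0 = 0"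
    and "\<And>x. jacobi_a q (Suc x) = jacobi_a q' (Suc x)" "\<And>x. jacobi_b q (Suc x) = jacobi_b q' (Suc x)"
  shows "q = q'"
proof
  fix j
  show "q j = q' j"
  proof (cases j)
    case (Suc i)
    show ?thesis
    proof (cases "even i")
      case True
      then obtain x where "i = 2 * x" by blast
      with assms(4)[of x] show ?thesis by (simp add: jacobi_b_def Suc)
    next
      case False
      then obtain x where "i = 2 * x + 1" by (elim oddE)
      with assms(3)[of x] show ?thesis by (simp add: jacobi_a_def Suc)
    qed
  qed (use assms in simp)
qed

text \<open>
  By uniqueness for the Wronskian identity and the normalisation at 0, equal \<open>A\<^sub>x\<close> have equal successors. Comparing
  the coefficients of \<open>z\<close> and \<open>z\<^sup>2\<close> in the recurrence then gives \<open>b\<close> and \<open>a\<^sup>2\<close>.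
\<close>

lemma jost_factors_inject:
  assumes q: "q \<in> pert_class k" "q' \<in> pert_class k'" and A: "jost_factors q A" "jost_factors q' A'"
    and eq: "A 0 = A' 0"
  shows "q = q'"
proof -
  have step: "A (Suc x) = A' (Suc x)" if eqx: "A x = A' x" for x
  proof -
    obtain C where C: "C > 0" "has_wronskian (cpoly (A x)) (pCons 0 (cpoly (A (Suc x)))) (of_real C)"
      using jost_factors_wronskian[OF pert_class_a_pos[OF q(1)] A(1)] by blast
    obtain C' where C': "C' > 0" "has_wronskian (cpoly (A x)) (pCons 0 (cpoly (A' (Suc x)))) (of_real C')"
      using jost_factors_wronskian[OF pert_class_a_pos[OF q(2)] A(2), of x] unfolding eqx by blast
    have "smult (of_real C') (cpoly (A (Suc x))) = smult (of_real C) (cpoly (A' (Suc x)))"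
      by (rule has_wronskian_unique[OF C(2) C'(2)])
        (use C in \<open>simp_all add: poly_0_coeff_0 jost_factors_coeff_0[OF A(1)]\<close>)
    then have *: "smult C' (A (Suc x)) = smult C (A' (Suc x))"
      by (simp flip: cpoly_smult)
    from arg_cong[OF this, of "\<lambda>p. coeff p 0"] have "C = C'"
      by (simp add: jost_factors_coeff_0[OF A(1)] jost_factors_coeff_0[OF A(2)])
    with * C(1) show ?thesis by (metis less_irrefl smult_cancel)
  qed
  have AA: "A x = A' x" for x
    by (induction x) (use eq step in auto)
  have b: "jacobi_b q (Suc x) = jacobi_b q' (Suc x)" for x
  proof -
    have "coeff (A x) 1 = coeff (A (Suc x)) 1 - jacobi_b q (Suc x)"
      by (subst jost_factors_rec[OF A(1), of x])
        (simp only: One_nat_def coeff_jost_step jost_factors_coeff_0[OF A(1)] mult_1_right)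
    moreover have "coeff (A' x) 1 = coeff (A' (Suc x)) 1 - jacobi_b q' (Suc x)"
      by (subst jost_factors_rec[OF A(2), of x])
        (simp only: One_nat_def coeff_jost_step jost_factors_coeff_0[OF A(2)] mult_1_right)
    ultimately show ?thesis by (simp add: AA)
  qed
  have a: "jacobi_a q (Suc x) = jacobi_a q' (Suc x)" for x
  proof -
    have "smult ((jacobi_a q (Suc x))\<^sup>2) ([:0, 0, 1:] * A (Suc (Suc x)))
       = smult ((jacobi_a q' (Suc x))\<^sup>2) ([:0, 0, 1:] * A (Suc (Suc x)))"
      using jost_factors_rec[OF A(1), of x] jost_factors_rec[OF A(2), of x] by (simp add: AA b)
    from arg_cong[OF this, of "\<lambda>p. coeff p (Suc (Suc 0))"]
    have "(jacobi_a q (Suc x))\<^sup>2 = (jacobi_a q' (Suc x))\<^sup>2"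
      by (simp add: jost_factors_coeff_0[OF A(1)])
    then show ?thesis
      using pert_class_a_pos[OF q(1), of "Suc x"] pert_class_a_pos[OF q(2), of "Suc x"]
      by (simp add: power2_eq_iff_nonneg)
  qed
  show ?thesis
    by (rule pert_class_eqI) (use q a b in \<open>auto simp: pert_class_def\<close>)
qed

section \<open>Reconstruction\<close>

text \<open>
  The factor \<open>z\<close> does not affect the sign condition: at a zero of \<open>X\<close> it contributes \<open>s\<close> to the derivative
  and \<open>1/s\<close> to the value at \<open>1/s\<close>.
\<close>

lemma admissible_divide_id:
  assumes "admissible (pCons 0 X)" "coeff X 0 \<noteq> 0"
  shows "admissible X"
  unfolding admissible_def
proof (intro conjI allI impI)
  fix z assume z: "cmod z \<le> 1 \<and> poly (cpoly X) z = 0"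
  then have "z \<in> \<real> \<and> poly (cpoly (pderiv (pCons 0 X))) z \<noteq> 0"
    using assms(1) unfolding admissible_def by simp
  moreover have "poly (cpoly (pderiv (pCons 0 X))) z = z * poly (cpoly (pderiv X)) z"
    using z by (simp add: pderiv_pCons cpoly_add)
  ultimately show "z \<in> \<real>" "poly (cpoly (pderiv X)) z \<noteq> 0" by auto
next
  fix s :: real assume s: "\<bar>s\<bar> < 1 \<and> s \<noteq> 0 \<and> poly X s = 0"
  then have "0 < s * poly (pderiv (pCons 0 X)) s * poly (pCons 0 X) (inverse s)"
    using assms(1) unfolding admissible_def by simp
  also have "\<dots> = s * poly (pderiv X) s * poly X (inverse s)"
    using s by (simp add: pderiv_pCons)
  finally show "0 < s * poly (pderiv X) s * poly X (inverse s)" .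
qed

lemma admissible_smult:
  assumes "admissible X" "c \<noteq> 0"
  shows "admissible (smult c X)"
  unfolding admissible_def
proof (intro conjI allI impI)
  fix z assume "cmod z \<le> 1 \<and> poly (cpoly (smult c X)) z = 0"
  then show "z \<in> \<real>" "poly (cpoly (pderiv (smult c X))) z \<noteq> 0"
    using assms by (auto simp: admissible_def cpoly_smult pderiv_smult)
next
  fix s :: real assume "\<bar>s\<bar> < 1 \<and> s \<noteq> 0 \<and> poly (smult c X) s = 0"
  then have "0 < s * poly (pderiv X) s * poly X (inverse s)"
    using assms by (auto simp: admissible_def)
  then have "0 < c\<^sup>2 * (s * poly (pderiv X) s * poly X (inverse s))" using assms(2) by simp
  then show "0 < s * poly (pderiv (smult c X)) s * poly (smult c X) (inverse s)"
    by (simp add: pderiv_smult power2_eq_square algebra_simps)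
qed

text \<open>
  The zero of \<open>z X\<close> at 0, seen with the roles of numerator and denominator exchanged.
\<close>

lemma herglotz_coeff_pos:
  assumes "herglotz P (pCons 0 X)" "coeff P 0 > 0"
  shows "coeff X 0 > 0"
proof -
  have "herglotz (pCons 0 X) (- P)" using assms(1) by (rule herglotz_swap)
  from herglotz_root[OF this, of 0] assms(2) show ?thesis
    by (simp add: poly_0_coeff_0 pderiv_pCons mult_less_0_iff zero_less_mult_iff)
qed

text \<open>
  The state of the reconstruction: a candidate for \<open>(A\<^sub>x, A\<^sub>x\<^sub>+\<^sub>1)\<close>.
\<close>

definition jost_pair :: "real poly \<Rightarrow> real poly \<Rightarrow> bool" where
  "jost_pair P X \<longleftrightarrow> admissible P \<and> coeff P 0 = 1 \<and> coeff X 0 = 1 \<and>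
     (\<exists>C>0. has_wronskian (cpoly P) (pCons 0 (cpoly X)) (of_real C))"

lemma jost_pairI:
  assumes P: "admissible P" "coeff P 0 = 1" and C: "C > 0"
    and W: "has_wronskian (cpoly P) (pCons 0 (cpoly X)) (of_real C)"
  shows "coeff X 0 > 0" "jost_pair P (smult (inverse (coeff X 0)) X)"
proof -
  have W': "has_wronskian (cpoly P) (cpoly (pCons 0 X)) (of_real C)" using W by simp
  have "herglotz P (pCons 0 X)"
    by (rule admissible_herglotz[OF P(1) W' C]) (simp add: P poly_0_coeff_0)
  from herglotz_coeff_pos[OF this] P show X: "coeff X 0 > 0" by simp
  have "has_wronskian (cpoly P) (pCons 0 (cpoly (smult (inverse (coeff X 0)) X)))
     (of_real (inverse (coeff X 0) * C))"
    using has_wronskian_smult[OF W, of "of_real (inverse (coeff X 0))"] by (simp add: cpoly_smult)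
  moreover have "inverse (coeff X 0) * C > 0" using X C by simp
  ultimately show "jost_pair P (smult (inverse (coeff X 0)) X)"
    unfolding jost_pair_def using P X by auto
qed

text \<open>
  Exchanging the roles of \<open>P\<close> and \<open>z X\<close> shows that \<open>X\<close> is admissible. The coefficient \<open>b\<close> is forced by the
  vanishing of the coefficient of \<open>z\<close> in \<open>(1 - b z + z\<^sup>2) X - P = z\<^sup>2 Y\<close>, the Wronskian identity passes to
  \<open>X\<close> and \<open>Y\<close>, and so \<open>a\<^sup>2 = Y(0)\<close> is positive.
\<close>

lemma jost_pair_step:
  assumes "jost_pair P X"
  shows "\<exists>b a Y. a > 0 \<and> jost_pair X Y \<and> P = [:1, - b, 1:] * X - smult (a\<^sup>2) ([:0, 0, 1:] * Y)"
proof -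
  obtain C where P: "admissible P" "coeff P 0 = 1" and X: "coeff X 0 = 1" and C: "C > 0"
    and W: "has_wronskian (cpoly P) (pCons 0 (cpoly X)) (of_real C)"
    using assms unfolding jost_pair_def by blast
  have W': "has_wronskian (cpoly P) (cpoly (pCons 0 X)) (of_real C)" using W by simp
  have "herglotz P (pCons 0 X)"
    by (rule admissible_herglotz[OF P(1) W' C]) (simp add: P poly_0_coeff_0)
  then have "herglotz (pCons 0 X) (- P)" by (rule herglotz_swap)
  moreover have "has_wronskian (cpoly (pCons 0 X)) (cpoly (- P)) (of_real C)"
    using has_wronskian_swap[OF W'] by (simp only: cpoly_uminus)
  ultimately have "admissible (pCons 0 X)"
    by (rule herglotz_admissible) (use C P in \<open>auto simp: poly_0_coeff_0\<close>)
  then have aX: "admissible X" by (rule admissible_divide_id) (simp add: X)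
  define b where "b = coeff X 1 - coeff P 1"
  define N where "N = [:1, - b, 1:] * X - P"
  have N: "coeff N 0 = 0" "coeff N (Suc 0) = 0"
    by (simp_all add: N_def b_def X P coeff_pCons)
  define Y where "Y = poly_shift 2 N"
  have NY: "N = [:0, 0, 1:] * Y"
    by (rule poly_eqI) (simp add: Y_def coeff_poly_shift coeff_pCons N split: nat.splits)
  have "[:0, 0, 1:] * cpoly Y = [:1, - of_real b, 1:] * cpoly X - cpoly P"
    using arg_cong[OF NY[unfolded N_def], of cpoly]
    by (simp only: cpoly_diff cpoly_mult cpoly_pCons of_real_minus of_real_1 of_real_0 map_poly_0)
  from has_wronskian_step_back[OF W this]
  have WY: "has_wronskian (cpoly X) (pCons 0 (cpoly Y)) (of_real C)" .
  define y where "y = coeff Y 0"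
  have y: "y > 0" and pair: "jost_pair X (smult (inverse y) Y)"
    unfolding y_def by (rule jost_pairI[OF aX X C WY])+
  have "P = [:1, - b, 1:] * X - [:0, 0, 1:] * Y"
    using NY by (simp only: N_def)
  also have "[:0, 0, 1:] * Y = smult ((sqrt y)\<^sup>2) ([:0, 0, 1:] * smult (inverse y) Y)"
    using y by simp
  finally show ?thesis using y pair
    by (intro exI[of _ b] exI[of _ "sqrt y"] exI[of _ "smult (inverse y) Y"]) auto
qed

lemma jost_pair_degree: "jost_pair P X \<Longrightarrow> degree X \<le> degree P - 2"
  unfolding jost_pair_def using has_wronskian_degree[of "cpoly P" "cpoly X"]
  by (auto simp: poly_0_coeff_0)

lemma finite_support_pert_class:
  assumes "q 0 = 0" "\<And>x. jacobi_a q (Suc x) > 0" "\<And>j. j > K \<Longrightarrow> q j = 0" "q \<noteq> (\<lambda>_. 0)"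
  shows "\<exists>k\<ge>1. q \<in> pert_class k"
proof -
  define S where "S = {j. q j \<noteq> 0}"
  have "S \<subseteq> {..K}" using assms(3) by (auto simp: S_def not_less[symmetric])
  then have fin: "finite S" using finite_subset by blast
  moreover have "S \<noteq> {}" using assms(4) by (auto simp: S_def)
  ultimately have Max: "Max S \<in> S" "\<And>j. j \<in> S \<Longrightarrow> j \<le> Max S" by auto
  have "q (Max S) \<noteq> 0" using Max(1) by (simp add: S_def)
  moreover have "q j = 0" if "j > Max S" for j using Max(2)[of j] that by (auto simp: S_def)
  moreover have "range q \<subseteq> insert 0 (q ` S)" by (auto simp: S_def)
  then have "bounded (range q)" using fin by (meson finite_imageI finite_imp_bounded finite_insert finite_subset)
  moreover have "q (2 * x) > - 1" if "x \<ge> 1" for x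
    using assms(2)[of "x - 1"] that by (simp add: jacobi_a_def)
  ultimately have "q \<in> pert_class (Max S)" using assms(1) by (simp add: pert_class_def)
  moreover have "Max S \<noteq> 0" using \<open>q (Max S) \<noteq> 0\<close> assms(1) by metis
  ultimately show ?thesis by (intro exI[of _ "Max S"]) auto
qed

lemma jost_factors_0:
  assumes "jost_factors (\<lambda>_. 0) A"
  shows "A x = 1"
proof -
  have "jost_factors (\<lambda>_. 0) (\<lambda>_. 1)"
    by (auto simp: jost_factors_def jacobi_a_def jacobi_b_def)
  from jost_factors_unique[OF assms this] show ?thesis by simp
qed

text \<open>
  Iterating the step yields coefficients that are trivial after at most \<open>k\<close> steps, because the degrees decrease. That the resulting
  perturbation ends exactly at \<open>k\<close> is read off from the degree of \<open>A\<^sub>0\<close> and not tracked through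
  the iteration.
\<close>

lemma jost_factors_surj:
  assumes P: "admissible P" "coeff P 0 = 1" "degree P = k" "k \<ge> 1"
    and X: "has_wronskian (cpoly P) (pCons 0 (cpoly X)) 1"
  shows "\<exists>q\<in>pert_class k. \<exists>A. jost_factors q A \<and> A 0 = P"
proof -
  have "has_wronskian (cpoly P) (pCons 0 (cpoly X)) (of_real 1)" using X by simp
  from jost_pairI(2)[OF P(1,2) _ this] obtain X0 where X0: "jost_pair P X0" by auto
  define R where "R S T \<longleftrightarrow> fst T = snd S \<and> (\<exists>b a. a > 0 \<and>
      fst S = [:1, - b, 1:] * snd S - smult (a\<^sup>2) ([:0, 0, 1:] * snd T))" for S T :: "real poly \<times> real poly"
  have "\<exists>f. f 0 = (P, X0) \<and> (\<forall>n. jost_pair (fst (f n)) (snd (f n)) \<and> R (f n) (f (Suc n)))"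
  proof -
    have "\<exists>f :: nat \<Rightarrow> real poly \<times> real poly. \<forall>n. (jost_pair (fst (f n)) (snd (f n)) \<and> (n = 0 \<longrightarrow> f n = (P, X0))) \<and> R (f n) (f (Suc n))"
    proof (rule dependent_nat_choice)
      show "\<exists>x. jost_pair (fst x) (snd x) \<and> ((0::nat) = 0 \<longrightarrow> x = (P, X0))" using X0 by auto
      fix x and n :: nat assume "jost_pair (fst x) (snd x) \<and> (n = 0 \<longrightarrow> x = (P, X0))"
      then obtain b a Y where "a > 0" "jost_pair (snd x) Y"
        "fst x = [:1, - b, 1:] * snd x - smult (a\<^sup>2) ([:0, 0, 1:] * Y)"
        using jost_pair_step by blast
      then show "\<exists>y. (jost_pair (fst y) (snd y) \<and> (Suc n = 0 \<longrightarrow> y = (P, X0))) \<and> R x y"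
        by (intro exI[of _ "(snd x, Y)"]) (auto simp: R_def)
    qed
    then show ?thesis by blast
  qed
  then obtain f where f: "f 0 = (P, X0)" "\<And>n. jost_pair (fst (f n)) (snd (f n))" "\<And>n. R (f n) (f (Suc n))"
    by blast
  define A where "A n = fst (f n)" for n
  have snd: "snd (f n) = A (Suc n)" for n using f(3)[of n] by (simp add: R_def A_def)
  have "\<exists>b a. a > 0 \<and> A n = [:1, - b, 1:] * A (Suc n) - smult (a\<^sup>2) ([:0, 0, 1:] * A (Suc (Suc n)))" for n
    using f(3)[of n] unfolding R_def snd by (simp add: A_def)
  then obtain b a where ab: "\<And>n. a n > 0"
    "\<And>n. A n = [:1, - b n, 1:] * A (Suc n) - smult ((a n)\<^sup>2) ([:0, 0, 1:] * A (Suc (Suc n)))"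
    by metis
  have pair: "jost_pair (A n) (A (Suc n))" for n using f(2)[of n] unfolding snd by (simp add: A_def)
  have c0: "coeff (A n) 0 = 1" for n using pair[of n] by (simp add: jost_pair_def)
  have deg: "degree (A n) \<le> k - 2 * n" for n
  proof (induction n)
    case (Suc n)
    then show ?case using jost_pair_degree[OF pair[of n]] by simp
  qed (simp add: A_def f P)
  have A1: "A n = 1" if "n \<ge> k" for n
  proof -
    have "degree (A n) = 0" using deg[of n] that by simp
    then show ?thesis using c0[of n] by (metis degree_eq_zeroE coeff_pCons_0 one_pCons)
  qed
  have ab1: "b n = 0" "a n = 1" if "n \<ge> k" for n
  proof -
    have "coeff (A n) i = coeff ([:1, - b n, 1:] * A (Suc n) - smult ((a n)\<^sup>2) ([:0, 0, 1:] * A (Suc (Suc n)))) i" for i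
      by (subst ab(2)) (rule refl)
    from this[of "Suc 0"] this[of "Suc (Suc 0)"] that have "b n = 0" "(a n)\<^sup>2 = 1"
      unfolding coeff_jost_step by (simp_all add: A1)
    then show "b n = 0" "a n = 1" using ab(1)[of n] by (auto simp: power2_eq_1_iff)
  qed
  define q where "q j = (if j = 0 then 0 else if odd j then b (j div 2) else a (j div 2 - 1) - 1)" for j
  have qa: "jacobi_a q (Suc x) = a x" and qb: "jacobi_b q (Suc x) = b x" for x
    by (simp_all add: jacobi_a_def jacobi_b_def q_def)
  have A: "jost_factors q A"
    unfolding jost_factors_def qa qb using ab(2) A1 by blast
  have "q \<noteq> (\<lambda>_. 0)"
  proof
    assume "q = (\<lambda>_. 0)"
    with jost_factors_0[of A 0] A have "A 0 = 1" by simp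
    then show False using P by (simp add: A_def f)
  qed
  then have "\<exists>k\<ge>1. q \<in> pert_class k"
  proof (intro finite_support_pert_class[where K = "2 * k"])
    fix j assume "j > 2 * k"
    then show "q j = 0" using ab1[of "j div 2"] ab1[of "j div 2 - 1"] by (auto simp: q_def elim!: evenE)
  qed (auto simp: qa ab q_def)
  then obtain k' where k': "k' \<ge> 1" "q \<in> pert_class k'" by blast
  then have "degree (A 0) = k'" using jost_factors_degree[OF k'(2) A, of 0] by simp
  then have "k' = k" using P by (simp add: A_def f)
  moreover have "A 0 = P" by (simp add: A_def f)
  ultimately show ?thesis using k'(2) A by blast
qed

section \<open>The Jost function\<close>

text \<open>
  The factor \<open>a\<^sub>x \<cdots> a\<^sub>p\<close> is an empty product for \<open>x > p\<close>; at \<open>x = 0\<close> it contains the conventional \<open>a\<^sub>0 = 1\<close>.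
\<close>

lemma jost_solution_exists:
  assumes q: "q \<in> pert_class k" and A: "jost_factors q A" and z: "z \<noteq> 0"
  shows "is_jost_solution k q z
    (\<lambda>x. z ^ x * poly (cpoly (A x)) z / of_real (\<Prod>j = x..(k + 1) div 2. jacobi_a q j))"
proof -
  define p where "p = (k + 1) div 2"
  define pr where "pr x = (\<Prod>j = x..p. jacobi_a q j)" for x
  have pr: "pr x = jacobi_a q x * pr (Suc x)" for x
  proof (cases "x \<le> p")
    case False
    then have "jacobi_a q x = 1"
      using pert_class_trivial(2)[OF q, of "x - 1"] by (cases x) (auto simp: p_def)
    then show ?thesis using False by (simp add: pr_def)
  qed (simp add: pr_def prod.atLeast_Suc_atMost)
  have pr0: "pr x \<noteq> 0" for x
    using pert_class_a_pos[OF q] by (simp add: pr_def less_imp_neq[symmetric] less_imp_neq[THEN not_sym])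
  have a0: "jacobi_a q x \<noteq> 0" for x using pert_class_a_pos[OF q, of x] by simp
  show ?thesis
    unfolding is_jost_solution_def p_def[symmetric] pr_def[symmetric]
  proof (intro conjI allI impI)
    fix x :: nat assume "x \<ge> 1"
    then obtain y where x: "x = Suc y" by (cases x) auto
    define a a' b Q where "a = complex_of_real (jacobi_a q y)" and "a' = complex_of_real (jacobi_a q x)"
      and "b = complex_of_real (jacobi_b q x)" and "Q = complex_of_real (pr (Suc x))"
    have nz: "a \<noteq> 0" "a' \<noteq> 0" "Q \<noteq> 0" using a0 pr0 by (auto simp: a_def a'_def Q_def)
    have P1: "complex_of_real (pr x) = a' * Q" by (subst pr) (simp add: a'_def Q_def)
    have P2: "complex_of_real (pr y) = a * (a' * Q)"
      by (subst pr) (simp add: a_def P1[symmetric] x)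
    define U V W where "U = poly (cpoly (A y)) z" and "V = poly (cpoly (A x)) z"
      and "W = poly (cpoly (A (Suc x))) z"
    have "poly (cpoly (A y)) z = poly ([:1, - b, 1:] * cpoly (A (Suc y)) - smult (a'\<^sup>2) ([:0, 0, 1:] * cpoly (A (Suc (Suc y))))) z"
      by (subst jost_factors_rec[OF A, of y])
        (simp only: cpoly_diff cpoly_mult cpoly_smult cpoly_pCons a'_def b_def x of_real_minus of_real_1 of_real_0 of_real_power map_poly_0)
    then have U: "U = (1 - b * z + z * z) * V - a'\<^sup>2 * (z * z * W)"
      by (simp add: U_def V_def W_def x algebra_simps)
    show "jacobi (jacobi_a q) (jacobi_b q) (\<lambda>x. z ^ x * poly (cpoly (A x)) z / of_real (pr x)) x
       = (z + inverse z) * (z ^ x * poly (cpoly (A x)) z / of_real (pr x))"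
    proof -
      have "jacobi (jacobi_a q) (jacobi_b q) (\<lambda>x. z ^ x * poly (cpoly (A x)) z / of_real (pr x)) x
        = a' * (z ^ Suc x * W / Q) + b * (z ^ x * V / (a' * Q)) + a * (z ^ y * U / (a * (a' * Q)))"
        unfolding jacobi_def using P1 P2
        by (simp add: a_def a'_def b_def U_def V_def W_def Q_def x)
      also have "\<dots> = z ^ y * (a'\<^sup>2 * (z * z * W) + b * z * V + U) / (a' * Q)"
        using nz by (simp add: x field_simps power2_eq_square)
      also have "\<dots> = z ^ y * ((1 + z * z) * V) / (a' * Q)"
        unfolding U by (simp add: algebra_simps)
      also have "\<dots> = (z + inverse z) * (z ^ x * V / (a' * Q))"
        using z nz by (simp add: x field_simps)
      finally show ?thesis by (simp add: P1 V_def)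
    qed
  next
    fix x assume "p < x"
    then show "z ^ x * poly (cpoly (A x)) z / of_real (pr x) = z ^ x"
      using jost_factors_tail_1[OF q A, of x] by (simp add: p_def pr_def)
  qed
qed

lemma jost_solution_unique:
  assumes q: "q \<in> pert_class k" and \<psi>: "is_jost_solution k q z \<psi>" "is_jost_solution k q z \<phi>"
  shows "\<psi> = \<phi>"
proof
  fix x
  have "\<psi> x = \<phi> x \<and> \<psi> (Suc x) = \<phi> (Suc x)"
  proof (induction x rule: downward_induct[where N = "Suc ((k + 1) div 2)"])
    fix x assume IH: "\<psi> (Suc x) = \<phi> (Suc x) \<and> \<psi> (Suc (Suc x)) = \<phi> (Suc (Suc x))"
    have "jacobi (jacobi_a q) (jacobi_b q) \<psi> (Suc x) = (z + inverse z) * \<psi> (Suc x)"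
      "jacobi (jacobi_a q) (jacobi_b q) \<phi> (Suc x) = (z + inverse z) * \<phi> (Suc x)"
      using \<psi> by (auto simp: is_jost_solution_def)
    then have "jacobi (jacobi_a q) (jacobi_b q) \<psi> (Suc x) = jacobi (jacobi_a q) (jacobi_b q) \<phi> (Suc x)"
      using IH by simp
    then have "of_real (jacobi_a q x) * \<psi> x = of_real (jacobi_a q x) * \<phi> x"
      using IH by (simp add: jacobi_def)
    then show "\<psi> x = \<phi> x \<and> \<psi> (Suc x) = \<phi> (Suc x)"
      using IH pert_class_a_pos[OF q, of x] by simp
  qed (use \<psi> in \<open>auto simp: is_jost_solution_def\<close>)
  then show "\<psi> x = \<phi> x" ..
qed

lemma jost_roots_eq:
  assumes q: "q \<in> pert_class k" and A: "jost_factors q A"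
  shows "jost_roots k q = proots (cpoly (A 0))"
proof -
  define c where "c = (\<Prod>j = 0..(k + 1) div 2. jacobi_a q j)"
  have "c > 0" unfolding c_def by (intro prod_pos) (use pert_class_a_pos[OF q] in auto)
  have sol: "jost_solution k q z 0 = poly (smult (of_real (inverse c)) (cpoly (A 0))) z" if "z \<noteq> 0" for z
  proof -
    have "jost_solution k q z =
      (\<lambda>x. z ^ x * poly (cpoly (A x)) z / of_real (\<Prod>j = x..(k + 1) div 2. jacobi_a q j))"
      unfolding jost_solution_def
      by (rule the_equality) (use jost_solution_exists[OF q A that] jost_solution_unique[OF q] in auto)
    then show ?thesis by (simp add: c_def field_simps)
  qed
  have "jost_poly k q = smult (of_real (inverse c)) (cpoly (A 0))"
    unfolding jost_poly_def
  proof (rule the_equality)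
    fix P assume "\<forall>z. z \<noteq> 0 \<longrightarrow> poly P z = jost_solution k q z 0"
    then show "P = smult (of_real (inverse c)) (cpoly (A 0))"
      by (intro poly_eqI_nonzero) (simp add: sol)
  qed (simp add: sol)
  then show ?thesis using \<open>c > 0\<close> by (simp add: jost_roots_def)
qed

section \<open>Parity of zeros and signs\<close>

lemma poly_no_root_sign:
  fixes G :: "real poly"
  assumes "a \<le> b" "\<And>x. a \<le> x \<Longrightarrow> x \<le> b \<Longrightarrow> poly G x \<noteq> 0"
  shows "0 < poly G a * poly G b"
proof (rule ccontr)
  assume "\<not> ?thesis"
  moreover have "poly G a * poly G b \<noteq> 0" using assms(1) assms(2)[of a] assms(2)[of b] by simp
  ultimately have neg: "poly G a * poly G b < 0" by linarith
  then have "a \<noteq> b" by (auto simp: not_less)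
  with assms(1) have "a < b" by simp
  from poly_IVT[OF this neg] assms(2) show False by (meson less_imp_le)
qed

text \<open>
  Splitting off a root between \<open>a\<close> and \<open>b\<close> changes the number of zeros by one and flips the sign of \<open>P(a) P(b)\<close>; without
  such roots the sign is positive by the intermediate value theorem.
\<close>

lemma odd_zeros_on_iff:
  assumes "P \<noteq> 0" "a < b" "poly P a \<noteq> 0" "poly P b \<noteq> 0"
  shows "odd (zeros_on (cpoly P) {a<..<b}) \<longleftrightarrow> poly P a * poly P b < 0"
  using assms
proof (induction "degree P" arbitrary: P rule: less_induct)
  case less
  show ?case
  proof (cases "\<exists>x. a < x \<and> x < b \<and> poly P x = 0")
    case True
    then obtain x where x: "a < x" "x < b" "poly P x = 0" by blast
    then obtain G where G: "P = [:-x, 1:] * G" unfolding poly_eq_0_iff_dvd by (elim dvdE)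
    have "G \<noteq> 0" using less.prems(1) G by auto
    have deg: "degree G < degree P" unfolding G using \<open>G \<noteq> 0\<close> by (subst degree_mult_eq) auto
    have Pa: "poly P a = (a - x) * poly G a" and Pb: "poly P b = (b - x) * poly G b"
      unfolding G by (simp_all add: algebra_simps)
    have Gab: "poly G a \<noteq> 0" "poly G b \<noteq> 0" using less.prems Pa Pb by auto
    have IH: "odd (zeros_on (cpoly G) {a<..<b}) \<longleftrightarrow> poly G a * poly G b < 0"
      by (rule less.hyps[OF deg \<open>G \<noteq> 0\<close> less.prems(2) Gab])
    have "cpoly P = [:- of_real x, 1:] * cpoly G" unfolding G cpoly_mult by simp
    then have "proots (cpoly P) = add_mset (of_real x) (proots (cpoly G))"
      using \<open>G \<noteq> 0\<close> by (simp only:) (subst proots_mult, auto)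
    then have "zeros_on (cpoly P) {a<..<b} = Suc (zeros_on (cpoly G) {a<..<b})"
      using x by (simp add: zeros_on_def)
    moreover have "(a - x) * (b - x) < 0" using x by (simp add: mult_neg_pos)
    then have "poly P a * poly P b < 0 \<longleftrightarrow> 0 < poly G a * poly G b"
      unfolding Pa Pb using mult_less_cancel_left_neg[of "(a - x) * (b - x)" "poly G a * poly G b" 0]
      by (simp add: mult_ac)
    moreover have "poly G a * poly G b \<noteq> 0" using Gab by simp
    then have "0 < poly G a * poly G b \<longleftrightarrow> \<not> poly G a * poly G b < 0" by linarith
    ultimately show ?thesis by (simp only: IH even_Suc simp_thms)
  next
    case False
    then have "{#z \<in># proots (cpoly P). z \<in> of_real ` {a<..<b}#} = {#z \<in># proots (cpoly P). False#}"
      using less.prems(1) by (intro filter_mset_cong refl) auto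
    then have "zeros_on (cpoly P) {a<..<b} = 0" by (simp add: zeros_on_def)
    moreover have "0 < poly P a * poly P b"
      by (rule poly_no_root_sign) (use False less.prems in \<open>auto simp: order_le_less\<close>)
    ultimately show ?thesis by simp
  qed
qed

lemma zeros_on_cong:
  assumes "P \<noteq> 0" "\<And>x. poly P x = 0 \<Longrightarrow> x \<in> I \<longleftrightarrow> x \<in> J"
  shows "zeros_on (cpoly P) I = zeros_on (cpoly P) J"
proof -
  have "{#z \<in># proots (cpoly P). z \<in> of_real ` I#} = {#z \<in># proots (cpoly P). z \<in> of_real ` J#}"
    by (rule filter_mset_cong) (use assms in auto)
  then show ?thesis by (simp add: zeros_on_def)
qed

lemma sign_after_root:
  fixes P :: "real poly"
  assumes "x < u" "poly P x = 0" "poly (pderiv P) x \<noteq> 0" "\<And>y. x < y \<Longrightarrow> y \<le> u \<Longrightarrow> poly P y \<noteq> 0"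
  shows "0 < poly P u * poly (pderiv P) x"
proof -
  obtain G where G: "P = [:-x, 1:] * G" using assms(2) unfolding poly_eq_0_iff_dvd by (elim dvdE)
  have d: "poly (pderiv P) x = poly G x" unfolding G pderiv_mult by (simp add: pderiv_pCons)
  have "0 < poly G x * poly G u"
  proof (rule poly_no_root_sign)
    fix y assume "x \<le> y" "y \<le> u"
    then show "poly G y \<noteq> 0" using assms(3) assms(4)[of y] d by (cases "y = x") (auto simp: G)
  qed (use assms in simp)
  then have "0 < (u - x) * (poly G x * poly G u)" using assms(1) by simp
  then show ?thesis unfolding d by (simp add: G algebra_simps)
qed

lemma sign_before_root:
  fixes P :: "real poly"
  assumes "u < x" "poly P x = 0" "poly (pderiv P) x \<noteq> 0" "\<And>y. u \<le> y \<Longrightarrow> y < x \<Longrightarrow> poly P y \<noteq> 0"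
  shows "poly P u * poly (pderiv P) x < 0"
proof -
  obtain G where G: "P = [:-x, 1:] * G" using assms(2) unfolding poly_eq_0_iff_dvd by (elim dvdE)
  have d: "poly (pderiv P) x = poly G x" unfolding G pderiv_mult by (simp add: pderiv_pCons)
  have "0 < poly G u * poly G x"
  proof (rule poly_no_root_sign)
    fix y assume "u \<le> y" "y \<le> x"
    then show "poly G y \<noteq> 0" using assms(3) assms(4)[of y] d by (cases "y = x") (auto simp: G)
  qed (use assms in simp)
  then have "(u - x) * (poly G u * poly G x) < 0" using assms(1) by (simp add: mult_neg_pos)
  then show ?thesis unfolding d by (simp add: G algebra_simps)
qed

text \<open>
  Between the two zeros \<open>P\<close> has a fixed sign, which is that of its slope at the left zero and
  opposite to that of its slope at the right zero.
\<close>

lemma consecutive_roots: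
  fixes P :: "real poly"
  assumes "x < y" "poly P x = 0" "poly P y = 0" "poly (pderiv P) x \<noteq> 0" "poly (pderiv P) y \<noteq> 0"
    and "\<And>w. x < w \<Longrightarrow> w < y \<Longrightarrow> poly P w \<noteq> 0"
  shows "poly (pderiv P) y * poly (pderiv P) x < 0"
proof -
  define u where "u = (x + y) / 2"
  have u: "x < u" "u < y" using assms(1) by (auto simp: u_def)
  have "0 < poly P u * poly (pderiv P) x" by (rule sign_after_root) (use assms u in auto)
  moreover have "poly P u * poly (pderiv P) y < 0" by (rule sign_before_root) (use assms u in auto)
  ultimately show ?thesis by (auto simp: zero_less_mult_iff mult_less_0_iff)
qed

text \<open>
  In the application \<open>e\<close> lists the slopes of a polynomial at its zeros on one side of 0, ordered away from 0, and
  \<open>g\<close> its values (up to a common sign) at the inverses of these zeros. The signs of \<open>g\<close> are transported from the outermost zero inwards.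
\<close>

lemma alternating_signs:
  fixes e g :: "nat \<Rightarrow> real"
  assumes "\<And>i. i \<in> {2..n} \<Longrightarrow> e i * e (i - 1) < 0"
  shows "(\<forall>i\<in>{1..n}. 0 < e i * g i) \<longleftrightarrow>
    (\<forall>i\<in>{2..n}. g i * g (i - 1) < 0) \<and> (1 \<le> n \<longrightarrow> 0 < e n * g n)"
proof (intro iffI conjI ballI impI)
  fix i assume L: "\<forall>i\<in>{1..n}. 0 < e i * g i" and i: "i \<in> {2..n}"
  have "i \<in> {1..n}" "i - 1 \<in> {1..n}" using i by auto
  with L have "0 < e i * g i" "0 < e (i - 1) * g (i - 1)" by blast+
  with assms[OF i] show "g i * g (i - 1) < 0"
    by (auto simp: zero_less_mult_iff mult_less_0_iff)
next
  fix i assume R: "(\<forall>i\<in>{2..n}. g i * g (i - 1) < 0) \<and> (1 \<le> n \<longrightarrow> 0 < e n * g n)" and i: "i \<in> {1..n}"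
  from i have "i \<le> n" by simp
  then show "0 < e i * g i" using i
  proof (induction rule: inc_induct)
    case (step j)
    then have "0 < e (Suc j) * g (Suc j)" "e (Suc j) * e j < 0" "g (Suc j) * g j < 0"
      using assms[of "Suc j"] R[THEN conjunct1, rule_format, of "Suc j"] by auto
    then show ?case by (auto simp: zero_less_mult_iff mult_less_0_iff)
  qed (use R in auto)
qed auto

section \<open>The root conditions\<close>

text \<open>
  The positive zeros and the negative ones are treated separately with \<open>alternating_signs\<close>; on the negative
  side \<open>s < 0\<close> is compensated by taking \<open>g = - P(1/s)\<close>. For the outermost zero the comparison point is any
  \<open>u\<close> between it and 1 (or -1): no zeros lie in between, so the zeros from 1 on, with 1 included, are those from \<open>u\<close> on.
\<close>

lemma parity_conditions_iff:
  assumes P: "P \<noteq> 0" and enum: "enumerates_disc_zeros (cpoly P) m n s"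
    and simple: "\<And>j. j \<in> zero_index m n \<Longrightarrow> poly (pderiv P) (s j) \<noteq> 0"
    and inv: "\<And>j. j \<in> zero_index m n \<Longrightarrow> poly P (inverse (s j)) \<noteq> 0"
  shows "(\<forall>j\<in>zero_index m n. 0 < s j * poly (pderiv P) (s j) * poly P (inverse (s j))) \<longleftrightarrow>
     (\<forall>j\<in>{- int m + 1..- 1} \<union> {2..int n}.
        odd (zeros_on (cpoly P) {inverse (s j)<..<inverse (s (j - 1))})) \<and>
     (n \<ge> 1 \<longrightarrow> even (zeros_on (cpoly P) {1..<inverse (s (int n))})) \<and>
     (m \<ge> 1 \<longrightarrow> even (zeros_on (cpoly P) {inverse (s (- int m))<..- 1}))"
proof -
  have mono: "strict_mono_on (zero_index m n) s"
    and bnd: "\<And>j. j \<in> zero_index m n \<Longrightarrow> - 1 < s j \<and> s j < 1"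
    and sgn: "\<And>j. j \<in> zero_index m n \<Longrightarrow> (j < 0 \<longrightarrow> s j < 0) \<and> (0 < j \<longrightarrow> 0 < s j)"
    and img: "{z. poly (cpoly P) z = 0 \<and> cmod z < 1} = (\<lambda>j. of_real (s j)) ` zero_index m n"
    using enum unfolding enumerates_disc_zeros_def by auto
  have root: "poly P (s j) = 0" if "j \<in> zero_index m n" for j
  proof -
    have "complex_of_real (s j) \<in> {z. poly (cpoly P) z = 0 \<and> cmod z < 1}" unfolding img using that by blast
    then show ?thesis by simp
  qed
  have roots: "\<exists>j\<in>zero_index m n. x = s j" if "poly P x = 0" "- 1 < x" "x < 1" for x
  proof -
    have "complex_of_real x \<in> {z. poly (cpoly P) z = 0 \<and> cmod z < 1}" using that by simp
    then show ?thesis unfolding img by auto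
  qed
  have less: "i < j" if "s i < s j" "i \<in> zero_index m n" "j \<in> zero_index m n" for i j
    using that strict_mono_on_less[OF mono] by blast
  have consec: "poly (pderiv P) (s j) * poly (pderiv P) (s (j - 1)) < 0"
    if j: "j \<in> zero_index m n" "j - 1 \<in> zero_index m n" for j
  proof (rule consecutive_roots)
    show "s (j - 1) < s j" using strict_mono_onD[OF mono j(2,1)] by simp
    fix w assume w: "s (j - 1) < w" "w < s j"
    show "poly P w \<noteq> 0"
    proof
      assume "poly P w = 0"
      then obtain i where i: "i \<in> zero_index m n" "w = s i"
        using roots[of w] w bnd[OF j(1)] bnd[OF j(2)] by force
      with w less j have "j - 1 < i" "i < j" by auto
      then show False by simp
    qed
  qed (use j root simple in auto)
  have inv_less: "inverse (s j) < inverse (s (j - 1))"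
    if "j \<in> zero_index m n" "j - 1 \<in> zero_index m n" for j
  proof -
    have lt: "s (j - 1) < s j" using strict_mono_onD[OF mono that(2,1)] by simp
    show ?thesis
    proof (cases "0 < j")
      case True
      then have "0 < j - 1" using that(2) by (auto simp: zero_index_def)
      then have "0 < s (j - 1)" using sgn[OF that(2)] by blast
      then show ?thesis using lt by (simp add: less_imp_inverse_less)
    next
      case False
      then have "s j < 0" using sgn[OF that(1)] that(1) by (auto simp: zero_index_def)
      then show ?thesis using lt by (simp add: less_imp_inverse_less_neg)
    qed
  qed
  have odd: "odd (zeros_on (cpoly P) {inverse (s j)<..<inverse (s (j - 1))})
      \<longleftrightarrow> poly P (inverse (s j)) * poly P (inverse (s (j - 1))) < 0"
    if "j \<in> zero_index m n" "j - 1 \<in> zero_index m n" for j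
    by (rule odd_zeros_on_iff) (use P inv inv_less that in auto)
  \<comment> \<open>The point u has the sign of the slope at the outermost zero.\<close>
  have right: "even (zeros_on (cpoly P) {1..<inverse (s (int n))})
      \<longleftrightarrow> 0 < poly (pderiv P) (s (int n)) * poly P (inverse (s (int n)))" if n: "n \<ge> 1"
  proof -
    have mem: "int n \<in> zero_index m n" using n by (simp add: zero_index_def)
    have s: "0 < s (int n)" "s (int n) < 1" using bnd[OF mem] sgn[OF mem] n by auto
    define u where "u = (s (int n) + 1) / 2"
    have u: "s (int n) < u" "u < 1" using s by (auto simp: u_def)
    have v: "1 < inverse (s (int n))" using s by (simp add: one_less_inverse)
    have nr: "poly P y \<noteq> 0" if y: "s (int n) < y" "y < 1" for y
    proof
      assume "poly P y = 0"
      then obtain i where "i \<in> zero_index m n" "y = s i" using roots[of y] y s by force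
      with y less[OF _ mem] have "int n < i" by auto
      with \<open>i \<in> zero_index m n\<close> show False by (simp add: zero_index_def)
    qed
    have "zeros_on (cpoly P) {1..<inverse (s (int n))} = zeros_on (cpoly P) {u<..<inverse (s (int n))}"
      by (rule zeros_on_cong[OF P]) (use u nr in \<open>force simp: not_less\<close>)
    moreover have "odd (zeros_on (cpoly P) {u<..<inverse (s (int n))})
        \<longleftrightarrow> poly P u * poly P (inverse (s (int n))) < 0"
      by (rule odd_zeros_on_iff) (use P u v nr[of u] inv[OF mem] in auto)
    moreover have "0 < poly P u * poly (pderiv P) (s (int n))"
      by (rule sign_after_root) (use u root[OF mem] simple[OF mem] nr in auto)
    ultimately show ?thesis using inv[OF mem]
      by (auto simp: zero_less_mult_iff mult_less_0_iff)
  qed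
  have left: "even (zeros_on (cpoly P) {inverse (s (- int m))<..- 1})
      \<longleftrightarrow> poly (pderiv P) (s (- int m)) * poly P (inverse (s (- int m))) < 0" if m: "m \<ge> 1"
  proof -
    have mem: "- int m \<in> zero_index m n" using m by (simp add: zero_index_def)
    have s: "s (- int m) < 0" "- 1 < s (- int m)" using bnd[OF mem] sgn[OF mem] m by auto
    define u where "u = (s (- int m) - 1) / 2"
    have u: "u < s (- int m)" "- 1 < u" using s by (auto simp: u_def)
    have v: "inverse (s (- int m)) < - 1" using s
      using one_less_inverse[of "- s (- int m)"] by simp
    have nr: "poly P y \<noteq> 0" if y: "y < s (- int m)" "- 1 < y" for y
    proof
      assume "poly P y = 0"
      then obtain i where "i \<in> zero_index m n" "y = s i" using roots[of y] y s by force
      with y less[OF _ _ mem] have "i < - int m" by auto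
      with \<open>i \<in> zero_index m n\<close> show False by (simp add: zero_index_def)
    qed
    have "zeros_on (cpoly P) {inverse (s (- int m))<..- 1} = zeros_on (cpoly P) {inverse (s (- int m))<..<u}"
      by (rule zeros_on_cong[OF P]) (use u nr in \<open>force simp: not_less\<close>)
    moreover have "odd (zeros_on (cpoly P) {inverse (s (- int m))<..<u})
        \<longleftrightarrow> poly P (inverse (s (- int m))) * poly P u < 0"
      by (rule odd_zeros_on_iff) (use P u v nr[of u] inv[OF mem] in auto)
    moreover have "poly P u * poly (pderiv P) (s (- int m)) < 0"
      by (rule sign_before_root) (use u root[OF mem] simple[OF mem] nr in auto)
    ultimately show ?thesis using inv[OF mem]
      by (auto simp: zero_less_mult_iff mult_less_0_iff)
  qed
  have pos: "(\<forall>i\<in>{1..n}. 0 < poly (pderiv P) (s (int i)) * poly P (inverse (s (int i)))) \<longleftrightarrow>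
      (\<forall>i\<in>{2..n}. poly P (inverse (s (int i))) * poly P (inverse (s (int (i - 1)))) < 0) \<and>
      (1 \<le> n \<longrightarrow> 0 < poly (pderiv P) (s (int n)) * poly P (inverse (s (int n))))"
  proof (rule alternating_signs)
    fix i assume "i \<in> {2..n}"
    then show "poly (pderiv P) (s (int i)) * poly (pderiv P) (s (int (i - 1))) < 0"
      using consec[of "int i"] by (auto simp: zero_index_def of_nat_diff)
  qed
  have neg: "(\<forall>i\<in>{1..m}. 0 < poly (pderiv P) (s (- int i)) * - poly P (inverse (s (- int i)))) \<longleftrightarrow>
      (\<forall>i\<in>{2..m}. - poly P (inverse (s (- int i))) * - poly P (inverse (s (- int (i - 1)))) < 0) \<and>
      (1 \<le> m \<longrightarrow> 0 < poly (pderiv P) (s (- int m)) * - poly P (inverse (s (- int m))))"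
  proof (rule alternating_signs)
    fix i assume i: "i \<in> {2..m}"
    then have "- int (i - 1) - 1 = - int i" by (auto simp: of_nat_diff)
    then show "poly (pderiv P) (s (- int i)) * poly (pderiv P) (s (- int (i - 1))) < 0"
      using consec[of "- int (i - 1)"] i by (auto simp: zero_index_def mult.commute)
  qed
  have idx: "(\<forall>j\<in>zero_index m n. Q j) \<longleftrightarrow> (\<forall>i\<in>{1..n}. Q (int i)) \<and> (\<forall>i\<in>{1..m}. Q (- int i))" for Q
  proof (intro iffI conjI ballI)
    fix j assume "(\<forall>i\<in>{1..n}. Q (int i)) \<and> (\<forall>i\<in>{1..m}. Q (- int i))" "j \<in> zero_index m n"
    then show "Q j" by (cases j rule: int_cases2) (auto simp: zero_index_def)
  qed (auto simp: zero_index_def)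
  have idx2: "(\<forall>j\<in>{- int m + 1..- 1} \<union> {2..int n}. Q j) \<longleftrightarrow>
      (\<forall>i\<in>{2..n}. Q (int i)) \<and> (\<forall>i\<in>{2..m}. Q (- int (i - 1)))" for Q
  proof (intro iffI conjI ballI)
    fix j assume Q: "(\<forall>i\<in>{2..n}. Q (int i)) \<and> (\<forall>i\<in>{2..m}. Q (- int (i - 1)))"
      and j: "j \<in> {- int m + 1..- 1} \<union> {2..int n}"
    show "Q j"
    proof (cases "0 < j")
      case True
      then have "nat j \<in> {2..n}" "j = int (nat j)" using j by auto
      then show ?thesis using Q by metis
    next
      case False
      then have "nat (- j) + 1 \<in> {2..m}" "j = - int (nat (- j) + 1 - 1)" using j by auto
      then show ?thesis using Q by metis
    qed
  qed auto
  have L: "(\<forall>j\<in>zero_index m n. 0 < s j * poly (pderiv P) (s j) * poly P (inverse (s j))) \<longleftrightarrow>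
      (\<forall>i\<in>{1..n}. 0 < poly (pderiv P) (s (int i)) * poly P (inverse (s (int i)))) \<and>
      (\<forall>i\<in>{1..m}. 0 < poly (pderiv P) (s (- int i)) * - poly P (inverse (s (- int i))))"
    unfolding idx
  proof (intro arg_cong2[of _ _ _ _ "(\<and>)"] ball_cong refl)
    fix i assume "i \<in> {1..n}"
    then have "0 < s (int i)" using sgn[of "int i"] by (auto simp: zero_index_def)
    then show "(0 < s (int i) * poly (pderiv P) (s (int i)) * poly P (inverse (s (int i)))) =
      (0 < poly (pderiv P) (s (int i)) * poly P (inverse (s (int i))))"
      by (simp add: zero_less_mult_iff mult.assoc)
  next
    fix i assume "i \<in> {1..m}"
    then have "s (- int i) < 0" using sgn[of "- int i"] by (auto simp: zero_index_def)
    then show "(0 < s (- int i) * poly (pderiv P) (s (- int i)) * poly P (inverse (s (- int i)))) =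
      (0 < poly (pderiv P) (s (- int i)) * - poly P (inverse (s (- int i))))"
      by (auto simp: zero_less_mult_iff mult_less_0_iff mult.assoc)
  qed
  have R: "(\<forall>j\<in>{- int m + 1..- 1} \<union> {2..int n}.
        odd (zeros_on (cpoly P) {inverse (s j)<..<inverse (s (j - 1))})) \<longleftrightarrow>
      (\<forall>i\<in>{2..n}. poly P (inverse (s (int i))) * poly P (inverse (s (int (i - 1)))) < 0) \<and>
      (\<forall>i\<in>{2..m}. - poly P (inverse (s (- int i))) * - poly P (inverse (s (- int (i - 1)))) < 0)"
    unfolding idx2
  proof (intro arg_cong2[of _ _ _ _ "(\<and>)"] ball_cong refl)
    fix i assume "i \<in> {2..n}"
    then show "odd (zeros_on (cpoly P) {inverse (s (int i))<..<inverse (s (int i - 1))}) =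
      (poly P (inverse (s (int i))) * poly P (inverse (s (int (i - 1)))) < 0)"
      using odd[of "int i"] by (auto simp: zero_index_def of_nat_diff)
  next
    fix i assume i: "i \<in> {2..m}"
    then have "- int (i - 1) - 1 = - int i" by (auto simp: of_nat_diff)
    then show "odd (zeros_on (cpoly P) {inverse (s (- int (i - 1)))<..<inverse (s (- int (i - 1) - 1))}) =
      (- poly P (inverse (s (- int i))) * - poly P (inverse (s (- int (i - 1)))) < 0)"
      using odd[of "- int (i - 1)"] i by (auto simp: zero_index_def mult.commute)
  qed
  show ?thesis
    unfolding L R pos neg using right left by auto
qed

lemma enumerate_finite_real:
  assumes "finite (S :: real set)"
  shows "\<exists>t. strict_mono_on {1..card S} t \<and> t ` {1..card S} = S"
proof -
  define l where "l = sorted_list_of_set S"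
  have l: "length l = card S" "set l = S" "sorted_wrt (<) l"
    using assms by (auto simp: l_def)
  have "strict_mono_on {1..card S} (\<lambda>i. l ! (i - 1))"
  proof (rule strict_mono_onI)
    fix i j assume "i \<in> {1..card S}" "j \<in> {1..card S}" "i < j"
    then show "l ! (i - 1) < l ! (j - 1)"
      using l by (intro sorted_wrt_nth_less[of "(<)" l]) auto
  qed
  moreover have "(\<lambda>i. l ! (i - 1)) ` {1..card S} = S"
  proof -
    have "(\<lambda>i. i - 1) ` {1..card S} = {..<card S}"
      by (auto simp: image_iff intro!: bexI[of _ "Suc _"])
    then have "(\<lambda>i. l ! (i - 1)) ` {1..card S} = (!) l ` {..<length l}"
      by (metis image_image l(1))
    then show ?thesis using l(2) by (auto simp: set_conv_nth)
  qed
  ultimately show ?thesis by blast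
qed

lemma enumerates_disc_zeros_exists:
  assumes P: "P \<noteq> 0" "poly P 0 \<noteq> 0" and real: "\<And>z. cmod z < 1 \<Longrightarrow> poly (cpoly P) z = 0 \<Longrightarrow> z \<in> \<real>"
  shows "\<exists>m n s. enumerates_disc_zeros (cpoly P) m n s"
proof -
  define S T where "S = {x. 0 < x \<and> x < 1 \<and> poly P x = 0}" and "T = {x. 0 < x \<and> x < 1 \<and> poly P (- x) = 0}"
  have fin: "finite {x. poly P x = 0}" by (rule poly_roots_finite[OF P(1)])
  have "finite S" by (rule finite_subset[OF _ fin]) (auto simp: S_def)
  from enumerate_finite_real[OF this]
  obtain u where u: "strict_mono_on {1..card S} u" "u ` {1..card S} = S" by blast
  have "uminus ` T \<subseteq> {x. poly P x = 0}" by (auto simp: T_def)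
  then have "finite (uminus ` T)" using fin finite_subset by blast
  then have "finite T" by (simp add: finite_image_iff)
  from enumerate_finite_real[OF this]
  obtain v where v: "strict_mono_on {1..card T} v" "v ` {1..card T} = T" by blast
  define s where "s j = (if 0 < j then u (nat j) else - v (nat (- j)))" for j :: int
  have uS: "u i \<in> S" if "1 \<le> i" "i \<le> card S" for i using u(2) that by auto
  have vT: "v i \<in> T" if "1 \<le> i" "i \<le> card T" for i using v(2) that by auto
  have mem: "(0 < j \<longrightarrow> s j \<in> S) \<and> (\<not> 0 < j \<longrightarrow> - s j \<in> T)" if "j \<in> zero_index (card T) (card S)" for j
    using that uS[of "nat j"] vT[of "nat (- j)"] by (auto simp: s_def zero_index_def)
  have "enumerates_disc_zeros (cpoly P) (card T) (card S) s"
    unfolding enumerates_disc_zeros_def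
  proof (intro conjI ballI)
    show "strict_mono_on (zero_index (card T) (card S)) s"
    proof (rule strict_mono_onI)
      fix i j :: int
      assume ij: "i \<in> zero_index (card T) (card S)" "j \<in> zero_index (card T) (card S)" "i < j"
      consider "0 < i" | "i < 0" "0 < j" | "j < 0" using ij by (force simp: zero_index_def)
      then show "s i < s j"
      proof cases
        case 1
        then show ?thesis using ij strict_mono_onD[OF u(1), of "nat i" "nat j"]
          by (auto simp: s_def zero_index_def nat_le_iff)
      next
        case 2
        then show ?thesis using mem[OF ij(1)] mem[OF ij(2)] by (auto simp: S_def T_def)
      next
        case 3
        then show ?thesis using ij strict_mono_onD[OF v(1), of "nat (- j)" "nat (- i)"]
          by (auto simp: s_def zero_index_def nat_le_iff)
      qed
    qed
  next
    fix j assume j: "j \<in> zero_index (card T) (card S)"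
    then have "j \<noteq> 0" by (simp add: zero_index_def)
    then show "- 1 < s j" "s j < 1" "j < 0 \<longrightarrow> s j < 0" "0 < j \<longrightarrow> 0 < s j"
      using mem[OF j] by (auto simp: S_def T_def)
  next
    show "{z. poly (cpoly P) z = 0 \<and> cmod z < 1} = (\<lambda>j. of_real (s j)) ` zero_index (card T) (card S)"
    proof (intro equalityI subsetI)
      fix z assume "z \<in> (\<lambda>j. complex_of_real (s j)) ` zero_index (card T) (card S)"
      then obtain j where j: "j \<in> zero_index (card T) (card S)" "z = of_real (s j)" by blast
      then show "z \<in> {z. poly (cpoly P) z = 0 \<and> cmod z < 1}"
        using mem[OF j(1)] by (cases "0 < j") (auto simp: S_def T_def)
    next
      fix z assume z: "z \<in> {z. poly (cpoly P) z = 0 \<and> cmod z < 1}"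
      then obtain x where x: "z = of_real x" using real by (auto elim!: Reals_cases)
      have Px: "poly P x = 0" "\<bar>x\<bar> < 1" using z by (auto simp: x)
      then have "x \<noteq> 0" using P(2) by auto
      then consider "0 < x" | "x < 0" by linarith
      then have "\<exists>j\<in>zero_index (card T) (card S). x = s j"
      proof cases
        case 1
        then have "x \<in> u ` {1..card S}" using Px unfolding u(2) by (auto simp: S_def)
        then obtain i where "i \<in> {1..card S}" "x = u i" by blast
        then show ?thesis by (intro bexI[of _ "int i"]) (auto simp: s_def zero_index_def)
      next
        case 2
        then have "- x \<in> v ` {1..card T}" using Px unfolding v(2) by (auto simp: T_def)
        then obtain i where "i \<in> {1..card T}" "- x = v i" by blast
        then show ?thesis by (intro bexI[of _ "- int i"]) (auto simp: s_def zero_index_def)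
      qed
      then show "z \<in> (\<lambda>j. complex_of_real (s j)) ` zero_index (card T) (card S)"
        unfolding x by blast
    qed
  qed
  then show ?thesis by blast
qed

lemma order_eq_1_iff:
  fixes f :: "complex poly"
  assumes "f \<noteq> 0" "poly f z = 0"
  shows "order z f = 1 \<longleftrightarrow> poly (pderiv f) z \<noteq> 0"
proof -
  obtain g where g: "f = [:-z, 1:] * g" using assms(2) unfolding poly_eq_0_iff_dvd by (elim dvdE)
  have "poly (pderiv f) z = poly g z" unfolding g pderiv_mult by (simp add: pderiv_pCons)
  moreover have "order z f = Suc (order z g)"
    using assms(1) unfolding g by (subst order_mult) (auto simp: order_power_n_n[of z 1, simplified])
  moreover have "order z g = 0 \<longleftrightarrow> poly g z \<noteq> 0"
    using assms(1) g order_root[of g z] by auto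
  ultimately show ?thesis by simp
qed

lemma root_poly_eq: "root_poly r = (\<Prod>c\<in>#mset r. [:-c, 1:])"
  by (simp add: root_poly_def prod_mset_prod_list[symmetric] flip: mset_map)

lemma root_poly_nz: "root_poly r \<noteq> 0"
  by (auto simp: root_poly_def prod_list_zero_iff)

lemma poly_root_poly_0: "poly (root_poly r) z = 0 \<longleftrightarrow> z \<in> set r"
  unfolding root_poly_def by (induction r) auto

lemma proots_root_poly: "proots (root_poly r) = mset r"
proof (induction r)
  case (Cons c r)
  have "root_poly (c # r) = [:-c, 1:] * root_poly r" by (simp add: root_poly_def)
  then show ?case using Cons root_poly_nz[of r] by (simp only:) (subst proots_mult, auto)
qed (simp add: root_poly_def)

lemma root_condition_iff:
  "root_condition r \<longleftrightarrow>
     sorted (map cmod r) \<and> (\<exists>P. root_poly r = cpoly P \<and> admissible P \<and> poly P 0 \<noteq> 0)"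
proof -
  have nz0: "(\<forall>c\<in>set r. 0 < cmod c) \<longleftrightarrow> poly P 0 \<noteq> 0" if "root_poly r = cpoly P" for P
  proof -
    have "poly P 0 = 0 \<longleftrightarrow> 0 \<in> set r"
      using poly_root_poly_0[of r 0] poly_cpoly_of_real[of P 0] that by simp
    then show ?thesis by auto
  qed
  have simple: "order z (cpoly P) = 1 \<longleftrightarrow> poly (cpoly (pderiv P)) z \<noteq> 0"
    if "root_poly r = cpoly P" "poly (cpoly P) z = 0" for P z
    using order_eq_1_iff[of "cpoly P" z] that root_poly_nz[of r] by (simp add: pderiv_cpoly)
  show ?thesis
  proof
    assume rc: "root_condition r"
    define f where "f = root_poly r"
    have fr: "\<forall>x::real. poly f (of_real x) \<in> \<real>" and srt: "sorted (map cmod r)"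
      and pos: "\<forall>c\<in>set r. 0 < cmod c"
      and zeros: "\<forall>z. cmod z \<le> 1 \<and> poly f z = 0 \<longrightarrow> z \<in> \<real> \<and> order z f = 1"
      using rc by (auto simp: root_condition_def Let_def f_def)
    define P where "P = map_poly Re f"
    have fP: "f = cpoly P" using fr unfolding P_def by (intro cpoly_of_real_values) blast
    have P0: "poly P 0 \<noteq> 0" using nz0 pos fP f_def by metis
    then have "P \<noteq> 0" by auto
    obtain m n s where en: "enumerates_disc_zeros f m n s"
      and inv: "\<forall>j\<in>zero_index m n. poly f (of_real (inverse (s j))) \<noteq> 0"
      and par: "(\<forall>j\<in>{- int m + 1..- 1} \<union> {2..int n}.
           odd (zeros_on f {inverse (s j)<..<inverse (s (j - 1))}))"
        "(n \<ge> 1 \<longrightarrow> even (zeros_on f {1..<inverse (s (int n))}))"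
        "(m \<ge> 1 \<longrightarrow> even (zeros_on f {inverse (s (- int m))<..- 1}))"
      using rc unfolding root_condition_def Let_def f_def by blast
    have img: "{z. poly (cpoly P) z = 0 \<and> cmod z < 1} = (\<lambda>j. of_real (s j)) ` zero_index m n"
      using en unfolding enumerates_disc_zeros_def fP by blast
    have simp': "poly (pderiv P) (s j) \<noteq> 0" if "j \<in> zero_index m n" for j
    proof -
      have "complex_of_real (s j) \<in> {z. poly (cpoly P) z = 0 \<and> cmod z < 1}" unfolding img using that by blast
      then have "poly f (of_real (s j)) = 0" "cmod (of_real (s j)) \<le> 1" unfolding fP by auto
      then have "poly (cpoly (pderiv P)) (of_real (s j)) \<noteq> 0"
        using zeros simple[of P "of_real (s j)"] fP f_def by auto
      then show ?thesis by simp
    qed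
    have "\<forall>j\<in>zero_index m n. 0 < s j * poly (pderiv P) (s j) * poly P (inverse (s j))"
      using parity_conditions_iff[OF \<open>P \<noteq> 0\<close> en[unfolded fP] simp'] inv par unfolding fP
      by (simp only: poly_cpoly_of_real of_real_eq_0_iff) auto
    moreover have "\<exists>j\<in>zero_index m n. x = s j" if "\<bar>x\<bar> < 1" "poly P x = 0" for x
    proof -
      have "complex_of_real x \<in> {z. poly (cpoly P) z = 0 \<and> cmod z < 1}" using that by simp
      then show ?thesis unfolding img by auto
    qed
    ultimately have "admissible P"
      unfolding admissible_def using zeros simple[of P] fP f_def by metis
    then show "sorted (map cmod r) \<and> (\<exists>P. root_poly r = cpoly P \<and> admissible P \<and> poly P 0 \<noteq> 0)"
      using srt P0 fP f_def by (intro conjI exI[of _ P]) simp_all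
  next
    assume "sorted (map cmod r) \<and> (\<exists>P. root_poly r = cpoly P \<and> admissible P \<and> poly P 0 \<noteq> 0)"
    then obtain P where srt: "sorted (map cmod r)" and fP: "root_poly r = cpoly P"
      and adm: "admissible P" and P0: "poly P 0 \<noteq> 0" by blast
    have "P \<noteq> 0" using P0 by auto
    obtain m n s where en: "enumerates_disc_zeros (cpoly P) m n s"
      using enumerates_disc_zeros_exists[OF \<open>P \<noteq> 0\<close> P0] adm unfolding admissible_def by force
    have img: "{z. poly (cpoly P) z = 0 \<and> cmod z < 1} = (\<lambda>j. of_real (s j)) ` zero_index m n"
      and sj: "\<And>j. j \<in> zero_index m n \<Longrightarrow> - 1 < s j \<and> s j < 1"
      using en unfolding enumerates_disc_zeros_def by blast+
    have sgn: "0 < s j * poly (pderiv P) (s j) * poly P (inverse (s j))" if j: "j \<in> zero_index m n" for j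
    proof -
      have "complex_of_real (s j) \<in> {z. poly (cpoly P) z = 0 \<and> cmod z < 1}" unfolding img using j by blast
      then have "poly P (s j) = 0" by simp
      moreover have "s j \<noteq> 0" using P0 calculation by auto
      moreover have "\<bar>s j\<bar> < 1" using sj[OF j] by auto
      ultimately show ?thesis using adm unfolding admissible_def by blast
    qed
    have ne: "poly (pderiv P) (s j) \<noteq> 0" "poly P (inverse (s j)) \<noteq> 0" if "j \<in> zero_index m n" for j
      using sgn[OF that] by auto
    show "root_condition r"
      unfolding root_condition_def Let_def fP
    proof (intro conjI)
      show "\<forall>c\<in>set r. 0 < cmod c" using nz0[OF fP] P0 by blast
      show "\<forall>z. cmod z \<le> 1 \<and> poly (cpoly P) z = 0 \<longrightarrow> z \<in> \<real> \<and> order z (cpoly P) = 1"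
        using adm simple[OF fP] unfolding admissible_def by blast
      show "\<exists>m n s. enumerates_disc_zeros (cpoly P) m n s \<and>
         (\<forall>j\<in>zero_index m n. poly (cpoly P) (of_real (inverse (s j))) \<noteq> 0) \<and>
         (\<forall>j\<in>{- int m + 1..- 1} \<union> {2..int n}.
           odd (zeros_on (cpoly P) {inverse (s j)<..<inverse (s (j - 1))})) \<and>
         (n \<ge> 1 \<longrightarrow> even (zeros_on (cpoly P) {1..<inverse (s (int n))})) \<and>
         (m \<ge> 1 \<longrightarrow> even (zeros_on (cpoly P) {inverse (s (- int m))<..- 1}))"
        using parity_conditions_iff[OF \<open>P \<noteq> 0\<close> en ne] sgn en ne(2)
        by (intro exI[of _ m] exI[of _ n] exI[of _ s]) (simp only: poly_cpoly_of_real of_real_eq_0_iff, blast)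
    qed (use srt in auto)
  qed
qed

text \<open>
  Passing from the monic polynomial with the given roots to the one normalised at 0 does not affect
  admissibility, and every multiset can be listed with increasing absolute values.
\<close>

lemma root_class_iff:
  "M \<in> root_class k \<longleftrightarrow>
     (\<exists>P. admissible P \<and> coeff P 0 = 1 \<and> degree P = k \<and> proots (cpoly P) = M)"
proof
  assume "M \<in> root_class k"
  then obtain r where r: "M = mset r" "length r = k" "root_condition r"
    by (auto simp: root_class_def)
  then obtain P where P: "root_poly r = cpoly P" "admissible P" "poly P 0 \<noteq> 0"
    by (auto simp: root_condition_iff)
  define c where "c = inverse (coeff P 0)"
  have c: "c \<noteq> 0" "c * coeff P 0 = 1" using P(3) by (auto simp: c_def poly_0_coeff_0)
  have "proots (cpoly P) = M" using P(1) r(1) proots_root_poly[of r] by simp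
  moreover from this have "degree P = k"
    using size_proots_complex[of "cpoly P"] r(1,2) by simp
  ultimately show "\<exists>P. admissible P \<and> coeff P 0 = 1 \<and> degree P = k \<and> proots (cpoly P) = M"
    using admissible_smult[OF P(2) c(1)] c by (intro exI[of _ "smult c P"]) (auto simp: cpoly_smult)
next
  assume "\<exists>P. admissible P \<and> coeff P 0 = 1 \<and> degree P = k \<and> proots (cpoly P) = M"
  then obtain P where P: "admissible P" "coeff P 0 = 1" "degree P = k" "proots (cpoly P) = M" by blast
  obtain xs where xs: "mset xs = M" using ex_mset by blast
  define r where "r = sort_key cmod xs"
  have r: "mset r = M" "sorted (map cmod r)" by (simp_all add: r_def xs)
  define c where "c = lead_coeff P"
  have "P \<noteq> 0" using P(2) by auto
  then have c: "c \<noteq> 0" by (simp add: c_def)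
  have "smult (of_real c) (root_poly r) = cpoly P"
    using complex_poly_decompose_multiset[of "cpoly P"] by (simp add: root_poly_eq r P c_def)
  then have "root_poly r = smult (of_real (inverse c)) (cpoly P)"
    using c by (metis of_real_eq_0_iff of_real_inverse smult_1_left smult_smult left_inverse)
  then have "root_poly r = cpoly (smult (inverse c) P)" by (simp add: cpoly_smult)
  moreover have "admissible (smult (inverse c) P)" by (rule admissible_smult) (use P c in auto)
  moreover have "poly (smult (inverse c) P) 0 \<noteq> 0" using P c by (simp add: poly_0_coeff_0)
  ultimately have "root_condition r" using r by (auto simp: root_condition_iff)
  moreover have "length r = k"
    using size_proots_complex[of "cpoly P"] P r by (metis degree_cpoly size_mset)
  ultimately show "M \<in> root_class k" using r(1) by (auto simp: root_class_def)
qed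

lemma proots_normalised_inject:
  assumes "proots (cpoly P) = proots (cpoly P')" "coeff P 0 = 1" "coeff P' 0 = 1"
  shows "P = P'"
proof -
  define R where "R = (\<Prod>x\<in>#proots (cpoly P). [:-x, 1:])"
  have 1: "smult (of_real (lead_coeff P)) R = cpoly P"
    using complex_poly_decompose_multiset[of "cpoly P"] by (simp add: R_def)
  have 2: "smult (of_real (lead_coeff P')) R = cpoly P'"
    using complex_poly_decompose_multiset[of "cpoly P'"] by (simp add: R_def assms(1))
  have "of_real (lead_coeff P) * coeff R 0 = 1" "of_real (lead_coeff P') * coeff R 0 = 1"
    using arg_cong[OF 1, of "\<lambda>p. coeff p 0"] arg_cong[OF 2, of "\<lambda>p. coeff p 0"] assms by simp_all
  then have "complex_of_real (lead_coeff P) = of_real (lead_coeff P')"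
    by (metis mult_cancel_right mult_zero_right zero_neq_one)
  then have "cpoly P = cpoly P'" using 1 2 by metis
  then show ?thesis by simp
qed

section \<open>Adding one root at a time\<close>

text \<open>
  The step of \<open>has_wronskian_add_root\<close> for the root \<open>c = 1/\<alpha>\<close>, on the pair of a polynomial and
  its partner.
\<close>

definition add_root :: "complex \<Rightarrow> complex poly \<times> complex poly \<Rightarrow> complex poly \<times> complex poly" where
  "add_root c S = (let \<alpha> = inverse c; P = fst S; X = snd S; g = \<alpha> * poly X \<alpha> / poly P \<alpha> in
     ([:1, - \<alpha>:] * P, (pCons 0 X - smult g P) div [:- \<alpha>, 1:]))"

lemma add_root_quotient:
  assumes "poly P (inverse c) \<noteq> 0"
  shows "[:- inverse c, 1:] * snd (add_root c (P, X)) =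
    pCons 0 X - smult (inverse c * poly X (inverse c) / poly P (inverse c)) P"
proof -
  define \<alpha> g where "\<alpha> = inverse c" and "g = \<alpha> * poly X \<alpha> / poly P \<alpha>"
  have "poly (pCons 0 X - smult g P) \<alpha> = 0" using assms by (simp add: g_def \<alpha>_def)
  then have "[:- \<alpha>, 1:] dvd pCons 0 X - smult g P" by (rule poly_eq_0_iff_dvd[THEN iffD1])
  then have "[:- \<alpha>, 1:] * ((pCons 0 X - smult g P) div [:- \<alpha>, 1:]) = pCons 0 X - smult g P"
    by (rule dvd_mult_div_cancel)
  then show ?thesis by (simp add: add_root_def Let_def \<alpha>_def g_def)
qed

text \<open>
  Otherwise \<open>\<alpha>\<close> and \<open>1/\<alpha>\<close> would both be zeros of \<open>P\<close>. Off the circle this contradicts the sign condition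
  at the one inside the disc; on the circle \<open>\<alpha>\<close> is 1 or -1 and would be a double zero.
\<close>

lemma admissible_reciprocal_root:
  assumes A: "admissible P" and f: "cpoly P = [:1, - \<alpha>:] * Q" and "\<alpha> \<noteq> 0"
  shows "poly Q \<alpha> \<noteq> 0"
proof
  assume Q: "poly Q \<alpha> = 0"
  then have z1: "poly (cpoly P) \<alpha> = 0" by (simp add: f)
  have z2: "poly (cpoly P) (inverse \<alpha>) = 0" using \<open>\<alpha> \<noteq> 0\<close> by (simp add: f)
  have no: False if z: "cmod z < 1" "z \<noteq> 0" "poly (cpoly P) z = 0" "poly (cpoly P) (inverse z) = 0" for z
  proof -
    have "z \<in> \<real>" using A z unfolding admissible_def by (simp add: less_imp_le)
    then obtain s where s: "z = of_real s" by (elim Reals_cases)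
    have "poly P s = 0" "poly P (inverse s) = 0" "s \<noteq> 0" "\<bar>s\<bar> < 1"
      using z unfolding s by (auto simp flip: of_real_inverse)
    then have "0 < s * poly (pderiv P) s * poly P (inverse s)"
      using A unfolding admissible_def by blast
    with \<open>poly P (inverse s) = 0\<close> show False by simp
  qed
  consider "cmod \<alpha> < 1" | "cmod (inverse \<alpha>) < 1" | "cmod \<alpha> = 1"
    by (cases "cmod \<alpha>" "1::real" rule: linorder_cases) (auto simp: norm_inverse inverse_less_1_iff)
  then show False
  proof cases
    case 1
    then show False using no[of \<alpha>] z1 z2 \<open>\<alpha> \<noteq> 0\<close> by simp
  next
    case 2
    then show False using no[of "inverse \<alpha>"] z1 z2 \<open>\<alpha> \<noteq> 0\<close> by simp
  next
    case 3
    then have "\<alpha> \<in> \<real>" and nz: "poly (cpoly (pderiv P)) \<alpha> \<noteq> 0"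
      using A z1 unfolding admissible_def by auto
    then have "\<alpha> * \<alpha> = 1" using 3 by (auto elim!: Reals_cases simp: abs_if split: if_splits)
    then have "poly (pderiv ([:1, - \<alpha>:] * Q)) \<alpha> = 0"
      unfolding pderiv_mult using Q by (simp add: pderiv_pCons)
    then show False using nz by (simp add: f flip: pderiv_cpoly)
  qed
qed

text \<open>
  The polynomial with roots \<open>r\<close> and value 1 at 0, built from the factors that \<open>add_root\<close> introduces.
\<close>

definition normalised_root_poly :: "complex list \<Rightarrow> complex poly" where
  "normalised_root_poly r = (\<Prod>c\<leftarrow>r. [:1, - inverse c:])"

lemma normalised_root_poly_coeff_0: "coeff (normalised_root_poly r) 0 = 1"
  unfolding normalised_root_poly_def by (induction r) auto

lemma normalised_root_poly_snoc:
  "normalised_root_poly (r @ [c]) = [:1, - inverse c:] * normalised_root_poly r"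
  by (simp add: normalised_root_poly_def)

lemma normalised_root_poly_append:
  "normalised_root_poly (r @ r') = normalised_root_poly r * normalised_root_poly r'"
  by (simp add: normalised_root_poly_def)

lemma normalised_root_poly_degree: "degree (normalised_root_poly r) \<le> length r"
proof (induction r)
  case (Cons c r)
  have "degree (normalised_root_poly (c # r)) \<le> degree [:1, - inverse c:] + degree (normalised_root_poly r)"
    unfolding normalised_root_poly_def by (simp only: list.map prod_list.Cons degree_mult_le)
  also have "\<dots> \<le> Suc (length r)" using Cons by simp
  finally show ?case by simp
qed (simp add: normalised_root_poly_def)

lemma normalised_root_poly_eq:
  assumes r: "mset r = proots (cpoly P)" and P: "coeff P 0 = 1"
  shows "cpoly P = normalised_root_poly r"
proof -
  have "P \<noteq> 0" using P by auto
  have "poly P 0 \<noteq> 0" using P by (simp add: poly_0_coeff_0)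
  then have "poly (cpoly P) 0 \<noteq> 0" using poly_cpoly_of_real[of P 0] by (metis of_real_0 of_real_eq_0_iff)
  then have "0 \<notin># proots (cpoly P)" using \<open>P \<noteq> 0\<close> by simp
  then have "0 \<notin> set r" by (simp flip: r)
  then have "\<exists>K. root_poly r = smult K (normalised_root_poly r)"
  proof (induction r)
    case (Cons c r)
    then obtain K where K: "root_poly r = smult K (normalised_root_poly r)" by auto
    have "[:- c, 1:] = smult (- c) [:1, - inverse c:]" using Cons.prems by simp
    then have "root_poly (c # r) = smult (K * - c) (normalised_root_poly (c # r))"
      using K by (simp only: root_poly_def normalised_root_poly_def list.map prod_list.Cons
        mult_smult_left mult_smult_right smult_smult)
    then show ?case by blast
  qed (auto simp: root_poly_def normalised_root_poly_def intro: exI[of _ 1])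
  then obtain K where K: "root_poly r = smult K (normalised_root_poly r)" by blast
  have "smult (of_real (lead_coeff P)) (root_poly r) = cpoly P"
    using complex_poly_decompose_multiset[of "cpoly P"] by (simp add: root_poly_eq r)
  then have eq: "cpoly P = smult (of_real (lead_coeff P) * K) (normalised_root_poly r)"
    unfolding K by simp
  from arg_cong[OF this, of "\<lambda>p. coeff p 0"] have "of_real (lead_coeff P) * K = 1"
    using P by (simp add: normalised_root_poly_coeff_0)
  then show ?thesis using eq by simp
qed

text \<open>
  The evaluation at \<open>\<alpha>\<close> in \<open>add_root\<close> never meets a zero: for each prefix of \<open>r\<close> the product over the prefix divides
  \<open>P / (1 - \<alpha> z)\<close>. So the roots may be added in any order.
\<close>

lemma add_roots:
  assumes A: "admissible P" and P: "coeff P 0 = 1" and r: "mset r = proots (cpoly P)" and t: "t \<le> length r"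
  shows "fst (fold add_root (take t r) (1, 1)) = normalised_root_poly (take t r)"
    and "has_wronskian (normalised_root_poly (take t r)) (pCons 0 (snd (fold add_root (take t r) (1, 1)))) 1"
    and "t < length r \<Longrightarrow> poly (normalised_root_poly (take t r)) (inverse (r ! t)) \<noteq> 0"
proof -
  have full: "cpoly P = normalised_root_poly r" by (rule normalised_root_poly_eq[OF r P])
  have nz0: "r ! t \<noteq> 0" if "t < length r" for t
  proof
    assume 0: "r ! t = 0"
    have "r ! t \<in># mset r" using that by simp
    then have "0 \<in># proots (cpoly P)" by (simp only: r 0)
    moreover have "P \<noteq> 0" using P by auto
    ultimately have "poly (cpoly P) 0 = 0" by simp
    then have "coeff P 0 = 0" by (simp add: poly_0_coeff_0)
    then show False using P by simp
  qed
  have nz: "poly (normalised_root_poly (take t r)) (inverse (r ! t)) \<noteq> 0" if "t < length r" for t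
  proof -
    have "r = take t r @ [r ! t] @ drop (Suc t) r" using id_take_nth_drop[OF that] by simp
    then have "cpoly P = [:1, - inverse (r ! t):] * (normalised_root_poly (take t r) * normalised_root_poly (drop (Suc t) r))"
      unfolding full by (metis normalised_root_poly_append normalised_root_poly_snoc append_assoc mult.assoc)
    from admissible_reciprocal_root[OF A this] nz0[OF that] show ?thesis by simp
  qed
  then show "t < length r \<Longrightarrow> poly (normalised_root_poly (take t r)) (inverse (r ! t)) \<noteq> 0" by blast
  have "fst (fold add_root (take t r) (1, 1)) = normalised_root_poly (take t r) \<and>
    has_wronskian (normalised_root_poly (take t r)) (pCons 0 (snd (fold add_root (take t r) (1, 1)))) 1"
    using t
  proof (induction t)
    case 0
    then show ?case by (simp add: normalised_root_poly_def has_wronskian_def)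
  next
    case (Suc t)
    define F where "F = fold add_root (take t r) (1, 1)"
    have lt: "t < length r" using Suc.prems by simp
    have IH: "fst F = normalised_root_poly (take t r)"
      "has_wronskian (normalised_root_poly (take t r)) (pCons 0 (snd F)) 1"
      using Suc by (auto simp: F_def)
    have take: "take (Suc t) r = take t r @ [r ! t]" using lt by (rule take_Suc_conv_app_nth)
    have F': "fold add_root (take (Suc t) r) (1, 1) = add_root (r ! t) (normalised_root_poly (take t r), snd F)"
      unfolding take using IH(1) by (simp add: F_def) (metis prod.collapse)
    have "has_wronskian ([:1, - inverse (r ! t):] * normalised_root_poly (take t r))
      (pCons 0 (snd (add_root (r ! t) (normalised_root_poly (take t r), snd F)))) 1"
      by (rule has_wronskian_add_root[OF IH(2) _ add_root_quotient[OF nz[OF lt]]]) (simp add: nz0[OF lt])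
    moreover have "fst (add_root (r ! t) (normalised_root_poly (take t r), snd F)) = normalised_root_poly (take (Suc t) r)"
      unfolding take normalised_root_poly_snoc by (simp add: add_root_def Let_def)
    ultimately show ?case unfolding F' unfolding take normalised_root_poly_snoc by simp
  qed
  then show "fst (fold add_root (take t r) (1, 1)) = normalised_root_poly (take t r)"
    "has_wronskian (normalised_root_poly (take t r)) (pCons 0 (snd (fold add_root (take t r) (1, 1)))) 1" by auto
qed

text \<open>
  The construction passes through complex polynomials; the final partner is real because its
  conjugate is a partner too and partners are unique.
\<close>

lemma admissible_has_partner:
  assumes A: "admissible P" and P: "coeff P 0 = 1"
  shows "\<exists>X. has_wronskian (cpoly P) (pCons 0 (cpoly X)) 1"
proof -
  obtain r where r: "mset r = proots (cpoly P)" using ex_mset by blast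
  define Y where "Y = snd (fold add_root r (1, 1))"
  have W: "has_wronskian (cpoly P) (pCons 0 Y) 1"
    using add_roots(2)[OF A P r, of "length r"] normalised_root_poly_eq[OF r P] by (simp add: Y_def)
  have "map_poly cnj (cpoly P) = cpoly P" by (rule poly_eqI) (simp add: coeff_map_poly)
  moreover have "map_poly cnj (pCons 0 Y) = pCons 0 (map_poly cnj Y)"
    by (rule poly_eqI) (simp add: coeff_map_poly coeff_pCons split: nat.splits)
  ultimately have W': "has_wronskian (cpoly P) (pCons 0 (map_poly cnj Y)) 1"
    using has_wronskian_cnj[OF W] by simp
  have "smult 1 Y = smult 1 (map_poly cnj Y)"
    by (rule has_wronskian_unique[OF W W']) (use P in \<open>simp_all add: poly_0_coeff_0\<close>)
  then have "coeff Y i = cnj (coeff Y i)" for i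
    by (metis coeff_map_poly complex_cnj_zero smult_1_left)
  then have "coeff Y i \<in> \<real>" for i by (simp add: Reals_cnj_iff)
  then have "Y = cpoly (map_poly Re Y)" by (rule cpoly_of_real_coeffs)
  with W show ?thesis by metis
qed

lemma bij_betw_jost_roots:
  assumes "k \<ge> 1"
  shows "bij_betw (jost_roots k) (pert_class k) (root_class k)"
proof (rule bij_betwI')
  fix q q' assume q: "q \<in> pert_class k" "q' \<in> pert_class k"
  obtain A A' where A: "jost_factors q A" "jost_factors q' A'"
    using jost_factors_exist[OF q(1)] jost_factors_exist[OF q(2)] by blast
  show "jost_roots k q = jost_roots k q' \<longleftrightarrow> q = q'"
  proof
    assume "jost_roots k q = jost_roots k q'"
    then have "proots (cpoly (A 0)) = proots (cpoly (A' 0))"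
      by (simp only: jost_roots_eq[OF q(1) A(1)] jost_roots_eq[OF q(2) A(2)])
    then have "A 0 = A' 0"
      by (rule proots_normalised_inject) (simp_all add: jost_factors_coeff_0[OF A(1)] jost_factors_coeff_0[OF A(2)])
    then show "q = q'" by (rule jost_factors_inject[OF q A])
  qed simp
next
  fix q assume q: "q \<in> pert_class k"
  obtain A where A: "jost_factors q A" using jost_factors_exist[OF q] by blast
  have "degree (A 0) = k" using jost_factors_degree[OF q A, of 0] assms by simp
  then show "jost_roots k q \<in> root_class k"
    unfolding root_class_iff jost_roots_eq[OF q A]
    using jost_factors_admissible[OF q A, of 0] jost_factors_coeff_0[OF A, of 0] by blast
next
  fix M assume "M \<in> root_class k"
  then obtain P where P: "admissible P" "coeff P 0 = 1" "degree P = k" "proots (cpoly P) = M"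
    unfolding root_class_iff by blast
  obtain X where X: "has_wronskian (cpoly P) (pCons 0 (cpoly X)) 1"
    using admissible_has_partner[OF P(1,2)] by blast
  obtain q A where q: "q \<in> pert_class k" "jost_factors q A" "A 0 = P"
    using jost_factors_surj[OF P(1-3) assms X] by blast
  then have "M = jost_roots k q" using P(4) by (simp add: jost_roots_eq)
  then show "\<exists>q\<in>pert_class k. M = jost_roots k q" using q(1) by blast
qed

section \<open>Complex arithmetic on the machine\<close>

text \<open>
  The machine is used as a machine for complex numbers: the cells \<open>2 j\<close> and \<open>2 j + 1\<close> form the complex slot \<open>j\<close>. With
  \<open>k\<close> kept in register 0, the slots below \<open>k\<close> hold the roots, as the input does, and are overwritten by the output at
  the end. The slots from \<open>k\<close> on hold 16 interleaved arrays, which have no upper bound and initially consist of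
  zeros, so an array can hold all coefficients of a polynomial. Array 0 is a scratch area.
\<close>

definition slot :: "store \<Rightarrow> nat \<Rightarrow> complex" where
  "slot \<sigma> j = Complex (snd \<sigma> (2 * j)) (snd \<sigma> (2 * j + 1))"

definition dbl :: "nexp \<Rightarrow> nexp" where
  "dbl e = NAdd e e"

text \<open>
  Entry \<open>i\<close> of array \<open>a\<close> is slot \<open>k + a + 16 i\<close>; address arithmetic has no multiplication.
\<close>

definition array_slot :: "nat \<Rightarrow> nexp \<Rightarrow> nexp" where
  "array_slot a e = NAdd (Reg 0) (NAdd (NConst a) (dbl (dbl (dbl (dbl e)))))"

definition re_cell :: "nexp \<Rightarrow> nexp" where "re_cell e = dbl e"
definition im_cell :: "nexp \<Rightarrow> nexp" where "im_cell e = NAdd (dbl e) (NConst 1)"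

datatype cexp = Entry nat nexp | Root nexp | CZero | COne
  | CAdd cexp cexp | CSub cexp cexp | CMul cexp cexp | CDiv cexp cexp

fun re_part :: "cexp \<Rightarrow> rexp" and im_part :: "cexp \<Rightarrow> rexp" where
  "re_part (Entry a e) = Cell (re_cell (array_slot a e))"
| "re_part (Root e) = Cell (re_cell e)"
| "re_part CZero = RZero"
| "re_part COne = ROne"
| "re_part (CAdd x y) = RAdd (re_part x) (re_part y)"
| "re_part (CSub x y) = RSub (re_part x) (re_part y)"
| "re_part (CMul x y) = RSub (RMul (re_part x) (re_part y)) (RMul (im_part x) (im_part y))"
| "re_part (CDiv x y) = RDiv (RAdd (RMul (re_part x) (re_part y)) (RMul (im_part x) (im_part y)))
     (RAdd (RMul (re_part y) (re_part y)) (RMul (im_part y) (im_part y)))"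
| "im_part (Entry a e) = Cell (im_cell (array_slot a e))"
| "im_part (Root e) = Cell (im_cell e)"
| "im_part CZero = RZero"
| "im_part COne = RZero"
| "im_part (CAdd x y) = RAdd (im_part x) (im_part y)"
| "im_part (CSub x y) = RSub (im_part x) (im_part y)"
| "im_part (CMul x y) = RAdd (RMul (re_part x) (im_part y)) (RMul (im_part x) (re_part y))"
| "im_part (CDiv x y) = RDiv (RSub (RMul (im_part x) (re_part y)) (RMul (re_part x) (im_part y)))
     (RAdd (RMul (re_part y) (re_part y)) (RMul (im_part y) (im_part y)))"

type_synonym regs = "nat \<Rightarrow> nat"
type_synonym roots = "nat \<Rightarrow> complex"
type_synonym arrays = "nat \<Rightarrow> nat \<Rightarrow> complex"

definition nat_value :: "nexp \<Rightarrow> regs \<Rightarrow> nat" where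
  "nat_value e \<rho> = nval e (\<rho>, \<lambda>_. 0)"

lemma nval_eq_nat_value: "nval e \<sigma> = nat_value e (fst \<sigma>)"
  unfolding nat_value_def by (induction e) auto

lemma nat_value_simps [simp]:
  "nat_value (NConst n) \<rho> = n" "nat_value (Reg i) \<rho> = \<rho> i"
  "nat_value (NAdd e e') \<rho> = nat_value e \<rho> + nat_value e' \<rho>" "nat_value (NSub e e') \<rho> = nat_value e \<rho> - nat_value e' \<rho>"
  by (simp_all add: nat_value_def)

lemma nat_value_slots [simp]:
  "nat_value (dbl e) \<rho> = 2 * nat_value e \<rho>" "nat_value (array_slot a e) \<rho> = \<rho> 0 + 16 * nat_value e \<rho> + a"
  "nat_value (re_cell e) \<rho> = 2 * nat_value e \<rho>" "nat_value (im_cell e) \<rho> = 2 * nat_value e \<rho> + 1"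
  by (simp_all add: dbl_def array_slot_def re_cell_def im_cell_def)

primrec cexp_value :: "cexp \<Rightarrow> regs \<Rightarrow> roots \<Rightarrow> arrays \<Rightarrow> complex" where
  "cexp_value (Entry a e) \<rho> R V = V a (nat_value e \<rho>)"
| "cexp_value (Root e) \<rho> R V = R (nat_value e \<rho>)"
| "cexp_value CZero \<rho> R V = 0"
| "cexp_value COne \<rho> R V = 1"
| "cexp_value (CAdd x y) \<rho> R V = cexp_value x \<rho> R V + cexp_value y \<rho> R V"
| "cexp_value (CSub x y) \<rho> R V = cexp_value x \<rho> R V - cexp_value y \<rho> R V"
| "cexp_value (CMul x y) \<rho> R V = cexp_value x \<rho> R V * cexp_value y \<rho> R V"
| "cexp_value (CDiv x y) \<rho> R V = cexp_value x \<rho> R V / cexp_value y \<rho> R V"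

text \<open>
  Expressions that keep away from the scratch array and read roots only within the input.
\<close>

primrec safe :: "cexp \<Rightarrow> regs \<Rightarrow> bool" where
  "safe (Entry a e) \<rho> \<longleftrightarrow> 0 < a \<and> a < 16"
| "safe (Root e) \<rho> \<longleftrightarrow> nat_value e \<rho> < \<rho> 0"
| "safe CZero \<rho> \<longleftrightarrow> True"
| "safe COne \<rho> \<longleftrightarrow> True"
| "safe (CAdd x y) \<rho> \<longleftrightarrow> safe x \<rho> \<and> safe y \<rho>"
| "safe (CSub x y) \<rho> \<longleftrightarrow> safe x \<rho> \<and> safe y \<rho>"
| "safe (CMul x y) \<rho> \<longleftrightarrow> safe x \<rho> \<and> safe y \<rho>"
| "safe (CDiv x y) \<rho> \<longleftrightarrow> safe x \<rho> \<and> safe y \<rho>"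

text \<open>
  The view of a store that programs are reasoned about in: registers, roots and arrays as independent
  functions. Different arrays cannot alias, and the scratch array is invisible.
\<close>

definition represents :: "store \<Rightarrow> regs \<Rightarrow> roots \<Rightarrow> arrays \<Rightarrow> bool" where
  "represents \<sigma> \<rho> R V \<longleftrightarrow> fst \<sigma> = \<rho> \<and> (\<forall>j<\<rho> 0. slot \<sigma> j = R j) \<and>
     (\<forall>a j. 0 < a \<and> a < 16 \<longrightarrow> slot \<sigma> (\<rho> 0 + 16 * j + a) = V a j)"

lemma represents_parts:
  assumes "represents \<sigma> \<rho> R V" "safe x \<rho>"
  shows "rval (re_part x) \<sigma> = Re (cexp_value x \<rho> R V)" and "rval (im_part x) \<sigma> = Im (cexp_value x \<rho> R V)"
  using assms(2)
proof (induction x)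
  case (Entry a e)
  case 1
  then have "slot \<sigma> (\<rho> 0 + 16 * nat_value e \<rho> + a) = V a (nat_value e \<rho>)" and "fst \<sigma> = \<rho>"
    using assms(1) by (auto simp: represents_def)
  then show ?case by (simp add: nval_eq_nat_value slot_def complex_eq_iff)
next
  case (Entry a e)
  case 2
  then have "slot \<sigma> (\<rho> 0 + 16 * nat_value e \<rho> + a) = V a (nat_value e \<rho>)" and "fst \<sigma> = \<rho>"
    using assms(1) by (auto simp: represents_def)
  then show ?case by (simp add: nval_eq_nat_value slot_def complex_eq_iff)
next
  case (Root e)
  case 1
  then have "slot \<sigma> (nat_value e \<rho>) = R (nat_value e \<rho>)" and "fst \<sigma> = \<rho>"
    using assms(1) by (auto simp: represents_def)
  then show ?case by (simp add: nval_eq_nat_value slot_def complex_eq_iff)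
next
  case (Root e)
  case 2
  then have "slot \<sigma> (nat_value e \<rho>) = R (nat_value e \<rho>)" and "fst \<sigma> = \<rho>"
    using assms(1) by (auto simp: represents_def)
  then show ?case by (simp add: nval_eq_nat_value slot_def complex_eq_iff)
qed (simp_all add: Re_divide Im_divide power2_eq_square)

text \<open>
  Both parts of the value are computed into the scratch slot before the target is written, since
  the expression may read the target.
\<close>

definition assign :: "nat \<Rightarrow> nexp \<Rightarrow> cexp \<Rightarrow> prog" where
  "assign a e x =
     Seq (SetCell (re_cell (array_slot 0 (NConst 0))) (re_part x))
    (Seq (SetCell (im_cell (array_slot 0 (NConst 0))) (im_part x))
    (Seq (SetCell (re_cell (array_slot a e)) (Cell (re_cell (array_slot 0 (NConst 0)))))
         (SetCell (im_cell (array_slot a e)) (Cell (im_cell (array_slot 0 (NConst 0)))))))"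

text \<open>
  Writes one pair of output cells, \<open>q\<^sub>2\<^sub>x = a\<^sub>x - 1\<close> and \<open>q\<^sub>2\<^sub>x\<^sub>+\<^sub>1 = b\<^sub>x\<^sub>+\<^sub>1\<close>, as the slot \<open>x\<close>; array
  \<open>a\<close> holds \<open>a\<^sub>x\<^sup>2\<close>.
\<close>

definition emit :: "nexp \<Rightarrow> nat \<Rightarrow> nat \<Rightarrow> prog" where
  "emit e a b = Seq (SetCell (re_cell e) (RSub (RSqrt (re_part (Entry a (NConst 0)))) ROne))
     (SetCell (im_cell e) (re_part (Entry b (NConst 0))))"

definition for_loop :: "nat \<Rightarrow> nexp \<Rightarrow> prog \<Rightarrow> prog" where
  "for_loop r n c = Seq (SetReg r (NConst 0))
     (While (NLess (Reg r) n) (Seq c (SetReg r (NAdd (Reg r) (NConst 1)))))"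

text \<open>
  Total correctness, as a weakest precondition on the view given by \<open>represents\<close>.
\<close>

definition wp :: "prog \<Rightarrow> (regs \<Rightarrow> roots \<Rightarrow> arrays \<Rightarrow> bool) \<Rightarrow> regs \<Rightarrow> roots \<Rightarrow> arrays \<Rightarrow> bool" where
  "wp c Q \<rho> R V \<longleftrightarrow> (\<forall>\<sigma>. represents \<sigma> \<rho> R V \<longrightarrow>
     (\<exists>\<tau> \<rho>' R' V'. exec c \<sigma> \<tau> \<and> represents \<tau> \<rho>' R' V' \<and> Q \<rho>' R' V'))"

definition put :: "arrays \<Rightarrow> nat \<Rightarrow> nat \<Rightarrow> complex \<Rightarrow> arrays" where
  "put V a i v = (\<lambda>b j. if b = a \<and> j = i then v else V b j)"

lemma put_simps [simp]:
  "put V a i v a = (V a)(i := v)" "b \<noteq> a \<Longrightarrow> put V a i v b = V b"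
  by (auto simp: put_def)

lemma wp_seq: "wp c (wp d Q) \<rho> R V \<Longrightarrow> wp (Seq c d) Q \<rho> R V"
  unfolding wp_def by (meson exec.Seq)

lemma wp_mono: "wp c P \<rho> R V \<Longrightarrow> (\<And>\<rho> R V. P \<rho> R V \<Longrightarrow> Q \<rho> R V) \<Longrightarrow> wp c Q \<rho> R V"
  unfolding wp_def by meson

lemma slot_update:
  "slot (\<rho>, m(2 * s := x, 2 * s + 1 := y)) j = (if j = s then Complex x y else slot (\<rho>', m) j)"
  by (auto simp: slot_def)

lemma array_slot_eq_iff:
  assumes "a < 16" "b < 16"
  shows "(n::nat) + 16 * i + a = n + 16 * j + b \<longleftrightarrow> i = j \<and> a = b"
proof
  assume "n + 16 * i + a = n + 16 * j + b"
  then have eq: "16 * i + a = 16 * j + b" by simp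
  have "(16 * i + a) div 16 = i" "(16 * j + b) div 16 = j" using assms by simp_all
  with eq show "i = j \<and> a = b" by simp
qed simp

lemma represents_put:
  assumes "represents \<sigma> \<rho> R V" "0 < a" "a < 16"
  shows "represents (fst \<sigma>, (snd \<sigma>)(2 * (\<rho> 0 + 16 * i + a) := Re v, 2 * (\<rho> 0 + 16 * i + a) + 1 := Im v))
    \<rho> R (put V a i v)"
  using assms unfolding represents_def slot_update[where \<rho>' = "fst \<sigma>"]
  by (auto simp: array_slot_eq_iff put_def)

lemma represents_scratch:
  assumes "represents \<sigma> \<rho> R V"
  shows "represents (fst \<sigma>, (snd \<sigma>)(2 * \<rho> 0 := x, 2 * \<rho> 0 + 1 := y)) \<rho> R V"
  using assms unfolding represents_def slot_update[where \<rho>' = "fst \<sigma>"] by auto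

lemma wp_assign:
  assumes x: "safe x \<rho>" and a: "0 < a" "a < 16"
    and Q: "Q \<rho> R (put V a (nat_value e \<rho>) (cexp_value x \<rho> R V))"
  shows "wp (assign a e x) Q \<rho> R V"
  unfolding wp_def
proof (intro allI impI)
  fix \<sigma> assume rep: "represents \<sigma> \<rho> R V"
  then have \<rho>: "fst \<sigma> = \<rho>" by (simp add: represents_def)
  define v where "v = cexp_value x \<rho> R V"
  define \<sigma>1 where "\<sigma>1 = (\<rho>, (snd \<sigma>)(2 * \<rho> 0 := Re v))"
  define \<sigma>2 where "\<sigma>2 = (\<rho>, (snd \<sigma>1)(2 * \<rho> 0 + 1 := Im v))"
  define s where "s = \<rho> 0 + 16 * nat_value e \<rho> + a"
  define \<sigma>3 where "\<sigma>3 = (\<rho>, (snd \<sigma>2)(2 * s := Re v))"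
  define \<sigma>4 where "\<sigma>4 = (\<rho>, (snd \<sigma>3)(2 * s + 1 := Im v))"
  have "\<sigma>1 = (fst \<sigma>, (snd \<sigma>)(2 * \<rho> 0 := Re v, 2 * \<rho> 0 + 1 := snd \<sigma> (2 * \<rho> 0 + 1)))"
    by (auto simp: \<sigma>1_def \<rho>)
  then have rep1: "represents \<sigma>1 \<rho> R V" using represents_scratch[OF rep] by simp
  have "\<sigma>2 = (fst \<sigma>, (snd \<sigma>)(2 * \<rho> 0 := Re v, 2 * \<rho> 0 + 1 := Im v))"
    by (simp add: \<sigma>2_def \<sigma>1_def \<rho>)
  then have rep2: "represents \<sigma>2 \<rho> R V" using represents_scratch[OF rep] by simp
  have "represents \<sigma>4 \<rho> R (put V a (nat_value e \<rho>) v)"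
    using represents_put[OF rep2 a, of "nat_value e \<rho>" v] by (simp add: \<sigma>4_def \<sigma>3_def s_def \<sigma>2_def)
  moreover have "exec (assign a e x) \<sigma> \<sigma>4"
    unfolding assign_def
  proof (intro exec.Seq)
    have "rval (re_part x) \<sigma> = Re v" unfolding v_def by (rule represents_parts(1)[OF rep x])
    then show "exec (SetCell (re_cell (array_slot 0 (NConst 0))) (re_part x)) \<sigma> \<sigma>1"
      using exec.SetCell[of "re_cell (array_slot 0 (NConst 0))" "re_part x" \<sigma>]
      by (simp add: nval_eq_nat_value \<rho> \<sigma>1_def)
    have "rval (im_part x) \<sigma>1 = Im v" unfolding v_def by (rule represents_parts(2)[OF rep1 x])
    then show "exec (SetCell (im_cell (array_slot 0 (NConst 0))) (im_part x)) \<sigma>1 \<sigma>2"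
      using exec.SetCell[of "im_cell (array_slot 0 (NConst 0))" "im_part x" \<sigma>1]
      by (simp add: nval_eq_nat_value \<sigma>2_def) (simp add: \<sigma>1_def)
    show "exec (SetCell (re_cell (array_slot a e)) (Cell (re_cell (array_slot 0 (NConst 0))))) \<sigma>2 \<sigma>3"
      using exec.SetCell[of "re_cell (array_slot a e)" "Cell (re_cell (array_slot 0 (NConst 0)))" \<sigma>2]
      by (simp add: nval_eq_nat_value \<sigma>3_def s_def) (simp add: \<sigma>2_def \<sigma>1_def)
    show "exec (SetCell (im_cell (array_slot a e)) (Cell (im_cell (array_slot 0 (NConst 0))))) \<sigma>3 \<sigma>4"
      using exec.SetCell[of "im_cell (array_slot a e)" "Cell (im_cell (array_slot 0 (NConst 0)))" \<sigma>3]
        a by (simp add: nval_eq_nat_value \<sigma>4_def s_def) (simp add: \<sigma>3_def \<sigma>2_def \<sigma>1_def s_def)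
  qed
  ultimately show "\<exists>\<tau> \<rho>' R' V'. exec (assign a e x) \<sigma> \<tau> \<and> represents \<tau> \<rho>' R' V' \<and> Q \<rho>' R' V'"
    using Q unfolding v_def by blast
qed

lemma wp_emit:
  assumes e: "nat_value e \<rho> < \<rho> 0" and ab: "0 < a" "a < 16" "0 < b" "b < 16"
    and Q: "Q \<rho> (R(nat_value e \<rho> := Complex (sqrt (Re (V a 0)) - 1) (Re (V b 0)))) V"
  shows "wp (emit e a b) Q \<rho> R V"
  unfolding wp_def
proof (intro allI impI)
  fix \<sigma> assume rep: "represents \<sigma> \<rho> R V"
  then have \<rho>: "fst \<sigma> = \<rho>" by (simp add: represents_def)
  define s x y where "s = nat_value e \<rho>" and "x = sqrt (Re (V a 0)) - 1" and "y = Re (V b 0)"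
  define \<sigma>1 where "\<sigma>1 = (\<rho>, (snd \<sigma>)(2 * s := x))"
  define \<sigma>2 where "\<sigma>2 = (\<rho>, (snd \<sigma>1)(2 * s + 1 := y))"
  have "represents \<sigma>2 \<rho> (R(s := Complex x y)) V"
    unfolding \<sigma>2_def \<sigma>1_def snd_conv represents_def slot_update[where \<rho>' = "fst \<sigma>"]
    using rep e by (auto simp: represents_def s_def)
  moreover have "exec (emit e a b) \<sigma> \<sigma>2"
    unfolding emit_def
  proof (rule exec.Seq)
    have "rval (re_part (Entry a (NConst 0))) \<sigma> = Re (V a 0)"
      using represents_parts(1)[OF rep, of "Entry a (NConst 0)"] ab by simp
    then show "exec (SetCell (re_cell e) (RSub (RSqrt (re_part (Entry a (NConst 0)))) ROne)) \<sigma> \<sigma>1"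
      using exec.SetCell[of "re_cell e" "RSub (RSqrt (re_part (Entry a (NConst 0)))) ROne" \<sigma>]
      by (simp add: nval_eq_nat_value \<rho> \<sigma>1_def s_def x_def)
    have "rval (re_part (Entry b (NConst 0))) \<sigma> = Re (V b 0)"
      using represents_parts(1)[OF rep, of "Entry b (NConst 0)"] ab by simp
    moreover have "rval (re_part (Entry b (NConst 0))) \<sigma>1 = rval (re_part (Entry b (NConst 0))) \<sigma>"
      using e by (simp add: nval_eq_nat_value \<rho> \<sigma>1_def s_def)
    ultimately show "exec (SetCell (im_cell e) (re_part (Entry b (NConst 0)))) \<sigma>1 \<sigma>2"
      using exec.SetCell[of "im_cell e" "re_part (Entry b (NConst 0))" \<sigma>1]
      by (simp add: nval_eq_nat_value \<sigma>2_def s_def y_def) (simp add: \<sigma>1_def)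
  qed
  ultimately show "\<exists>\<tau> \<rho>' R' V'. exec (emit e a b) \<sigma> \<tau> \<and> represents \<tau> \<rho>' R' V' \<and> Q \<rho>' R' V'"
    using Q unfolding s_def x_def y_def by blast
qed

lemma represents_reg:
  assumes "represents \<sigma> \<rho> R V" "r \<noteq> 0"
  shows "represents ((fst \<sigma>)(r := n), snd \<sigma>) (\<rho>(r := n)) R V"
  using assms by (simp add: represents_def slot_def)

lemma wp_for_loop:
  assumes r: "r \<noteq> 0" and init: "I 0 (\<rho>(r := 0)) R V"
    and bound: "\<And>i \<rho> R V. I i \<rho> R V \<Longrightarrow> nat_value n \<rho> = N"
    and step: "\<And>i \<rho> R V. I i \<rho> R V \<Longrightarrow> \<rho> r = i \<Longrightarrow> i < N \<Longrightarrow>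
       wp c (\<lambda>\<rho>' R' V'. \<rho>' r = i \<and> I (Suc i) (\<rho>'(r := Suc i)) R' V') \<rho> R V"
    and post: "\<And>\<rho> R V. I N \<rho> R V \<Longrightarrow> Q \<rho> R V"
  shows "wp (for_loop r n c) Q \<rho> R V"
  unfolding wp_def
proof (intro allI impI)
  fix \<sigma> assume rep: "represents \<sigma> \<rho> R V"
  let ?W = "While (NLess (Reg r) n) (Seq c (SetReg r (NAdd (Reg r) (NConst 1))))"
  have loop: "\<exists>\<tau> \<rho>' R' V'. exec ?W \<sigma> \<tau> \<and> represents \<tau> \<rho>' R' V' \<and> Q \<rho>' R' V'"
    if "represents \<sigma> \<rho> R V" "I i \<rho> R V" "\<rho> r = i" "i \<le> N" for \<sigma> \<rho> R V i
    using that
  proof (induction "N - i" arbitrary: i \<sigma> \<rho> R V)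
    case 0
    then have "i = N" by simp
    have "\<not> holds (NLess (Reg r) n) \<sigma>"
      using bound[OF 0(3)] 0 \<open>i = N\<close> by (simp add: nval_eq_nat_value represents_def)
    then have "exec ?W \<sigma> \<sigma>" by (rule exec.WhileFalse)
    then show ?case using 0 post \<open>i = N\<close> by blast
  next
    case (Suc d)
    then have "i < N" by simp
    from step[OF Suc.prems(2,3) this] Suc.prems(1)
    obtain \<tau> \<rho>' R' V' where t: "exec c \<sigma> \<tau>" "represents \<tau> \<rho>' R' V'" "\<rho>' r = i"
      "I (Suc i) (\<rho>'(r := Suc i)) R' V'" unfolding wp_def by blast
    define \<tau>' where "\<tau>' = ((fst \<tau>)(r := Suc i), snd \<tau>)"
    have "fst \<tau> r = i" using t by (simp add: represents_def)
    then have "exec (SetReg r (NAdd (Reg r) (NConst 1))) \<tau> \<tau>'"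
      using exec.SetReg[of r "NAdd (Reg r) (NConst 1)" \<tau>] by (simp add: \<tau>'_def)
    with t(1) have body: "exec (Seq c (SetReg r (NAdd (Reg r) (NConst 1)))) \<sigma> \<tau>'" by (rule exec.Seq)
    have d: "d = N - Suc i" using Suc.hyps(2) by simp
    have "represents \<tau>' (\<rho>'(r := Suc i)) R' V'"
      unfolding \<tau>'_def by (rule represents_reg[OF t(2) r])
    from Suc.hyps(1)[OF d this t(4) fun_upd_same Suc_leI[OF \<open>i < N\<close>]]
    obtain \<omega> \<rho>'' R'' V'' where w: "exec ?W \<tau>' \<omega>" "represents \<omega> \<rho>'' R'' V''" "Q \<rho>'' R'' V''"
      by blast
    have "holds (NLess (Reg r) n) \<sigma>"
      using bound[OF Suc.prems(2)] Suc.prems \<open>i < N\<close> by (simp add: nval_eq_nat_value represents_def)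
    then have "exec ?W \<sigma> \<omega>" using body w(1) by (rule exec.WhileTrue)
    with w show ?case by blast
  qed
  define \<sigma>' where "\<sigma>' = ((fst \<sigma>)(r := 0), snd \<sigma>)"
  have "exec (SetReg r (NConst 0)) \<sigma> \<sigma>'"
    using exec.SetReg[of r "NConst 0" \<sigma>] by (simp add: \<sigma>'_def)
  moreover have "represents \<sigma>' (\<rho>(r := 0)) R V"
    unfolding \<sigma>'_def by (rule represents_reg[OF rep r])
  from loop[OF this init] obtain \<tau> \<rho>' R' V' where
    "exec ?W \<sigma>' \<tau>" "represents \<tau> \<rho>' R' V'" "Q \<rho>' R' V'" by auto
  ultimately show "\<exists>\<tau> \<rho>' R' V'. exec (for_loop r n c) \<sigma> \<tau> \<and> represents \<tau> \<rho>' R' V' \<and> Q \<rho>' R' V'"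
    unfolding for_loop_def by (meson exec.Seq)
qed

section \<open>The algorithm\<close>

text \<open>
  Two arrays hold the coefficients of a polynomial and of its partner; the remaining
  variables are scalars, kept as entry 0 of an array.
\<close>

abbreviation (input) "v_alpha \<equiv> 1 :: nat"
abbreviation (input) "v_power \<equiv> 2 :: nat"
abbreviation (input) "v_sumA \<equiv> 3 :: nat"
abbreviation (input) "v_sumX \<equiv> 4 :: nat"
abbreviation (input) "v_ratio \<equiv> 5 :: nat"
abbreviation (input) "v_prevA \<equiv> 6 :: nat"
abbreviation (input) "v_prevX \<equiv> 7 :: nat"
abbreviation (input) "v_prevNew \<equiv> 8 :: nat"
abbreviation (input) "v_newA \<equiv> 9 :: nat"
abbreviation (input) "v_newX \<equiv> 10 :: nat"
abbreviation (input) "v_A \<equiv> 11 :: nat"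
abbreviation (input) "v_X \<equiv> 12 :: nat"
abbreviation (input) "v_c \<equiv> 13 :: nat"
abbreviation (input) "v_b \<equiv> 14 :: nat"

abbreviation (input) "scalar a \<equiv> Entry a (NConst 0)"
abbreviation (input) "set_scalar a x \<equiv> assign a (NConst 0) x"

text \<open>
  All polynomials have degree at most \<open>k\<close>.
\<close>

definition all_coeffs :: "prog \<Rightarrow> prog" where
  "all_coeffs c = for_loop 2 (NAdd (Reg 0) (NConst 1)) c"

definition eval_prog :: prog where
  "eval_prog = all_coeffs
     (Seq (set_scalar v_sumA (CAdd (scalar v_sumA) (CMul (Entry v_A (Reg 2)) (scalar v_power))))
     (Seq (set_scalar v_sumX (CAdd (scalar v_sumX) (CMul (Entry v_X (Reg 2)) (scalar v_power))))
          (set_scalar v_power (CMul (scalar v_power) (scalar v_alpha)))))"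

text \<open>
  Coefficients of \<open>(1 - \<alpha> z) P\<close> and of the quotient \<open>X' = (z X - g P) / (z - \<alpha>)\<close>, in ascending order. From
  \<open>(z - \<alpha>) X' = z X - g P\<close> the coefficient \<open>i\<close> of \<open>X'\<close> is obtained from its coefficient \<open>i - 1\<close>; the arrays are
  updated in place, so the old and new coefficients at \<open>i - 1\<close> are carried along in scalars.
\<close>

definition extend_prog :: prog where
  "extend_prog = all_coeffs
     (Seq (set_scalar v_newA (CSub (Entry v_A (Reg 2)) (CMul (scalar v_alpha) (scalar v_prevA))))
     (Seq (set_scalar v_newX (CDiv (CAdd (CSub (scalar v_prevNew) (scalar v_prevX))
             (CMul (scalar v_ratio) (Entry v_A (Reg 2)))) (scalar v_alpha)))
     (Seq (set_scalar v_prevA (Entry v_A (Reg 2)))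
     (Seq (set_scalar v_prevX (Entry v_X (Reg 2)))
     (Seq (set_scalar v_prevNew (scalar v_newX))
     (Seq (assign v_A (Reg 2) (scalar v_newA))
          (assign v_X (Reg 2) (scalar v_newX))))))))"

definition add_root_prog :: prog where
  "add_root_prog =
     Seq (set_scalar v_alpha (CDiv COne (Root (Reg 1))))
    (Seq (set_scalar v_power COne)
    (Seq (set_scalar v_sumA CZero)
    (Seq (set_scalar v_sumX CZero)
    (Seq eval_prog
    (Seq (set_scalar v_ratio (CDiv (CMul (scalar v_alpha) (scalar v_sumX)) (scalar v_sumA)))
    (Seq (set_scalar v_prevA CZero)
    (Seq (set_scalar v_prevX CZero)
    (Seq (set_scalar v_prevNew CZero)
         extend_prog))))))))"

text \<open>
  Replaces \<open>(A\<^sub>x, c A\<^sub>x\<^sub>+\<^sub>1)\<close> by \<open>(A\<^sub>x\<^sub>+\<^sub>1, a\<^sup>2 A\<^sub>x\<^sub>+\<^sub>2)\<close>. Entry \<open>i\<close> needs only entries \<open>i\<close> to \<open>i + 2\<close> of the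
  old arrays, so ascending order works in place.
\<close>

definition shift_prog :: prog where
  "shift_prog = all_coeffs
     (Seq (set_scalar v_newX (CSub (CSub (CAdd (CDiv (Entry v_X (NAdd (Reg 2) (NConst 2))) (scalar v_c))
                  (CDiv (Entry v_X (Reg 2)) (scalar v_c)))
             (CMul (scalar v_b) (CDiv (Entry v_X (NAdd (Reg 2) (NConst 1))) (scalar v_c))))
             (Entry v_A (NAdd (Reg 2) (NConst 2)))))
     (Seq (assign v_A (Reg 2) (CDiv (Entry v_X (Reg 2)) (scalar v_c)))
          (assign v_X (Reg 2) (scalar v_newX))))"

text \<open>
  The second array holds \<open>c A\<^sub>x\<^sub>+\<^sub>1\<close> with \<open>A\<^sub>x\<^sub>+\<^sub>1(0) = 1\<close>, so \<open>c\<close> is its entry 0. Except in the first round,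
  where \<open>c\<close> only normalises the partner, \<open>c = a\<^sub>x\<^sup>2\<close>.
\<close>

definition peel_prog :: prog where
  "peel_prog =
     Seq (set_scalar v_c (Entry v_X (NConst 0)))
    (Seq (set_scalar v_b (CSub (CDiv (Entry v_X (NConst 1)) (scalar v_c)) (Entry v_A (NConst 1))))
    (Seq (emit (Reg 1) v_c v_b)
         shift_prog))"

text \<open>
  The second loop runs \<open>k\<close> times. About \<open>k / 2\<close> rounds produce the entries of \<open>q\<close> up to \<open>k\<close>; after that the
  state is \<open>(1, 1)\<close>, and the further rounds write zeros.
\<close>

definition recover_prog :: prog where
  "recover_prog =
     Seq (assign v_A (NConst 0) COne)
    (Seq (assign v_X (NConst 0) COne)
    (Seq (for_loop 1 (Reg 0) add_root_prog)
         (for_loop 1 (Reg 0) peel_prog)))"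

lemma sum_coeffs_eq_poly:
  fixes P :: "complex poly"
  assumes "degree P < n"
  shows "(\<Sum>j<n. coeff P j * x ^ j) = poly P x"
  unfolding poly_altdef
  by (rule sum.mono_neutral_right) (use assms in \<open>auto simp: not_le coeff_eq_0\<close>)

lemma wp_eval:
  assumes "\<rho> 0 = k" "V v_A = coeff P" "V v_X = coeff X" "V v_alpha 0 = \<alpha>"
    and "V v_power 0 = 1" "V v_sumA 0 = 0" "V v_sumX 0 = 0" and deg: "degree P \<le> k" "degree X \<le> k"
    and Q: "\<And>V'. V' v_sumA 0 = poly P \<alpha> \<Longrightarrow> V' v_sumX 0 = poly X \<alpha> \<Longrightarrow>
       (\<And>a. a \<notin> {v_power, v_sumA, v_sumX} \<Longrightarrow> V' a = V a) \<Longrightarrow> Q (\<rho>(2 := k + 1)) R V'"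
  shows "wp eval_prog Q \<rho> R V"
  unfolding eval_prog_def all_coeffs_def
proof (rule wp_for_loop[where N = "k + 1" and I = "\<lambda>i \<rho>' R' V'. \<rho>' = \<rho>(2 := i) \<and> R' = R \<and>
    V' v_sumA 0 = (\<Sum>j<i. coeff P j * \<alpha> ^ j) \<and> V' v_sumX 0 = (\<Sum>j<i. coeff X j * \<alpha> ^ j) \<and>
    V' v_power 0 = \<alpha> ^ i \<and> (\<forall>a. a \<notin> {v_power, v_sumA, v_sumX} \<longrightarrow> V' a = V a)"], goal_cases)
  case (4 i \<rho>' R' V')
  then have V': "V' v_A = coeff P" "V' v_X = coeff X" "V' v_alpha 0 = \<alpha>" using assms by auto
  show ?case
    by (intro wp_seq wp_assign) (use 4 V' in \<open>auto simp: mult.commute\<close>)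
next
  case (5 \<rho>' R' V')
  have "V' v_sumA 0 = poly P \<alpha>"
    using 5 sum_coeffs_eq_poly[of P "k + 1" \<alpha>] deg by simp
  moreover have "V' v_sumX 0 = poly X \<alpha>"
    using 5 sum_coeffs_eq_poly[of X "k + 1" \<alpha>] deg by simp
  ultimately show ?case
    using Q[of V'] 5 by simp
qed (use assms in auto)

lemma wp_extend:
  assumes "\<rho> 0 = k" "V v_A = coeff P" "V v_X = coeff X" "V v_alpha 0 = \<alpha>" "V v_ratio 0 = g"
    and "V v_prevA 0 = 0" "V v_prevX 0 = 0" "V v_prevNew 0 = 0" and "\<alpha> \<noteq> 0"
    and X': "[:- \<alpha>, 1:] * X' = pCons 0 X - smult g P" and P': "P' = [:1, - \<alpha>:] * P"
    and deg: "degree P \<le> k" "degree X \<le> k" "degree P' \<le> k" "degree X' \<le> k"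
    and Q: "\<And>V'. V' v_A = coeff P' \<Longrightarrow> V' v_X = coeff X' \<Longrightarrow> Q (\<rho>(2 := k + 1)) R V'"
  shows "wp extend_prog Q \<rho> R V"
proof -
  have cP: "coeff P i - \<alpha> * coeff (pCons 0 P) i = coeff P' i" for i
    unfolding P' by (simp add: coeff_pCons split: nat.splits)
  have cX: "(coeff (pCons 0 X') i - coeff (pCons 0 X) i + g * coeff P i) / \<alpha> = coeff X' i" for i
  proof -
    have "coeff ([:- \<alpha>, 1:] * X') i = coeff (pCons 0 X - smult g P) i" by (simp only: X')
    then have "coeff (pCons 0 X') i - \<alpha> * coeff X' i = coeff (pCons 0 X) i - g * coeff P i" by simp
    then show ?thesis using \<open>\<alpha> \<noteq> 0\<close> by (simp add: field_simps)
  qed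
  show ?thesis
    unfolding extend_prog_def all_coeffs_def
  proof (rule wp_for_loop[where N = "k + 1" and I = "\<lambda>i \<rho>' R' V'. \<rho>' = \<rho>(2 := i) \<and> R' = R \<and>
      V' v_A = (\<lambda>j. if j < i then coeff P' j else coeff P j) \<and>
      V' v_X = (\<lambda>j. if j < i then coeff X' j else coeff X j) \<and>
      V' v_prevA 0 = coeff (pCons 0 P) i \<and> V' v_prevX 0 = coeff (pCons 0 X) i \<and>
      V' v_prevNew 0 = coeff (pCons 0 X') i \<and> V' v_alpha 0 = \<alpha> \<and> V' v_ratio 0 = g"], goal_cases)
    case (4 i \<rho>' R' V')
    show ?case
      by (intro wp_seq wp_assign)
        (use 4 cP[of i] cX[of i] in \<open>auto simp: fun_eq_iff less_Suc_eq\<close>)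
  next
    case (5 \<rho>' R' V')
    have "V' v_A = coeff P'" "V' v_X = coeff X'"
      using 5 deg by (auto simp: fun_eq_iff coeff_eq_0)
    then show ?case using Q 5 by simp
  qed (use assms in auto)
qed

lemma wp_add_root:
  assumes k: "\<rho> 0 = k" "\<rho> 1 < k" and c: "R (\<rho> 1) = c" "c \<noteq> 0" "poly P (inverse c) \<noteq> 0"
    and V: "V v_A = coeff P" "V v_X = coeff X"
    and deg: "degree P \<le> k" "degree X \<le> k"
      "degree (fst (add_root c (P, X))) \<le> k" "degree (snd (add_root c (P, X))) \<le> k"
    and Q: "\<And>V'. V' v_A = coeff (fst (add_root c (P, X))) \<Longrightarrow> V' v_X = coeff (snd (add_root c (P, X))) \<Longrightarrow>
       Q (\<rho>(2 := k + 1)) R V'"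
  shows "wp add_root_prog Q \<rho> R V"
proof -
  define \<alpha> where "\<alpha> = inverse c"
  have \<alpha>: "\<alpha> \<noteq> 0" "1 / c = \<alpha>" using c by (simp_all add: \<alpha>_def inverse_eq_divide)
  have fst: "fst (add_root c (P, X)) = [:1, - \<alpha>:] * P" by (simp add: add_root_def Let_def \<alpha>_def)
  note snd = add_root_quotient[OF c(3), of X, folded \<alpha>_def]
  have ext: "wp extend_prog Q \<rho>' R V'"
    if "\<rho>' = \<rho>(2 := k + 1)" "V' v_A = coeff P" "V' v_X = coeff X" "V' v_alpha 0 = \<alpha>"
      "V' v_ratio 0 = \<alpha> * poly X \<alpha> / poly P \<alpha>" "V' v_prevA 0 = 0" "V' v_prevX 0 = 0" "V' v_prevNew 0 = 0"
    for \<rho>' V'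
    by (rule wp_extend[where V = V' and k = k and \<alpha> = \<alpha> and P = P and X = X, OF _ that(2-8) \<alpha>(1) snd fst deg]) (use that(1) k Q in auto)
  have eval: "wp eval_prog (\<lambda>\<rho> R V. wp
      (Seq (set_scalar v_ratio (CDiv (CMul (scalar v_alpha) (scalar v_sumX)) (scalar v_sumA)))
      (Seq (set_scalar v_prevA CZero)
      (Seq (set_scalar v_prevX CZero)
      (Seq (set_scalar v_prevNew CZero) extend_prog)))) Q \<rho> R V) \<rho> R V'"
    if V': "V' v_A = coeff P" "V' v_X = coeff X" "V' v_alpha 0 = \<alpha>"
      "V' v_power 0 = 1" "V' v_sumA 0 = 0" "V' v_sumX 0 = 0" for V'
  proof (rule wp_eval[where \<rho> = \<rho> and V = V' and k = k and P = P and X = X and \<alpha> = \<alpha>, OF k(1) V' deg(1,2)])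
    fix W assume W: "W v_sumA 0 = poly P \<alpha>" "W v_sumX 0 = poly X \<alpha>"
      "\<And>a. a \<notin> {v_power, v_sumA, v_sumX} \<Longrightarrow> W a = V' a"
    have W': "W v_A = coeff P" "W v_X = coeff X" "W v_alpha 0 = \<alpha>"
      using W(3)[of v_A] W(3)[of v_X] W(3)[of v_alpha] V' by auto
    show "wp
      (Seq (set_scalar v_ratio (CDiv (CMul (scalar v_alpha) (scalar v_sumX)) (scalar v_sumA)))
      (Seq (set_scalar v_prevA CZero)
      (Seq (set_scalar v_prevX CZero)
      (Seq (set_scalar v_prevNew CZero) extend_prog)))) Q (\<rho>(2 := k + 1)) R W"
      by (intro wp_seq wp_assign ext) (use W W' in auto)
  qed
  show ?thesis
    unfolding add_root_prog_def
    by (intro wp_seq wp_assign eval) (use k V c(1) \<alpha>(2) in auto)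
qed

lemma wp_shift:
  assumes "\<rho> 0 = k" "V v_A = coeff P" "V v_X = coeff (smult c X)" "V v_c 0 = c" "V v_b 0 = b" "c \<noteq> 0"
    and rec: "P = [:1, - b, 1:] * X - smult d ([:0, 0, 1:] * Y)"
    and deg: "degree P \<le> k" "degree X \<le> k" "degree Y \<le> k"
    and Q: "\<And>V'. V' v_A = coeff X \<Longrightarrow> V' v_X = coeff (smult d Y) \<Longrightarrow> Q (\<rho>(2 := k + 1)) R V'"
  shows "wp shift_prog Q \<rho> R V"
proof -
  have cY: "coeff X (Suc (Suc i)) + coeff X i - b * coeff X (Suc i) - coeff P (Suc (Suc i)) = d * coeff Y i" for i
    unfolding rec coeff_jost_step by simp
  show ?thesis
    unfolding shift_prog_def all_coeffs_def
  proof (rule wp_for_loop[where N = "k + 1" and I = "\<lambda>i \<rho>' R' V'. \<rho>' = \<rho>(2 := i) \<and> R' = R \<and>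
      V' v_A = (\<lambda>j. if j < i then coeff X j else coeff P j) \<and>
      V' v_X = (\<lambda>j. if j < i then d * coeff Y j else c * coeff X j) \<and>
      V' v_c 0 = c \<and> V' v_b 0 = b"], goal_cases)
    case (4 i \<rho>' R' V')
    show ?case
      by (intro wp_seq wp_assign)
        (use 4 cY[of i] \<open>c \<noteq> 0\<close> in \<open>auto simp: fun_eq_iff less_Suc_eq\<close>)
  next
    case (5 \<rho>' R' V')
    have "V' v_A = coeff X" "V' v_X = coeff (smult d Y)"
      using 5 deg by (auto simp: fun_eq_iff coeff_eq_0)
    then show ?case using Q 5 by simp
  qed (use assms in \<open>auto simp: fun_eq_iff\<close>)
qed

lemma jost_factors_degree_le:
  assumes "q \<in> pert_class k" "jost_factors q A"
  shows "degree (A x) \<le> k"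
proof (cases "2 * x < k")
  case True
  with jost_factors_degree[OF assms] show ?thesis by simp
next
  case False
  then have "(k + 1) div 2 \<le> x" by simp
  from jost_factors_tail_1[OF assms this] show ?thesis by simp
qed

lemma wp_add_roots:
  assumes q: "q \<in> pert_class k" and A: "jost_factors q A" and r: "mset r = proots (cpoly (A 0))"
    and k: "length r = k" and \<rho>: "\<rho> 0 = k" and R: "\<And>j. j < k \<Longrightarrow> R j = r ! j"
    and V: "V v_A = coeff 1" "V v_X = coeff 1"
    and Q: "\<And>\<rho>' V'. \<rho>' 0 = k \<Longrightarrow> V' v_A = coeff (cpoly (A 0)) \<Longrightarrow>
      V' v_X = coeff (snd (fold add_root r (1, 1))) \<Longrightarrow> Q \<rho>' R V'"
  shows "wp (for_loop 1 (Reg 0) add_root_prog) Q \<rho> R V"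
proof -
  have A0: "coeff (A 0) 0 = 1" by (rule jost_factors_coeff_0[OF A])
  note roots = add_roots[OF jost_factors_admissible[OF q A] A0 r, unfolded k]
  define F where "F t = fold add_root (take t r) (1, 1)" for t
  have fstF: "fst (F t) = normalised_root_poly (take t r)" if "t \<le> k" for t
    using roots(1)[OF that] by (simp add: F_def)
  have deg1: "degree (fst (F t)) \<le> k" if "t \<le> k" for t
    using normalised_root_poly_degree[of "take t r"] that k by (simp add: fstF)
  have deg2: "degree (snd (F t)) \<le> k" if "t \<le> k" for t
    using has_wronskian_degree[OF roots(2)[OF that]] deg1[OF that] fstF[OF that]
    by (simp add: F_def poly_0_coeff_0 normalised_root_poly_coeff_0)
  have r0: "c \<noteq> 0" if "c \<in> set r" for c
  proof
    assume "c = 0"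
    have "c \<in># mset r" using that by simp
    then have "c \<in># proots (cpoly (A 0))" by (simp only: r)
    moreover have "A 0 \<noteq> 0" using A0 by auto
    ultimately have "poly (cpoly (A 0)) 0 = 0" using \<open>c = 0\<close> by simp
    then show False using A0 by (simp add: poly_0_coeff_0)
  qed
  show ?thesis
  proof (rule wp_for_loop[where N = k and I = "\<lambda>t \<rho>' R' V'. \<rho>' 0 = k \<and> R' = R \<and>
      V' v_A = coeff (fst (F t)) \<and> V' v_X = coeff (snd (F t))"], goal_cases)
    case (4 t \<rho>' R' V')
    have take: "F (Suc t) = add_root (r ! t) (F t)"
      using 4(3) k by (simp add: F_def take_Suc_conv_app_nth)
    show ?case
    proof (rule wp_add_root[of _ k _ "r ! t" "fst (F t)" _ "snd (F t)"], goal_cases)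
      case 5
      then show ?case using roots(3)[of t] fstF[of t] 4 by simp
    next
      case 4
      then show ?case using r0[of "r ! t"] \<open>t < k\<close> k by simp
    qed (use 4 R k deg1[of t] deg2[of t] deg1[of "Suc t"] deg2[of "Suc t"] take in auto)
  next
    case (5 \<rho>' R' V')
    have "fst (F k) = cpoly (A 0)"
      using fstF[of k] normalised_root_poly_eq[OF r A0] k by simp
    then show ?case using 5 Q[of \<rho>' V'] k by (simp add: F_def)
  qed (use \<rho> V in \<open>auto simp: F_def\<close>)
qed

text \<open>
  The real part of slot 0 comes from the normalising constant of the partner and carries no entry of \<open>q\<close>.
\<close>

lemma wp_peel:
  assumes q: "q \<in> pert_class k" and A: "jost_factors q A" and \<rho>: "\<rho> 0 = k"
    and c: "c > 0" and V: "V v_A = coeff (cpoly (A 0))" "V v_X = coeff (smult (of_real c) (cpoly (A 1)))"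
    and Q: "\<And>\<rho>' R' V'. \<rho>' 0 = k \<Longrightarrow> (\<And>x. x < k \<Longrightarrow> Im (R' x) = q (2 * x + 1)) \<Longrightarrow>
      (\<And>x. 0 < x \<Longrightarrow> x < k \<Longrightarrow> Re (R' x) = q (2 * x)) \<Longrightarrow> Q \<rho>' R' V'"
  shows "wp (for_loop 1 (Reg 0) peel_prog) Q \<rho> R V"
proof -
  define C where "C x = (if x = 0 then c else (jacobi_a q x)\<^sup>2)" for x
  have a: "jacobi_a q x > 0" for x by (rule pert_class_a_pos[OF q])
  have C: "C x > 0" for x using c a[of x] by (simp add: C_def)
  show ?thesis
  proof (rule wp_for_loop[where N = k and I = "\<lambda>x \<rho>' R' V'. \<rho>' 0 = k \<and>
      V' v_A = coeff (cpoly (A x)) \<and> V' v_X = coeff (smult (of_real (C x)) (cpoly (A (Suc x)))) \<and>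
      (\<forall>y<x. Im (R' y) = q (2 * y + 1)) \<and> (\<forall>y<x. 0 < y \<longrightarrow> Re (R' y) = q (2 * y))"], goal_cases)
    case (4 x \<rho>' R' V')
    define b where "b = jacobi_b q (Suc x)"
    have A1: "coeff (A (Suc x)) 0 = 1" "coeff (A x) 0 = 1" by (simp_all add: jost_factors_coeff_0[OF A])
    have "coeff (A x) (Suc 0) = coeff (A (Suc x)) 1 - b * coeff (A (Suc x)) 0"
      unfolding b_def by (subst jost_factors_rec[OF A, of x]) (rule coeff_jost_step)
    then have bq: "coeff (A (Suc x)) (Suc 0) - coeff (A x) (Suc 0) = b" by (simp add: A1)
    then have bq': "complex_of_real (coeff (A (Suc x)) (Suc 0)) - of_real (coeff (A x) (Suc 0)) = of_real b"
      by (simp flip: of_real_diff)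
    have rec: "cpoly (A x) = [:1, - of_real b, 1:] * cpoly (A (Suc x))
        - smult (of_real (C (Suc x))) ([:0, 0, 1:] * cpoly (A (Suc (Suc x))))"
      by (subst jost_factors_rec[OF A, of x])
        (simp only: cpoly_diff cpoly_mult cpoly_smult cpoly_pCons C_def b_def of_real_minus of_real_1 of_real_0 map_poly_0 if_False nat.distinct simp_thms)
    have sq: "sqrt (C x) - 1 = q (2 * x)" if "0 < x"
      using that a[of x] by (simp add: C_def jacobi_a_def)
    have bx: "b = q (2 * x + 1)" by (simp add: b_def jacobi_b_def)
    have shift: "wp shift_prog (\<lambda>\<rho>' R' V'. \<rho>' (1::nat) = x \<and> \<rho>' 0 = k \<and>
        V' v_A = coeff (cpoly (A (Suc x))) \<and> V' v_X = coeff (smult (of_real (C (Suc x))) (cpoly (A (Suc (Suc x))))) \<and>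
        (\<forall>y<Suc x. Im (R' y) = q (2 * y + 1)) \<and> (\<forall>y<Suc x. 0 < y \<longrightarrow> Re (R' y) = q (2 * y))) \<rho>' R2 V2"
      if "V2 v_A = coeff (cpoly (A x))" "V2 v_X = coeff (smult (of_real (C x)) (cpoly (A (Suc x))))"
        "V2 v_c 0 = of_real (C x)" "V2 v_b 0 = of_real b"
        "R2 = R'(x := Complex (sqrt (C x) - 1) b)" for R2 V2
      by (rule wp_shift[OF _ that(1-4) _ rec, where k = k])
        (use 4 that(5) sq bx C[of x] jost_factors_degree_le[OF q A] in \<open>auto simp: less_Suc_eq\<close>)
    show ?case
      unfolding peel_prog_def
      by (intro wp_seq wp_assign wp_emit wp_mono[OF shift])
        (use 4 A1 bq' C[of x] in \<open>auto\<close>)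
  next
    case (5 \<rho>' R' V')
    then show ?case using Q[of \<rho>' R' V'] by simp
  qed (use \<rho> V in \<open>auto simp: C_def\<close>)
qed

text \<open>
  The partner computed from the roots is a multiple of \<open>A\<^sub>1\<close> by uniqueness, which is the state that
  the second loop expects. The output cell \<open>x\<close> is a part of slot \<open>x div 2\<close>, which is below \<open>k\<close> for \<open>1 \<le> x \<le> k\<close>.
\<close>

lemma recover_prog_correct:
  assumes "k \<ge> 1" and q: "q \<in> pert_class k" and r: "mset r = jost_roots k q"
  shows "outputs recover_prog r q"
proof -
  obtain A where A: "jost_factors q A" using jost_factors_exist[OF q] by blast
  have r': "mset r = proots (cpoly (A 0))" using r jost_roots_eq[OF q A] by simp
  have A0: "coeff (A 0) 0 = 1" by (rule jost_factors_coeff_0[OF A])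
  have len: "length r = k"
    using size_proots_complex[of "cpoly (A 0)"] jost_factors_degree[OF q A, of 0] assms(1) r'
    by (metis degree_cpoly diff_zero less_le_trans mult_0_right size_mset zero_less_one)
  obtain C where C: "C > 0" "has_wronskian (cpoly (A 0)) (pCons 0 (cpoly (A 1))) (of_real C)"
    using jost_factors_wronskian[OF pert_class_a_pos[OF q] A, of 0] by auto
  define X where "X = snd (fold add_root r (1, 1))"
  have "has_wronskian (cpoly (A 0)) (pCons 0 X) 1"
    using add_roots(2)[OF jost_factors_admissible[OF q A] A0 r', of "length r"] normalised_root_poly_eq[OF r' A0]
    by (simp add: X_def)
  from has_wronskian_unique[OF this C(2)] have "smult (of_real C) X = cpoly (A 1)"
    using A0 by (simp add: poly_0_coeff_0)
  then have X: "X = smult (of_real (inverse C)) (cpoly (A 1))"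
    using C(1) by (metis left_inverse less_irrefl of_real_1 of_real_mult smult_1_left smult_smult)
  define \<rho> :: regs where "\<rho> = (\<lambda>i. if i = 0 then k else 0)"
  define R :: roots where "R = (\<lambda>j. r ! j)"
  have rep: "represents (input_store r) \<rho> R (\<lambda>_ _. 0)"
    unfolding represents_def input_store_def slot_def \<rho>_def R_def
    using len by (auto simp: complex_eq_iff)
  have "wp recover_prog (\<lambda>\<rho>' R' V'. \<rho>' 0 = k \<and> (\<forall>x<k. Im (R' x) = q (2 * x + 1)) \<and>
      (\<forall>x<k. 0 < x \<longrightarrow> Re (R' x) = q (2 * x))) \<rho> R (\<lambda>_ _. 0)"
    unfolding recover_prog_def
  proof (intro wp_seq wp_assign)
    show "wp (for_loop 1 (Reg 0) add_root_prog) (wp (for_loop 1 (Reg 0) peel_prog)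
       (\<lambda>\<rho>' R' V'. \<rho>' 0 = k \<and> (\<forall>x<k. Im (R' x) = q (2 * x + 1)) \<and>
      (\<forall>x<k. 0 < x \<longrightarrow> Re (R' x) = q (2 * x)))) \<rho> R
       (put (put (\<lambda>_ _. 0) v_A (nat_value (NConst 0) \<rho>) (cexp_value COne \<rho> R (\<lambda>_ _. 0))) v_X (nat_value (NConst 0) \<rho>)
         (cexp_value COne \<rho> R (put (\<lambda>_ _. 0) v_A (nat_value (NConst 0) \<rho>) (cexp_value COne \<rho> R (\<lambda>_ _. 0)))))"
    proof (rule wp_add_roots[OF q A r' len])
      fix \<rho>' :: regs and V' :: arrays
      assume "\<rho>' 0 = k" "V' v_A = coeff (cpoly (A 0))" "V' v_X = coeff (snd (fold add_root r (1, 1)))"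
      then show "wp (for_loop 1 (Reg 0) peel_prog)
       (\<lambda>\<rho>' R' V'. \<rho>' 0 = k \<and> (\<forall>x<k. Im (R' x) = q (2 * x + 1)) \<and>
      (\<forall>x<k. 0 < x \<longrightarrow> Re (R' x) = q (2 * x))) \<rho>' R V'"
        by (intro wp_peel[OF q A, of _ "inverse C"]) (use C(1) X in \<open>auto simp: X_def\<close>)
    qed (auto simp: \<rho>_def R_def fun_eq_iff coeff_1)
  qed auto
  with rep obtain \<tau> \<rho>' R' V' where t: "exec recover_prog (input_store r) \<tau>" "represents \<tau> \<rho>' R' V'"
    "\<rho>' 0 = k" "\<forall>x<k. Im (R' x) = q (2 * x + 1)" "\<forall>x<k. 0 < x \<longrightarrow> Re (R' x) = q (2 * x)"
    unfolding wp_def by blast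
  have slots: "slot \<tau> j = R' j" if "j < k" for j using t(2,3) that by (simp add: represents_def)
  have "snd \<tau> x = q x" if x: "x \<in> {1..k}" for x
  proof (cases "even x")
    case True
    then obtain j where j: "x = 2 * j" by blast
    then have "0 < j" "j < k" using x by auto
    then have "Re (slot \<tau> j) = q (2 * j)" using t(5) slots by simp
    then show ?thesis by (simp add: slot_def j)
  next
    case False
    then obtain j where j: "x = 2 * j + 1" by (elim oddE)
    then have "j < k" using x by auto
    then have "Im (slot \<tau> j) = q (2 * j + 1)" using t(4) slots by simp
    then show ?thesis by (simp add: slot_def j)
  qed
  then show ?thesis unfolding outputs_def len using t(1) by blast
qed

theorem theorem1p4:
  shows "(\<forall>k\<ge>1. bij_betw (jost_roots k) (pert_class k) (root_class k)) \<and>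
    (\<exists>c. \<forall>k\<ge>1. \<forall>q\<in>pert_class k. \<forall>r. mset r = jost_roots k q \<longrightarrow> outputs c r q)"
  using bij_betw_jost_roots recover_prog_correct by blast

end
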